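(* Fix integers $0\le k<m$, $n,q\ge1$, $0\le l<r$. Let $\sigma_z:I^m\to J^r(\mathbb R^m,\mathbb R^n)$, $z\in I^q$, be a smooth family of sections such that $\sigma_z=0$ on an open neighborhood of $\partial I^m$, $\sigma^{(l)}_z=0$ on all of $I^m$, and $\sigma_z=0$ on all of $I^m$ for $z$ in an open neighborhood of $\partial I^q$. Then for every $\varepsilon>0$ there exist a family of isotopies $F^z_t:I^m\to I^m$ and a family of holonomic sections $\hat\sigma_z$ such that: $\mathrm{dist}_{C^0}(\hat\sigma_z,\sigma_z)<\varepsilon$ on an open neighborhood of $F^z_1(I^k)$; $\|\hat\sigma^{(l)}_z\|_{C^0}<\varepsilon$ on $I^m$; $\mathrm{dist}_{C^0}(F^z_t,\mathrm{id})<\varepsilon$; $F^z_t=\mathrm{id}$ and $\hat\sigma_z=0$ on an open neighborhood of $\partial I^m$; and $F^z_t=\mathrm{id}$ and $\hat\sigma_z=0$ on all of $I^m$ for $z$ in an open neighborhood of $\partial I^q$.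
   Context: $I=[-1,1]$, $I^k=I^k\times\{0\}^{m-k}\subset I^m$. $J^r(\mathbb R^m,\mathbb R^n)\cong\mathbb R^m\times(\mathcal P_r)^n$ via Taylor polynomials of degree $\le r$, with linear structure from $\mathbb R^n$; $0$ is the jet of the zero map; $\sigma^{(l)}$ is the $l$-jet component. Holonomic means of the form $j^r(h)$. *)

theory Defs
  imports "HOL-Analysis.Analysis"
begin

definition icube :: "(real^'a) set" where
  "icube = {x. \<forall>i. \<bar>x $ i\<bar> \<le> 1}"

text \<open>The coordinate sub-cube I^k x {0}^(m-k), the k "first" coordinates being the set K.\<close>
definition isubcube :: "'a set \<Rightarrow> (real^'a) set" where
  "isubcube K = {x \<in> icube. \<forall>i. i \<notin> K \<longrightarrow> x $ i = 0}"

fun Ck :: "nat \<Rightarrow> 'a::real_normed_vector set \<Rightarrow> ('a \<Rightarrow> 'b::real_normed_vector) \<Rightarrow> bool" where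
  "Ck 0 S f = continuous_on S f"
| "Ck (Suc k) S f = (\<exists>f'. (\<forall>x\<in>S. (f has_derivative f' x) (at x)) \<and> (\<forall>v. Ck k S (\<lambda>x. f' x v)))"

definition smooth_on :: "'a::real_normed_vector set \<Rightarrow> ('a \<Rightarrow> 'b::real_normed_vector) \<Rightarrow> bool" where
  "smooth_on S f = (open S \<and> (\<forall>k. Ck k S f))"

definition smooth_near :: "'a::real_normed_vector set \<Rightarrow> ('a \<Rightarrow> 'b::real_normed_vector) \<Rightarrow> bool" where
  "smooth_near A f = (\<exists>S. open S \<and> A \<subseteq> S \<and> smooth_on S f)"

definition partial :: "'m \<Rightarrow> (real^'m \<Rightarrow> real) \<Rightarrow> real^'m \<Rightarrow> real" where
  "partial i f x = frechet_derivative f (at x) (axis i 1)"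

definition coord_list :: "'m::finite list" where
  "coord_list = (SOME xs. distinct xs \<and> set xs = UNIV)"

definition hpartial :: "('m::finite \<Rightarrow> nat) \<Rightarrow> (real^'m \<Rightarrow> real) \<Rightarrow> real^'m \<Rightarrow> real" where
  "hpartial \<alpha> f = foldr (\<lambda>i g. (partial i ^^ \<alpha> i) g) coord_list f"

definition mdeg :: "('m::finite \<Rightarrow> nat) \<Rightarrow> nat" where
  "mdeg \<alpha> = sum \<alpha> UNIV"

text \<open>A point of the fibre of J^r(R^m,R^n) over x: the derivative data
  s alpha j = (d^alpha f_j)(x) for |alpha| <= r, j < n (components with |alpha| > r are ignored).
  (Equivalent to the Taylor coefficients up to the factors alpha!.)\<close>
type_synonym ('m, 'n) jetfib = "('m \<Rightarrow> nat) \<Rightarrow> 'n \<Rightarrow> real"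

definition jet :: "(real^'m::finite \<Rightarrow> real^'n) \<Rightarrow> real^'m \<Rightarrow> ('m, 'n) jetfib" where
  "jet h x = (\<lambda>\<alpha> j. hpartial \<alpha> (\<lambda>y. h y $ j) x)"

definition jnorm :: "nat \<Rightarrow> ('m::finite, 'n::finite) jetfib \<Rightarrow> real" where
  "jnorm l s = (\<Sum>\<alpha>\<in>{\<alpha>. mdeg \<alpha> \<le> l}. \<Sum>j\<in>UNIV. \<bar>s \<alpha> j\<bar>)"

definition jdist :: "nat \<Rightarrow> ('m::finite, 'n::finite) jetfib \<Rightarrow> ('m, 'n) jetfib \<Rightarrow> real" where
  "jdist r s t = jnorm r (\<lambda>\<alpha> j. s \<alpha> j - t \<alpha> j)"

end

theory Submission
  imports Defs
begin

text \<open>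
  Only one direction \<open>i0\<close> outside \<open>K\<close> is used: the isotopy pushes the hyperplane \<open>x $ i0 = 0\<close> along
  \<open>i0\<close> onto a graph \<open>x $ i0 = W (z, x)\<close>, with \<open>W\<close> independent of \<open>x $ i0\<close>, so that compositions of such
  isotopies just add the heights. The orders \<open>d = l + 1, \<dots>, r\<close> are corrected one after the other by
  functions that are small in \<open>C\<close>-norm of order \<open>d - 1\<close> everywhere and whose derivatives of order \<open>d\<close> are
  prescribed on a slightly perturbed graph; higher derivatives are left to the later steps.

  For a single order \<open>d = a + b\<close>, let \<open>Y = x $ i0 - W0\<close> and let \<open>v\<close> be a horizontal vector. The function
  \<open>N ^ - d * c * (A1 (N * (v \<bullet> x)) * C1 (N * Y) + A2 (N * (v \<bullet> x)) * C2 (N * Y))\<close> has derivative of order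
  \<open>d\<close> close to \<open>c\<close> times (multiples of) \<open>v ^ a * dY ^ b\<close> wherever the profile selected by the height \<open>N * Y\<close>
  is a unit monomial. The periodic profiles \<open>A1\<close>, \<open>A2\<close> fail near half-integers and near integers
  respectively, so the graph \<open>N * Y = L * cos (2 * pi * N * (v \<bullet> x))\<close> avoids both bad sets; the errors are
  \<open>O (1 / L) + O (1 / N)\<close>. Polarization expresses every symmetric tensor through such powers, and descending
  induction on the exponent of \<open>i0\<close> takes care of the dependence of \<open>dY\<close> on the graph.
\<close>

section \<open>Calculus of smooth functions\<close>

text \<open>Boundedness of the profiles is what lets the factor \<open>N ^ - d\<close> reduce all
  derivatives of order below \<open>d\<close> to \<open>O (1 / N)\<close>. But a bounded function
  cannot be a unit monomial of positive degree on the whole line, so every profile has bad places,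
  and the height must select another profile there. The selection happens in the variable
  \<open>N * Y / L\<close>: each derivative spent on it beyond the \<open>b\<close> wanted ones
  costs a factor \<open>1 / L\<close>, while terms with fewer than \<open>b\<close> vanish exactly
  on the graph, since a unit monomial of degree \<open>a\<close> is then differentiated more than
  \<open>a\<close> times. \<open>L\<close> is fixed before \<open>N\<close>, so the graph moves only
  by \<open>L / N\<close> although its slope is of order \<open>L\<close>: it is close to the old
  graph in C^0 and in nothing stronger, which is the closeness that the theorem asks of the isotopy.
  A steep graph has a new \<open>dY\<close>, so realizability is established for all admissible
  graphs. What is achieved on one graph survives on the next, because the functions are fixed before
  the next displacement is chosen.\<close>

lemma Ck_cong:
  assumes "Ck k S f" "open S" "\<And>x. x \<in> S \<Longrightarrow> f x = g x"
  shows "Ck k S g"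
proof (cases k)
  case 0
  then show ?thesis using assms by (simp cong: continuous_on_cong)
next
  case (Suc n)
  then obtain f' where f': "\<forall>x\<in>S. (f has_derivative f' x) (at x)" "\<forall>v. Ck n S (\<lambda>x. f' x v)"
    using assms by auto
  have "\<forall>x\<in>S. (g has_derivative f' x) (at x)"
    using f'(1) assms(2,3) by (metis has_derivative_transform_within_open)
  with f'(2) Suc show ?thesis by auto
qed

lemma Ck_SucE:
  assumes "Ck (Suc k) S f"
  obtains f' where "\<And>x. x \<in> S \<Longrightarrow> (f has_derivative f' x) (at x)" "\<And>v. Ck k S (\<lambda>x. f' x v)"
  using assms by auto

lemma Ck_SucI:
  "(\<And>x. x \<in> S \<Longrightarrow> (f has_derivative f' x) (at x)) \<Longrightarrow> (\<And>v. Ck k S (\<lambda>x. f' x v)) \<Longrightarrow> Ck (Suc k) S f"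
  unfolding Ck.simps by blast

lemma Ck_continuous_on: "Ck k S f \<Longrightarrow> continuous_on S f"
  by (cases k) (auto intro!: continuous_at_imp_continuous_on, metis has_derivative_continuous)

lemma Ck_Suc_imp: "Ck (Suc k) S f \<Longrightarrow> Ck k S f"
proof (induction k arbitrary: f)
  case 0
  then show ?case using Ck_continuous_on[OF 0] by simp
next
  case (Suc k)
  from Suc.prems(1) obtain f' where f': "\<And>x. x \<in> S \<Longrightarrow> (f has_derivative f' x) (at x)"
      "\<And>v. Ck (Suc k) S (\<lambda>x. f' x v)"
    by (rule Ck_SucE) blast
  show ?case by (rule Ck_SucI[OF f'(1) Suc.IH[OF f'(2)]])
qed

lemma Ck_const: "Ck k S (\<lambda>x. c)"
proof (induction k arbitrary: c)
  case (Suc k)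
  show ?case by (rule Ck_SucI[of _ _ "\<lambda>x v. 0"]) (auto simp: Suc)
qed simp

lemma Ck_bounded_linear: "bounded_linear T \<Longrightarrow> Ck k S T"
  by (cases k) (auto simp del: Ck.simps(2) intro!: Ck_SucI[of _ _ "\<lambda>x. T"] Ck_const
      bounded_linear_imp_has_derivative linear_continuous_on)

lemma Ck_add: "Ck k S f \<Longrightarrow> Ck k S g \<Longrightarrow> Ck k S (\<lambda>x. f x + g x)"
proof (induction k arbitrary: f g)
  case 0
  then show ?case by (simp add: continuous_on_add)
next
  case (Suc k)
  from Suc.prems(1) obtain f' where f': "\<And>x. x \<in> S \<Longrightarrow> (f has_derivative f' x) (at x)"
      "\<And>v. Ck k S (\<lambda>x. f' x v)"
    by (rule Ck_SucE) blast
  from Suc.prems(2) obtain g' where g': "\<And>x. x \<in> S \<Longrightarrow> (g has_derivative g' x) (at x)"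
      "\<And>v. Ck k S (\<lambda>x. g' x v)"
    by (rule Ck_SucE) blast
  show ?case
    by (rule Ck_SucI[OF has_derivative_add[OF f'(1) g'(1)] Suc.IH[OF f'(2) g'(2)]])
qed

lemma (in bounded_bilinear) Ck_prod:
  "Ck k S f \<Longrightarrow> Ck k S g \<Longrightarrow> Ck k S (\<lambda>x. prod (f x) (g x))"
proof (induction k arbitrary: f g)
  case 0
  then show ?case by (simp add: continuous_on)
next
  case (Suc k)
  from Suc.prems(1) obtain f' where f': "\<And>x. x \<in> S \<Longrightarrow> (f has_derivative f' x) (at x)"
      "\<And>v. Ck k S (\<lambda>x. f' x v)"
    by (rule Ck_SucE) blast
  from Suc.prems(2) obtain g' where g': "\<And>x. x \<in> S \<Longrightarrow> (g has_derivative g' x) (at x)"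
      "\<And>v. Ck k S (\<lambda>x. g' x v)"
    by (rule Ck_SucE) blast
  show ?case
    using Suc.prems[THEN Ck_Suc_imp]
    by (intro Ck_SucI[OF FDERIV[OF f'(1) g'(1)] Ck_add] Suc.IH f'(2) g'(2))
qed

lemmas Ck_mult = bounded_bilinear.Ck_prod[OF bounded_bilinear_mult]
lemmas Ck_scaleR = bounded_bilinear.Ck_prod[OF bounded_bilinear_scaleR]

lemma Ck_sum: "(\<And>i. i \<in> I \<Longrightarrow> Ck k S (f i)) \<Longrightarrow> Ck k S (\<lambda>x. \<Sum>i\<in>I. f i x)"
  by (induction I rule: infinite_finite_induct) (auto intro!: Ck_const Ck_add)

lemma Ck_compose_linear:
  "Ck k S f \<Longrightarrow> bounded_linear T \<Longrightarrow> Ck k S (\<lambda>x. T (f x))"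
proof (induction k arbitrary: f)
  case 0
  then show ?case by (simp add: linear_continuous_on_compose bounded_linear.continuous_on)
next
  case (Suc k)
  from Suc.prems(1) obtain f' where f': "\<And>x. x \<in> S \<Longrightarrow> (f has_derivative f' x) (at x)"
      "\<And>v. Ck k S (\<lambda>x. f' x v)"
    by (rule Ck_SucE) blast
  show ?case
    by (rule Ck_SucI[OF bounded_linear.has_derivative[OF Suc.prems(2) f'(1)] Suc.IH[OF f'(2) Suc.prems(2)]])
qed

text \<open>The chain rule evaluates \<open>f' (g x)\<close> in the direction \<open>g' x v\<close>,
  which varies with \<open>x\<close>, while \<open>Ck\<close> speaks of fixed directions only.
  Expanding the direction in a finite basis of the middle space reduces to fixed ones; this is the
  reason for the class \<open>euclidean_space\<close>.\<close>

lemma Ck_compose: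
  fixes f :: "'b::euclidean_space \<Rightarrow> 'c::real_normed_vector"
  shows "Ck k T f \<Longrightarrow> Ck k S g \<Longrightarrow> (\<And>x. x \<in> S \<Longrightarrow> g x \<in> T) \<Longrightarrow> Ck k S (\<lambda>x. f (g x))"
proof (induction k arbitrary: f g)
  case 0
  then show ?case by (auto intro: continuous_on_compose2)
next
  case (Suc k)
  from Suc.prems(1) obtain f' where f': "\<And>x. x \<in> T \<Longrightarrow> (f has_derivative f' x) (at x)"
      "\<And>v. Ck k T (\<lambda>x. f' x v)"
    by (rule Ck_SucE) blast
  from Suc.prems(2) obtain g' where g': "\<And>x. x \<in> S \<Longrightarrow> (g has_derivative g' x) (at x)"
      "\<And>v. Ck k S (\<lambda>x. g' x v)"
    by (rule Ck_SucE) blast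
  let ?D = "\<lambda>x v. \<Sum>b\<in>Basis. (g' x v \<bullet> b) *\<^sub>R f' (g x) b"
  have 1: "((\<lambda>x. f (g x)) has_derivative ?D x) (at x)" if "x \<in> S" for x
  proof -
    have "((\<lambda>x. f (g x)) has_derivative (\<lambda>v. f' (g x) (g' x v))) (at x)"
      by (rule has_derivative_compose[OF g'(1)[OF that] f'(1)[OF Suc.prems(3)[OF that]]])
    moreover have "f' (g x) (g' x v) = ?D x v" for v
    proof -
      have lin: "linear (f' (g x))"
        using f'(1)[OF Suc.prems(3)[OF that]] has_derivative_linear by blast
      have "f' (g x) (g' x v) = f' (g x) (\<Sum>b\<in>Basis. (g' x v \<bullet> b) *\<^sub>R b)"
        by (simp add: euclidean_representation)
      then show ?thesis using lin by (simp add: linear_sum linear_scale)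
    qed
    ultimately show ?thesis by (simp only:)
  qed
  have 2: "Ck k S (\<lambda>x. ?D x v)" for v
  proof (intro Ck_sum Ck_scaleR)
    fix b :: 'b assume "b \<in> Basis"
    show "Ck k S (\<lambda>x. g' x v \<bullet> b)"
      using g'(2) by (intro Ck_compose_linear[OF _ bounded_linear_inner_left]) auto
    show "Ck k S (\<lambda>x. f' (g x) b)"
      using f'(2) Suc.prems(3) by (intro Suc.IH[of "\<lambda>y. f' y b"] Ck_Suc_imp[OF Suc.prems(2)]) auto
  qed
  show ?case by (rule Ck_SucI[OF 1 2])
qed

text \<open>Derivatives are unique, so the existential witness in \<open>Ck\<close> can be made
  canonical. A canonical witness is the same on two overlapping sets, which makes gluing over unions
  possible.\<close>

lemma Ck_Suc_iff:
  assumes "open S"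
  shows "Ck (Suc k) S f \<longleftrightarrow> (\<forall>x\<in>S. f differentiable at x) \<and>
     (\<forall>v. Ck k S (\<lambda>x. frechet_derivative f (at x) v))"
proof
  assume "Ck (Suc k) S f"
  then obtain f' where f': "\<And>x. x \<in> S \<Longrightarrow> (f has_derivative f' x) (at x)" "\<And>v. Ck k S (\<lambda>x. f' x v)"
    by (rule Ck_SucE) blast
  have "Ck k S (\<lambda>x. frechet_derivative f (at x) v)" for v
    by (rule Ck_cong[OF f'(2)[of v] assms]) (simp add: frechet_derivative_at[OF f'(1)])
  with f'(1) show "(\<forall>x\<in>S. f differentiable at x) \<and> (\<forall>v. Ck k S (\<lambda>x. frechet_derivative f (at x) v))"
    unfolding differentiable_def by blast
next
  assume *: "(\<forall>x\<in>S. f differentiable at x) \<and> (\<forall>v. Ck k S (\<lambda>x. frechet_derivative f (at x) v))"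
  show "Ck (Suc k) S f"
    by (rule Ck_SucI[of _ _ "\<lambda>x. frechet_derivative f (at x)"])
      (use * frechet_derivative_works in blast)+
qed

lemma Ck_Un: "open S \<Longrightarrow> open T \<Longrightarrow> Ck k S f \<Longrightarrow> Ck k T f \<Longrightarrow> Ck k (S \<union> T) f"
proof (induction k arbitrary: f)
  case 0
  then show ?case by (auto intro: continuous_on_open_Un)
next
  case (Suc k)
  then show ?case by (auto simp: Ck_Suc_iff open_Un simp del: Ck.simps)
qed

lemma Ck_subset: "Ck k S f \<Longrightarrow> T \<subseteq> S \<Longrightarrow> Ck k T f"
proof (induction k arbitrary: f)
  case 0
  then show ?case by (auto intro: continuous_on_subset)
next
  case (Suc k)
  from Suc.prems(1) obtain f' where f': "\<And>x. x \<in> S \<Longrightarrow> (f has_derivative f' x) (at x)"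
      "\<And>v. Ck k S (\<lambda>x. f' x v)"
    by (rule Ck_SucE) blast
  show ?case
    by (rule Ck_SucI[OF f'(1) Suc.IH[OF f'(2) Suc.prems(2)]]) (use Suc.prems(2) in blast)
qed

lemma smooth_onI: "open S \<Longrightarrow> (\<And>k. Ck k S f) \<Longrightarrow> smooth_on S f"
  by (simp add: smooth_on_def)

lemma smooth_on_open: "smooth_on S f \<Longrightarrow> open S"
  by (simp add: smooth_on_def)

lemma smooth_on_cong:
  "smooth_on S f \<Longrightarrow> (\<And>x. x \<in> S \<Longrightarrow> f x = g x) \<Longrightarrow> smooth_on S g"
  unfolding smooth_on_def by (blast intro: Ck_cong)

lemma smooth_on_subset: "smooth_on S f \<Longrightarrow> open T \<Longrightarrow> T \<subseteq> S \<Longrightarrow> smooth_on T f"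
  unfolding smooth_on_def by (blast intro: Ck_subset)

lemma smooth_on_continuous_on: "smooth_on S f \<Longrightarrow> continuous_on S f"
  unfolding smooth_on_def by (blast intro: Ck_continuous_on)

lemma smooth_on_const [simp]: "open S \<Longrightarrow> smooth_on S (\<lambda>x. c)"
  unfolding smooth_on_def by (blast intro: Ck_const)

lemma smooth_on_bounded_linear: "bounded_linear T \<Longrightarrow> open S \<Longrightarrow> smooth_on S T"
  unfolding smooth_on_def by (blast intro: Ck_bounded_linear)

lemma smooth_on_ident: "open S \<Longrightarrow> smooth_on S (\<lambda>x. x)"
  by (rule smooth_on_bounded_linear[OF bounded_linear_ident])

lemma smooth_on_add: "smooth_on S f \<Longrightarrow> smooth_on S g \<Longrightarrow> smooth_on S (\<lambda>x. f x + g x)"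
  unfolding smooth_on_def by (blast intro: Ck_add)

lemma smooth_on_mult:
  fixes f g :: "'a::real_normed_vector \<Rightarrow> 'b::real_normed_algebra"
  shows "smooth_on S f \<Longrightarrow> smooth_on S g \<Longrightarrow> smooth_on S (\<lambda>x. f x * g x)"
  unfolding smooth_on_def by (blast intro: Ck_mult)

lemma smooth_on_scaleR:
  "smooth_on S f \<Longrightarrow> smooth_on S g \<Longrightarrow> smooth_on S (\<lambda>x. f x *\<^sub>R g x)"
  unfolding smooth_on_def by (blast intro: Ck_scaleR)

lemma smooth_on_compose_linear:
  "smooth_on S f \<Longrightarrow> bounded_linear T \<Longrightarrow> smooth_on S (\<lambda>x. T (f x))"
  unfolding smooth_on_def by (blast intro: Ck_compose_linear)

lemma smooth_on_minus: "smooth_on S f \<Longrightarrow> smooth_on S (\<lambda>x. - f x)"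
  by (rule smooth_on_compose_linear[OF _ bounded_linear_minus[OF bounded_linear_ident]])

lemma smooth_on_diff: "smooth_on S f \<Longrightarrow> smooth_on S g \<Longrightarrow> smooth_on S (\<lambda>x. f x - g x)"
  using smooth_on_add[OF _ smooth_on_minus, of S f g] by simp

lemma smooth_on_sum:
  "open S \<Longrightarrow> (\<And>i. i \<in> I \<Longrightarrow> smooth_on S (f i)) \<Longrightarrow> smooth_on S (\<lambda>x. \<Sum>i\<in>I. f i x)"
  unfolding smooth_on_def by (blast intro: Ck_sum)

lemma smooth_on_prod:
  fixes f :: "'i \<Rightarrow> 'a::real_normed_vector \<Rightarrow> real"
  shows "open S \<Longrightarrow> (\<And>i. i \<in> I \<Longrightarrow> smooth_on S (f i)) \<Longrightarrow> smooth_on S (\<lambda>x. \<Prod>i\<in>I. f i x)"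
  by (induction I rule: infinite_finite_induct) (simp_all add: smooth_on_mult)

lemma smooth_on_power:
  fixes f :: "'a::real_normed_vector \<Rightarrow> real"
  shows "smooth_on S f \<Longrightarrow> smooth_on S (\<lambda>x. f x ^ n)"
  by (induction n) (simp_all add: smooth_on_mult smooth_on_open)

lemma smooth_on_compose:
  fixes f :: "'b::euclidean_space \<Rightarrow> 'c::real_normed_vector"
  shows "smooth_on T f \<Longrightarrow> smooth_on S g \<Longrightarrow> (\<And>x. x \<in> S \<Longrightarrow> g x \<in> T) \<Longrightarrow> smooth_on S (\<lambda>x. f (g x))"
  unfolding smooth_on_def by (blast intro: Ck_compose)

lemma smooth_on_Un: "smooth_on S f \<Longrightarrow> smooth_on T f \<Longrightarrow> smooth_on (S \<union> T) f"
  unfolding smooth_on_def by (blast intro: Ck_Un)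

lemma smooth_on_differentiable: "smooth_on S f \<Longrightarrow> x \<in> S \<Longrightarrow> f differentiable at x"
  unfolding smooth_on_def by (metis Ck_Suc_iff)

lemma smooth_on_has_derivative:
  "smooth_on S f \<Longrightarrow> x \<in> S \<Longrightarrow> (f has_derivative frechet_derivative f (at x)) (at x)"
  using smooth_on_differentiable frechet_derivative_works by blast

lemma smooth_on_frechet_derivative:
  "smooth_on S f \<Longrightarrow> smooth_on S (\<lambda>x. frechet_derivative f (at x) v)"
  unfolding smooth_on_def by (metis Ck_Suc_iff)

text \<open>The derivative of the reciprocal is built from derivatives of \<open>f\<close> and the
  reciprocal itself, so each order of regularity of the reciprocal yields the next.\<close>

lemma smooth_on_inverse:
  fixes f :: "'a::real_normed_vector \<Rightarrow> real"
  assumes f: "smooth_on S f" and nz: "\<And>x. x \<in> S \<Longrightarrow> f x \<noteq> 0"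
  shows "smooth_on S (\<lambda>x. inverse (f x))"
proof (rule smooth_onI)
  show "open S" using f smooth_on_open by blast
  show "Ck k S (\<lambda>x. inverse (f x))" for k
  proof (induction k)
    case 0
    show ?case using smooth_on_continuous_on[OF f] nz by (auto intro: continuous_on_inverse)
  next
    case (Suc k)
    let ?D = "\<lambda>x v. (- 1 * frechet_derivative f (at x) v) * (inverse (f x) * inverse (f x))"
    have 1: "((\<lambda>x. inverse (f x)) has_derivative ?D x) (at x)" if "x \<in> S" for x
      using Deriv.has_derivative_inverse[OF nz[OF that] smooth_on_has_derivative[OF f that]]
      by (simp add: algebra_simps)
    have 2: "Ck k S (\<lambda>x. ?D x v)" for v
      using smooth_on_frechet_derivative[OF f, of v]
      by (intro Ck_mult Ck_const Suc) (auto simp: smooth_on_def)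
    show ?case by (rule Ck_SucI[OF 1 2])
  qed
qed

lemma smooth_on_vec:
  fixes f :: "'a::real_normed_vector \<Rightarrow> real^'n"
  assumes "open S" "\<And>i. smooth_on S (\<lambda>x. f x $ i)"
  shows "smooth_on S f"
proof -
  have "f x = (\<Sum>i\<in>UNIV. (f x $ i) *\<^sub>R axis i 1)" for x
    using basis_expansion[of "f x"] by (simp add: scalar_mult_eq_scaleR)
  moreover have "smooth_on S (\<lambda>x. \<Sum>i\<in>UNIV. (f x $ i) *\<^sub>R axis i (1::real))"
    using assms by (intro smooth_on_sum smooth_on_scaleR) auto
  ultimately show ?thesis by presburger
qed

lemma smooth_on_Pair:
  assumes "smooth_on S f" "smooth_on S g"
  shows "smooth_on S (\<lambda>x. (f x, g x))"
proof -
  have "smooth_on S (\<lambda>x. (f x, 0) + (0, g x))"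
    using assms
    by (intro smooth_on_add smooth_on_compose_linear[of S _ "\<lambda>y. (y, 0)"]
        smooth_on_compose_linear[of S _ "\<lambda>y. (0, y)"])
      (auto intro!: bounded_linear_Pair bounded_linear_ident)
  then show ?thesis by simp
qed

text \<open>The function is smooth on \<open>S\<close> as a product and on the complement of
  \<open>C\<close> as zero; these two open sets cover the space.\<close>

lemma smooth_on_extend_by_zero:
  fixes f g :: "'a::real_normed_vector \<Rightarrow> real"
  assumes g: "smooth_on UNIV g" and f: "smooth_on S f"
    and C: "closed C" "C \<subseteq> S" "\<And>x. x \<notin> C \<Longrightarrow> g x = 0"
  shows "smooth_on UNIV (\<lambda>x. if x \<in> S then g x * f x else 0)" (is "smooth_on _ ?h")
proof -
  have "smooth_on S ?h"
    by (rule smooth_on_cong[OF smooth_on_mult[OF smooth_on_subset[OF g] f]])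
      (use smooth_on_open[OF f] in auto)
  moreover have "smooth_on (- C) ?h"
    by (rule smooth_on_cong[of _ "\<lambda>_. 0"]) (use C in \<open>auto simp: open_Compl\<close>)
  ultimately have "smooth_on (S \<union> - C) ?h" by (rule smooth_on_Un)
  moreover have "S \<union> - C = UNIV" using C(2) by auto
  ultimately show ?thesis by simp
qed

text \<open>Explicit functions are shown to be smooth by guessing the whole sequence of their
  derivatives at once: a family closed under differentiation is smooth by induction on the order.
  The flat function, the cosine and periodizations enter this way.\<close>

lemma smooth_on_realI:
  fixes D :: "nat \<Rightarrow> real \<Rightarrow> real"
  assumes D: "\<And>n x. (D n has_real_derivative D (Suc n) x) (at x)"
  shows "smooth_on UNIV (D n)"
proof (rule smooth_onI)
  show "Ck k UNIV (D n)" for k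
  proof (induction k arbitrary: n)
    case 0
    show ?case using D by (auto intro!: continuous_at_imp_continuous_on DERIV_isCont)
  next
    case (Suc k)
    show ?case
      using D by (intro Ck_SucI[of _ _ "\<lambda>x v. D (Suc n) x * v"] Ck_mult Ck_const Suc)
        (auto simp: has_field_derivative_def)
  qed
qed simp

lemma higher_deriv_eqI:
  fixes D :: "nat \<Rightarrow> real \<Rightarrow> real"
  assumes D: "\<And>n x. (D n has_real_derivative D (Suc n) x) (at x)"
  shows "(deriv ^^ n) (D 0) = D n"
proof (induction n)
  case (Suc n)
  have "deriv (D n) = D (Suc n)" by (rule ext) (rule DERIV_imp_deriv[OF D])
  with Suc show ?case by simp
qed simp

lemma smooth_on_real_deriv:
  fixes f :: "real \<Rightarrow> real"
  assumes "smooth_on UNIV f"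
  shows "(f has_real_derivative deriv f x) (at x)" "smooth_on UNIV (deriv f)"
proof -
  have h: "(f has_derivative frechet_derivative f (at x)) (at x)" for x
    by (rule smooth_on_has_derivative[OF assms]) simp
  have fr: "frechet_derivative f (at x) = (\<lambda>v. frechet_derivative f (at x) 1 * v)" for x
  proof
    fix v
    have "linear (frechet_derivative f (at x))" using h has_derivative_linear by blast
    from linear_scale[OF this, of v 1] show "frechet_derivative f (at x) v = frechet_derivative f (at x) 1 * v"
      by simp
  qed
  have d: "(f has_real_derivative frechet_derivative f (at x) 1) (at x)" for x
    using h[of x] fr[of x] by (simp add: has_field_derivative_def)
  then have e: "deriv f = (\<lambda>x. frechet_derivative f (at x) 1)"
    using DERIV_imp_deriv by blast
  show "(f has_real_derivative deriv f x) (at x)" using d e by simp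
  show "smooth_on UNIV (deriv f)" unfolding e by (rule smooth_on_frechet_derivative[OF assms])
qed

lemma smooth_on_higher_deriv:
  fixes f :: "real \<Rightarrow> real"
  assumes "smooth_on UNIV f"
  shows "smooth_on UNIV ((deriv ^^ n) f)"
  by (induction n) (auto intro: assms smooth_on_real_deriv)

lemma has_real_derivative_higher_deriv:
  fixes f :: "real \<Rightarrow> real"
  assumes "smooth_on UNIV f"
  shows "((deriv ^^ n) f has_real_derivative (deriv ^^ Suc n) f x) (at x)"
  using smooth_on_real_deriv(1)[OF smooth_on_higher_deriv[OF assms]] by simp

lemma higher_deriv_cong_open:
  fixes f g :: "real \<Rightarrow> real"
  assumes "open S" "\<And>x. x \<in> S \<Longrightarrow> f x = g x" "x \<in> S"
  shows "(deriv ^^ n) f x = (deriv ^^ n) g x"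
  using assms(3)
proof (induction n arbitrary: x)
  case (Suc n)
  have "eventually (\<lambda>y. (deriv ^^ n) f y = (deriv ^^ n) g y) (nhds x)"
    using Suc assms(1) eventually_nhds by blast
  then show ?case using deriv_cong_ev by simp blast
qed (use assms in auto)

lemma smooth_on_cos: "smooth_on UNIV (cos :: real \<Rightarrow> real)"
proof -
  let ?D = "\<lambda>n x::real. cos (x + real n * (pi / 2))"
  have "smooth_on UNIV (?D 0)"
  proof (rule smooth_on_realI)
    fix n x
    have "x + real (Suc n) * (pi / 2) = (x + real n * (pi / 2)) + pi / 2"
      by (simp add: algebra_simps add_divide_distrib)
    then have "?D (Suc n) x = - sin (x + real n * (pi / 2))"
      by (simp only: cos_add) simp
    then show "(?D n has_real_derivative ?D (Suc n) x) (at x)"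
      by (auto intro!: derivative_eq_intros)
  qed
  then show ?thesis by simp
qed

section \<open>Profiles in one real variable\<close>

lemma higher_deriv_add:
  fixes f g :: "real \<Rightarrow> real"
  assumes "smooth_on UNIV f" "smooth_on UNIV g"
  shows "(deriv ^^ n) (\<lambda>x. f x + g x) = (\<lambda>x. (deriv ^^ n) f x + (deriv ^^ n) g x)"
  using higher_deriv_eqI[of "\<lambda>n x. (deriv ^^ n) f x + (deriv ^^ n) g x" n]
    has_real_derivative_higher_deriv[OF assms(1)] has_real_derivative_higher_deriv[OF assms(2)]
  by (force intro: DERIV_add)

lemma higher_deriv_shift:
  fixes f :: "real \<Rightarrow> real"
  assumes "smooth_on UNIV f"
  shows "(deriv ^^ n) (\<lambda>x. f (x + c)) = (\<lambda>x. (deriv ^^ n) f (x + c))"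
proof -
  let ?D = "\<lambda>n x. (deriv ^^ n) f (x + c)"
  have "(?D n has_real_derivative ?D (Suc n) x) (at x)" for n x
    using has_real_derivative_higher_deriv[OF assms, of n "x + c"] by (simp only: DERIV_shift)
  from higher_deriv_eqI[of ?D n, OF this] show ?thesis by simp
qed

lemma higher_deriv_scale:
  fixes f :: "real \<Rightarrow> real"
  assumes "smooth_on UNIV f"
  shows "(deriv ^^ n) (\<lambda>x. k * f (c * x)) = (\<lambda>x. k * c ^ n * (deriv ^^ n) f (c * x))"
proof -
  let ?D = "\<lambda>n x. k * c ^ n * (deriv ^^ n) f (c * x)"
  have "(?D n has_real_derivative ?D (Suc n) x) (at x)" for n x
  proof -
    have "((\<lambda>x. (deriv ^^ n) f (c * x)) has_real_derivative (deriv ^^ Suc n) f (c * x) * c) (at x)"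
      by (rule DERIV_chain2[OF has_real_derivative_higher_deriv[OF assms]])
        (auto intro!: derivative_eq_intros)
    from DERIV_cmult[OF this, of "k * c ^ n"] show ?thesis by (simp add: mult_ac)
  qed
  from higher_deriv_eqI[of ?D n, OF this] show ?thesis by simp
qed

lemma higher_deriv_monomial:
  "(deriv ^^ n) (\<lambda>x. x ^ b / fact b) = (\<lambda>x::real. if n \<le> b then x ^ (b - n) / fact (b - n) else 0)"
proof -
  let ?D = "\<lambda>n x::real. if n \<le> b then x ^ (b - n) / fact (b - n) else 0"
  have "(?D n has_real_derivative ?D (Suc n) x) (at x)" for n x
  proof (cases "n < b")
    case True
    then obtain c where b: "b = Suc (n + c)" using less_imp_Suc_add by blast
    have "((\<lambda>x. x ^ Suc c / fact (Suc c)) has_real_derivative (real (Suc c) * x ^ c) / fact (Suc c)) (at x)"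
      using DERIV_cdivide[OF DERIV_pow[of "Suc c" x], of "fact (Suc c)"] by simp
    also have "(real (Suc c) * x ^ c) / fact (Suc c) = x ^ c / fact c"
      by (simp only: fact_Suc of_nat_mult) simp
    finally show ?thesis using b by (simp add: Suc_diff_le)
  next
    case False
    then show ?thesis by (cases "n = b") auto
  qed
  from higher_deriv_eqI[of ?D n, OF this] show ?thesis by simp
qed

section \<open>Smooth steps and bumps built from a flat exponential\<close>

lemma tendsto_poly_times_exp_minus:
  fixes p :: "real poly"
  shows "((\<lambda>t. poly p t * exp (- t)) \<longlongrightarrow> 0) at_top"
proof -
  have "((\<lambda>t. \<Sum>i\<le>degree p. coeff p i * (t ^ i / exp t)) \<longlongrightarrow> (\<Sum>i\<le>degree p. coeff p i * 0)) at_top"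
    by (intro tendsto_intros tendsto_power_div_exp_0)
  then show ?thesis
    by (simp add: poly_altdef sum_distrib_right exp_minus divide_inverse mult.assoc)
qed

lemma DERIV_transform_ev:
  "(g has_real_derivative d) (at x) \<Longrightarrow> eventually (\<lambda>y. f y = g y) (nhds x) \<Longrightarrow>
    (f has_real_derivative d) (at x)"
  by (simp add: DERIV_cong_ev[OF refl _ refl])

definition flat :: "real \<Rightarrow> real" where
  "flat x = (if x > 0 then exp (- (1 / x)) else 0)"

text \<open>With \<open>t = 1 / x\<close> the derivatives at positive \<open>x\<close> are
  polynomials \<open>q\<close> in \<open>t\<close> times \<open>exp (- t)\<close>, and one more
  derivative sends \<open>q\<close> to \<open>t ^ 2 * (q - q')\<close>. At 0 the right difference
  quotient is \<open>t * q t * exp (- t)\<close>, which tends to 0 as \<open>t\<close>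
  grows.\<close>

lemma smooth_on_flat: "smooth_on UNIV flat"
proof -
  define q :: "nat \<Rightarrow> real poly" where
    "q = rec_nat 1 (\<lambda>_ p. [:0, 0, 1:] * (p - pderiv p))"
  define D where "D n x = (if x > 0 then poly (q n) (1 / x) * exp (- (1 / x)) else 0)" for n and x :: real
  have "(D n has_real_derivative D (Suc n) x) (at x)" for n x
  proof -
    consider "x > 0" | "x < 0" | "x = 0" by linarith
    then show ?thesis
    proof cases
      case 1
      have "((\<lambda>x. poly (q n) (1 / x) * exp (- (1 / x))) has_real_derivative D (Suc n) x) (at x)"
      proof -
        have inv: "((\<lambda>x. 1 / x) has_real_derivative - (1 / x\<^sup>2)) (at x)"
          using 1 by (auto intro!: derivative_eq_intros simp: power2_eq_square)
        have "((\<lambda>x. poly (q n) (1 / x) * exp (- (1 / x))) has_real_derivative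
            poly (pderiv (q n)) (1 / x) * (- (1 / x\<^sup>2)) * exp (- (1 / x)) +
            exp (- (1 / x)) * (- (- (1 / x\<^sup>2))) * poly (q n) (1 / x)) (at x)"
          by (rule DERIV_mult[OF DERIV_chain2[OF poly_DERIV inv]
                DERIV_chain2[OF DERIV_exp DERIV_minus[OF inv]]])
        also have "poly (pderiv (q n)) (1 / x) * (- (1 / x\<^sup>2)) * exp (- (1 / x)) +
            exp (- (1 / x)) * (- (- (1 / x\<^sup>2))) * poly (q n) (1 / x) = D (Suc n) x"
          using 1 by (simp add: D_def q_def power2_eq_square algebra_simps)
        finally show ?thesis .
      qed
      moreover have "eventually (\<lambda>y. D n y = poly (q n) (1 / y) * exp (- (1 / y))) (nhds x)"
        by (rule eventually_mono[OF eventually_nhds_in_open[of "{0<..}" x]]) (use 1 in \<open>auto simp: D_def\<close>)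
      ultimately show ?thesis by (blast intro: DERIV_transform_ev)
    next
      case 2
      have "((\<lambda>_. 0) has_real_derivative D (Suc n) x) (at x)" using 2 by (simp add: D_def)
      moreover have "eventually (\<lambda>y. D n y = 0) (nhds x)"
        by (rule eventually_mono[OF eventually_nhds_in_open[of "{..<0}" x]]) (use 2 in \<open>auto simp: D_def\<close>)
      ultimately show ?thesis by (blast intro: DERIV_transform_ev)
    next
      case 3
      have "((\<lambda>t. poly ([:0, 1:] * q n) t * exp (- t)) \<longlongrightarrow> 0) at_top"
        by (rule tendsto_poly_times_exp_minus)
      from filterlim_compose[OF this filterlim_inverse_at_top_right]
      have "((\<lambda>h. poly ([:0, 1:] * q n) (inverse h) * exp (- inverse h)) \<longlongrightarrow> 0) (at_right 0)" .
      then have "((\<lambda>h. (D n (0 + h) - D n 0) / h) \<longlongrightarrow> 0) (at_right 0)"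
        by (rule Lim_transform_eventually)
          (auto simp: D_def eventually_at_right_less field_simps intro!: eventually_at_rightI[of 0 1])
      moreover have "((\<lambda>h. (D n (0 + h) - D n 0) / h) \<longlongrightarrow> 0) (at_left 0)"
        by (rule Lim_transform_eventually[OF tendsto_const])
          (auto simp: D_def intro!: eventually_at_leftI[of "-1" 0])
      ultimately have "((\<lambda>h. (D n (0 + h) - D n 0) / h) \<longlongrightarrow> 0) (at 0)"
        by (simp add: filterlim_at_split)
      then show ?thesis using 3 by (simp add: DERIV_def D_def)
    qed
  qed
  then have "smooth_on UNIV (D 0)" by (rule smooth_on_realI)
  moreover have "D 0 = flat" by (auto simp: D_def q_def flat_def)
  ultimately show ?thesis by simp
qed

text \<open>A quotient of two flat functions, one starting at \<open>a\<close> and one ending at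
  \<open>b\<close>. Because \<open>a < b\<close>, they never vanish together, so the denominator
  stays positive.\<close>

lemma smooth_step_exists:
  fixes a b :: real
  assumes "a < b"
  obtains \<psi> :: "real \<Rightarrow> real"
  where "smooth_on UNIV \<psi>" "\<And>x. 0 \<le> \<psi> x" "\<And>x. \<psi> x \<le> 1"
    "\<And>x. x \<le> a \<Longrightarrow> \<psi> x = 0" "\<And>x. b \<le> x \<Longrightarrow> \<psi> x = 1"
proof
  let ?f = "\<lambda>x. flat (x - a)" and ?g = "\<lambda>x. flat (b - x)"
  let ?\<psi> = "\<lambda>x. ?f x * inverse (?f x + ?g x)"
  have nn: "flat x \<ge> 0" for x by (simp add: flat_def)
  have pos: "?f x + ?g x > 0" for x
  proof (cases "x > a")
    case True
    then have "?f x > 0" by (simp add: flat_def)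
    with nn[of "b - x"] show ?thesis by linarith
  next
    case False
    then have "?g x > 0" using assms by (simp add: flat_def)
    with nn[of "x - a"] show ?thesis by linarith
  qed
  have f: "smooth_on UNIV ?f" and g: "smooth_on UNIV ?g"
    by (rule smooth_on_compose[OF smooth_on_flat];
        auto intro!: smooth_on_diff smooth_on_ident)+
  show "smooth_on UNIV ?\<psi>"
    by (intro smooth_on_mult smooth_on_inverse smooth_on_add f g) (use pos in \<open>metis less_irrefl\<close>)
  show "0 \<le> ?\<psi> x" for x using nn[of "x - a"] pos[of x] by simp
  show "?\<psi> x \<le> 1" for x using nn[of "b - x"] pos[of x] by (simp add: field_simps)
  show "?\<psi> x = 0" if "x \<le> a" for x using that by (simp add: flat_def)
  show "?\<psi> x = 1" if "b \<le> x" for x using that assms by (simp add: flat_def)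
qed

lemma smooth_bump_exists:
  fixes a b :: real
  assumes "a < b" "0 < a"
  obtains \<theta> :: "real \<Rightarrow> real"
  where "smooth_on UNIV \<theta>" "\<And>x. 0 \<le> \<theta> x" "\<And>x. \<theta> x \<le> 1"
    "\<And>x. \<bar>x\<bar> \<le> a \<Longrightarrow> \<theta> x = 1" "\<And>x. b \<le> \<bar>x\<bar> \<Longrightarrow> \<theta> x = 0"
proof -
  obtain \<psi> :: "real \<Rightarrow> real"
  where \<psi>: "smooth_on UNIV \<psi>" "\<And>x. 0 \<le> \<psi> x" "\<And>x. \<psi> x \<le> 1"
    "\<And>x. x \<le> a \<Longrightarrow> \<psi> x = 0" "\<And>x. b \<le> x \<Longrightarrow> \<psi> x = 1"
    by (rule smooth_step_exists[OF assms(1)], rule that)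
  show thesis
  proof
    let ?\<theta> = "\<lambda>x. (1 - \<psi> x) * (1 - \<psi> (- x))"
    have "smooth_on UNIV (\<lambda>x. \<psi> (- x))"
      by (rule smooth_on_compose[OF \<psi>(1)])
        (auto intro!: smooth_on_minus smooth_on_ident)
    with \<psi>(1) show "smooth_on UNIV ?\<theta>"
      by (intro smooth_on_mult smooth_on_diff) auto
    show "0 \<le> ?\<theta> x" "?\<theta> x \<le> 1" for x
      using \<psi>(2,3)[of x] \<psi>(2,3)[of "- x"] by (auto intro: mult_le_one)
    show "?\<theta> x = 1" if "\<bar>x\<bar> \<le> a" for x using that \<psi>(4)[of x] \<psi>(4)[of "- x"] by simp
    show "?\<theta> x = 0" if "b \<le> \<bar>x\<bar>" for x
      using that \<psi>(5)[of x] \<psi>(5)[of "- x"] by (cases "x \<ge> 0") auto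
  qed
qed

text \<open>Bounds over the whole line survive the substitution of arbitrarily large arguments such
  as \<open>N * (v \<bullet> snd p)\<close>; this makes the later estimates uniform in
  \<open>N\<close>.\<close>

definition smooth_bdd :: "(real \<Rightarrow> real) \<Rightarrow> bool" where
  "smooth_bdd f \<longleftrightarrow> smooth_on UNIV f \<and> (\<forall>n. bounded (range ((deriv ^^ n) f)))"

lemma smooth_bdd_smooth: "smooth_bdd f \<Longrightarrow> smooth_on UNIV f"
  by (simp add: smooth_bdd_def)

lemma smooth_bdd_deriv: "smooth_bdd f \<Longrightarrow> smooth_bdd (deriv f)"
proof -
  assume f: "smooth_bdd f"
  have "(deriv ^^ n) (deriv f) = (deriv ^^ Suc n) f" for n
    by (simp only: funpow_Suc_right o_apply)
  with f show ?thesis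
    unfolding smooth_bdd_def using smooth_on_real_deriv(2)[of f] by presburger
qed

lemma smooth_bddE:
  assumes "smooth_bdd f"
  obtains B where "\<And>x. \<bar>(deriv ^^ n) f x\<bar> \<le> B"
  using assms unfolding smooth_bdd_def bounded_iff by (auto simp: image_iff)

lemma higher_deriv_zero: "(deriv ^^ n) (\<lambda>_. 0 :: real) = (\<lambda>_. 0)"
  by (induction n) auto

lemma smooth_bdd_compact_support:
  assumes f: "smooth_on UNIV f" and R: "\<And>x. R \<le> \<bar>x\<bar> \<Longrightarrow> f x = 0"
  shows "smooth_bdd f"
  unfolding smooth_bdd_def
proof (intro conjI allI f)
  fix n
  have c: "continuous_on {-R..R} ((deriv ^^ n) f)"
    using smooth_on_continuous_on[OF smooth_on_higher_deriv[OF f]] continuous_on_subset by blast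
  have "(deriv ^^ n) f x = 0" if "x \<notin> {-R..R}" for x
  proof -
    have "(deriv ^^ n) f x = (deriv ^^ n) (\<lambda>_. 0) x"
      by (rule higher_deriv_cong_open[of "- {-R..R}"]) (use that in \<open>auto intro: R simp: open_Compl\<close>)
    then show ?thesis by (simp add: higher_deriv_zero)
  qed
  then have "range ((deriv ^^ n) f) \<subseteq> insert 0 ((deriv ^^ n) f ` {-R..R})" by blast
  moreover have "bounded ((deriv ^^ n) f ` {-R..R})"
    by (intro compact_imp_bounded compact_continuous_image c) simp
  ultimately show "bounded (range ((deriv ^^ n) f))"
    by (meson bounded_insert bounded_subset)
qed

text \<open>Rounding jumps only at half-integers, and there the periodization vanishes on a whole
  neighbourhood because \<open>s < 1 / 2\<close>. Elsewhere it is locally a translate of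
  \<open>g\<close>.\<close>

lemma higher_deriv_periodization:
  fixes g :: "real \<Rightarrow> real"
  assumes g: "smooth_on UNIV g" and s: "s < 1 / 2" and z: "\<And>x. s \<le> \<bar>x\<bar> \<Longrightarrow> g x = 0"
  shows "smooth_on UNIV (\<lambda>u. g (u - of_int (round u)))"
    and "(deriv ^^ n) (\<lambda>u. g (u - of_int (round u))) = (\<lambda>u. (deriv ^^ n) g (u - of_int (round u)))"
proof -
  define D where "D n u = (deriv ^^ n) g (u - of_int (round u))" for n and u :: real
  have zn: "(deriv ^^ n) g x = 0" if "s < \<bar>x\<bar>" for n x
  proof -
    have "open {x::real. s < \<bar>x\<bar>}" by (intro open_Collect_less continuous_intros)
    then have "(deriv ^^ n) g x = (deriv ^^ n) (\<lambda>_. 0) x"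
      by (rule higher_deriv_cong_open) (use that in \<open>auto intro: z\<close>)
    then show ?thesis by (simp add: higher_deriv_zero)
  qed
  have D: "(D n has_real_derivative D (Suc n) u) (at u)" for n u
  proof (cases "\<bar>u - of_int (round u)\<bar> < 1 / 2")
    case True
    have "((\<lambda>v. (deriv ^^ n) g (v - of_int (round u))) has_real_derivative D (Suc n) u) (at u)"
      using has_real_derivative_higher_deriv[OF g, of n "u + - of_int (round u)"]
      by (simp only: DERIV_shift D_def) simp
    moreover have "eventually (\<lambda>v. D n v = (deriv ^^ n) g (v - of_int (round u))) (nhds u)"
    proof -
      have "open {v::real. \<bar>v - of_int (round u)\<bar> < 1 / 2}" by (intro open_Collect_less continuous_intros)
      then show ?thesis
      proof (rule eventually_mono[OF eventually_nhds_in_open])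
        show "u \<in> {v::real. \<bar>v - of_int (round u)\<bar> < 1 / 2}" using True by simp
        fix v assume "v \<in> {v::real. \<bar>v - of_int (round u)\<bar> < 1 / 2}"
        then have "round v = round u" by (intro round_unique') (simp add: abs_minus_commute)
        then show "D n v = (deriv ^^ n) g (v - of_int (round u))" by (simp add: D_def)
      qed
    qed
    ultimately show ?thesis by (blast intro: DERIV_transform_ev)
  next
    case False
    then have half: "\<bar>u - of_int (round u)\<bar> = 1 / 2"
      using of_int_round_abs_le[of u] by (simp add: abs_minus_commute)
    have "eventually (\<lambda>v. D n v = 0) (nhds u)"
    proof -
      have "\<forall>v\<in>ball u (1 / 2 - s). D n v = 0"
      proof
        fix v assume "v \<in> ball u (1 / 2 - s)"
        then have "\<bar>u - v\<bar> < 1 / 2 - s" by (simp add: dist_real_def)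
        moreover have "\<bar>u - of_int (round v)\<bar> \<ge> \<bar>u - of_int (round u)\<bar>"
          using round_diff_minimal[of u "round v"] by simp
        ultimately have "s < \<bar>v - of_int (round v)\<bar>" using half by linarith
        then show "D n v = 0" unfolding D_def by (rule zn)
      qed
      moreover have "u \<in> ball u (1 / 2 - s)" using s by simp
      ultimately show ?thesis unfolding eventually_nhds by (intro exI[of _ "ball u (1 / 2 - s)"]) blast
    qed
    moreover have "D (Suc n) u = 0" unfolding D_def using half s by (intro zn) simp
    then have "((\<lambda>_. 0) has_real_derivative D (Suc n) u) (at u)" by simp
    ultimately show ?thesis by (blast intro: DERIV_transform_ev)
  qed
  have D0: "D 0 = (\<lambda>u. g (u - of_int (round u)))" by (auto simp: D_def)
  show "smooth_on UNIV (\<lambda>u. g (u - of_int (round u)))"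
    using smooth_on_realI[of D 0, OF D] by (simp add: D0)
  show "(deriv ^^ n) (\<lambda>u. g (u - of_int (round u))) = (\<lambda>u. (deriv ^^ n) g (u - of_int (round u)))"
    using higher_deriv_eqI[of D n, OF D] by (simp add: D0 D_def fun_eq_iff)
qed

text \<open>The cosine sees only the distance of \<open>u\<close> to the nearest integer, which is
  at most \<open>1 / 2\<close>; on this range it decreases and passes \<open>- 1 / 2\<close> at
  distance \<open>1 / 3\<close>.\<close>

lemma dist_round_less_of_cos_gt:
  assumes "- 1 / 2 < cos (2 * pi * u)"
  shows "\<bar>u - of_int (round u)\<bar> < 1 / 3"
proof (rule ccontr)
  define t where "t = \<bar>u - of_int (round u)\<bar>"
  assume "\<not> \<bar>u - of_int (round u)\<bar> < 1 / 3"
  then have "1 / 3 \<le> t" "t \<le> 1 / 2"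
    using of_int_round_abs_le[of u] by (simp_all add: t_def abs_minus_commute)
  then have "cos (2 * pi * t) \<le> cos (2 * pi * (1 / 3))"
    by (intro cos_monotone_0_pi_le mult_left_mono) (auto simp: field_simps)
  also have "\<dots> = - 1 / 2" using cos_120 by (simp add: field_simps)
  finally have "cos (2 * pi * t) \<le> - 1 / 2" .
  moreover have "cos (2 * pi * t) = cos (2 * pi * u)"
  proof -
    have "cos (2 * pi * t) = cos \<bar>2 * pi * u - 2 * pi * of_int (round u)\<bar>"
      by (simp add: t_def abs_mult flip: right_diff_distrib)
    also have "\<dots> = cos (2 * pi * u - 2 * pi * of_int (round u))" by (rule cos_abs_real)
    also have "\<dots> = cos (2 * pi * u)"
      by (simp add: cos_diff cos_int_2pin sin_int_2pin)
    finally show ?thesis .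
  qed
  ultimately show False using assms by linarith
qed

text \<open>The two oscillating profiles of the wiggle: \<open>A\<^sub>1\<close> is a unit monomial of degree \<open>a\<close> except near
  half-integers, \<open>A\<^sub>2\<close> except near integers. At height \<open>cos (2 \<pi> u)\<close> the weights \<open>\<kappa>\<^sub>1\<close>, \<open>\<kappa>\<^sub>2\<close> select a
  profile that is good at \<open>u\<close>.\<close>

lemma wiggle_profiles_exist:
  obtains A1 A2 \<kappa>1 \<kappa>2 :: "real \<Rightarrow> real"
  where "smooth_bdd A1" "smooth_bdd A2" "smooth_bdd \<kappa>1" "smooth_bdd \<kappa>2"
    "\<And>u q. q \<le> b \<Longrightarrow>
      (deriv ^^ (a + b - q)) A1 u * (deriv ^^ q) \<kappa>1 (cos (2 * pi * u)) +
      (deriv ^^ (a + b - q)) A2 u * (deriv ^^ q) \<kappa>2 (cos (2 * pi * u)) = (if q = b then 1 else 0)"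
proof -
  \<comment> \<open>The plateau \<open>2 / 5\<close> exceeds the distance \<open>1 / 3\<close>
    guaranteed by \<open>dist_round_less_of_cos_gt\<close>, so derivatives can be read off on an
    open interval; \<open>9 / 20 < 1 / 2\<close> leaves the gap that periodization requires.\<close>
  obtain \<theta> :: "real \<Rightarrow> real" where \<theta>: "smooth_on UNIV \<theta>" "\<And>x. \<bar>x\<bar> \<le> 2 / 5 \<Longrightarrow> \<theta> x = 1"
    "\<And>x. 9 / 20 \<le> \<bar>x\<bar> \<Longrightarrow> \<theta> x = 0"
    by (rule smooth_bump_exists[of "2 / 5" "9 / 20"]) auto
  \<comment> \<open>The plateau reaches beyond 1, so all values of the cosine lie in its interior;
    the compact support makes the weights bounded with all derivatives.\<close>
  obtain \<theta>' :: "real \<Rightarrow> real" where \<theta>': "smooth_on UNIV \<theta>'" "\<And>x. \<bar>x\<bar> \<le> 3 / 2 \<Longrightarrow> \<theta>' x = 1"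
    "\<And>x. 2 \<le> \<bar>x\<bar> \<Longrightarrow> \<theta>' x = 0"
    by (rule smooth_bump_exists[of "3 / 2" 2]) auto
  \<comment> \<open>Both profiles are good where the cosine lies between \<open>- 1 / 2\<close> and
    \<open>1 / 2\<close>; the switch takes place strictly inside this range.\<close>
  obtain \<psi> :: "real \<Rightarrow> real" where \<psi>: "smooth_on UNIV \<psi>" "\<And>x. x \<le> - 1 / 3 \<Longrightarrow> \<psi> x = 0"
    "\<And>x. 1 / 3 \<le> x \<Longrightarrow> \<psi> x = 1"
    by (rule smooth_step_exists[of "- 1 / 3" "1 / 3"]) auto
  have mono: "smooth_on UNIV (\<lambda>x::real. x ^ k / fact k)" for k
    unfolding divide_inverse
    by (intro smooth_on_mult smooth_on_power) (auto intro!: smooth_on_ident)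
  define g where "g x = \<theta> x * (x ^ a / fact a)" for x
  define A1 where "A1 u = g (u - of_int (round u))" for u
  define A2 where "A2 u = A1 (u + 1 / 2)" for u
  define \<kappa>1 where "\<kappa>1 x = x ^ b / fact b * (\<psi> x * \<theta>' x)" for x
  define \<kappa>2 where "\<kappa>2 x = x ^ b / fact b * ((1 - \<psi> x) * \<theta>' x)" for x
  have g: "smooth_on UNIV g" unfolding g_def by (intro smooth_on_mult \<theta> mono)
  have g0: "g x = 0" if "9 / 20 \<le> \<bar>x\<bar>" for x using \<theta>(3)[OF that] by (simp add: g_def)
  have A1': "A1 = (\<lambda>u. g (u - of_int (round u)))" by (auto simp: A1_def)
  have smA1: "smooth_on UNIV A1"
    unfolding A1' by (rule higher_deriv_periodization[of g "9 / 20"]) (auto intro: g g0)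
  have dA1: "(deriv ^^ n) A1 = (\<lambda>u. (deriv ^^ n) g (u - of_int (round u)))" for n
    unfolding A1' by (rule higher_deriv_periodization[of g "9 / 20"]) (auto intro: g g0)
  have A2': "A2 = (\<lambda>u. A1 (u + 1 / 2))" by (auto simp: A2_def)
  have dA2: "(deriv ^^ n) A2 = (\<lambda>u. (deriv ^^ n) A1 (u + 1 / 2))" for n
    unfolding A2' by (rule higher_deriv_shift[OF smA1])
  have bA1: "smooth_bdd A1"
  proof -
    have "bounded (range ((deriv ^^ n) A1))" for n
    proof -
      have "smooth_bdd g" by (rule smooth_bdd_compact_support[OF g g0])
      then have "bounded (range ((deriv ^^ n) g))" by (simp add: smooth_bdd_def)
      then show ?thesis unfolding dA1 by (rule bounded_subset) auto
    qed
    with smA1 show ?thesis by (simp add: smooth_bdd_def)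
  qed
  have bA2: "smooth_bdd A2"
  proof -
    have "smooth_on UNIV A2"
      unfolding A2' by (rule smooth_on_compose[OF smA1])
        (auto intro!: smooth_on_add smooth_on_ident)
    moreover have "bounded (range ((deriv ^^ n) A2))" for n
    proof -
      have "bounded (range ((deriv ^^ n) A1))" using bA1 by (simp add: smooth_bdd_def)
      then show ?thesis unfolding dA2 by (rule bounded_subset) auto
    qed
    ultimately show ?thesis by (simp add: smooth_bdd_def)
  qed
  have sk1: "smooth_on UNIV \<kappa>1" and sk2: "smooth_on UNIV \<kappa>2"
    unfolding \<kappa>1_def[abs_def] \<kappa>2_def[abs_def]
    by (intro smooth_on_mult smooth_on_diff mono \<psi> \<theta>' smooth_on_const open_UNIV)+
  have bk: "smooth_bdd \<kappa>1" "smooth_bdd \<kappa>2"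
    by (rule smooth_bdd_compact_support[of _ 2], fact sk1, simp add: \<kappa>1_def \<theta>'(3))
      (rule smooth_bdd_compact_support[of _ 2], fact sk2, simp add: \<kappa>2_def \<theta>'(3))
  have goodA1: "(deriv ^^ n) A1 u = (if n = a then 1 else 0)"
    if n: "a \<le> n" and u: "- 1 / 2 < cos (2 * pi * u)" for n u
  proof -
    have "\<bar>u - of_int (round u)\<bar> < 2 / 5" using dist_round_less_of_cos_gt[OF u] by simp
    then have "u - of_int (round u) \<in> {-2/5<..<2/5}"
      unfolding greaterThanLessThan_iff by linarith
    then have "(deriv ^^ n) g (u - of_int (round u)) = (deriv ^^ n) (\<lambda>x. x ^ a / fact a) (u - of_int (round u))"
      by (intro higher_deriv_cong_open[of "{-2/5<..<2/5}"]) (auto simp: g_def \<theta>(2))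
    then show ?thesis using n by (auto simp: dA1 higher_deriv_monomial)
  qed
  have goodA2: "(deriv ^^ n) A2 u = (if n = a then 1 else 0)"
    if n: "a \<le> n" and u: "cos (2 * pi * u) < 1 / 2" for n u
  proof -
    have "cos (2 * pi * (u + 1 / 2)) = - cos (2 * pi * u)" by (simp add: algebra_simps)
    then show ?thesis using u goodA1[OF n, of "u + 1 / 2"] by (simp add: dA2)
  qed
  have right: "(deriv ^^ q) \<kappa>1 x = (deriv ^^ q) (\<lambda>x. x ^ b / fact b) x" "(deriv ^^ q) \<kappa>2 x = 0"
    if "x \<in> {1/3<..<3/2}" for q x
  proof -
    show "(deriv ^^ q) \<kappa>1 x = (deriv ^^ q) (\<lambda>x. x ^ b / fact b) x"
      by (rule higher_deriv_cong_open[OF _ _ that]) (auto simp: \<kappa>1_def \<psi> \<theta>')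
    have "(deriv ^^ q) \<kappa>2 x = (deriv ^^ q) (\<lambda>_. 0) x"
      by (rule higher_deriv_cong_open[OF _ _ that]) (auto simp: \<kappa>2_def \<psi> \<theta>')
    then show "(deriv ^^ q) \<kappa>2 x = 0" by (simp add: higher_deriv_zero)
  qed
  have left: "(deriv ^^ q) \<kappa>2 x = (deriv ^^ q) (\<lambda>x. x ^ b / fact b) x" "(deriv ^^ q) \<kappa>1 x = 0"
    if "x \<in> {-3/2<..<-1/3}" for q x
  proof -
    show "(deriv ^^ q) \<kappa>2 x = (deriv ^^ q) (\<lambda>x. x ^ b / fact b) x"
      by (rule higher_deriv_cong_open[OF _ _ that]) (auto simp: \<kappa>2_def \<psi> \<theta>')
    have "(deriv ^^ q) \<kappa>1 x = (deriv ^^ q) (\<lambda>_. 0) x"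
      by (rule higher_deriv_cong_open[OF _ _ that]) (auto simp: \<kappa>1_def \<psi> \<theta>')
    then show "(deriv ^^ q) \<kappa>1 x = 0" by (simp add: higher_deriv_zero)
  qed
  \<comment> \<open>In the transition zone the relevant derivatives of the two profiles coincide, so
    only the sum of the weights counts, and there \<open>\<psi>\<close> cancels.\<close>
  have both: "(deriv ^^ q) \<kappa>1 x + (deriv ^^ q) \<kappa>2 x = (deriv ^^ q) (\<lambda>x. x ^ b / fact b) x"
    if "x \<in> {-3/2<..<3/2}" for q x
  proof -
    have "(deriv ^^ q) (\<lambda>x. \<kappa>1 x + \<kappa>2 x) x = (deriv ^^ q) (\<lambda>x. x ^ b / fact b) x"
      by (rule higher_deriv_cong_open[OF _ _ that])
        (auto simp: \<kappa>1_def \<kappa>2_def \<theta>' field_simps)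
    then show ?thesis by (simp add: higher_deriv_add[OF sk1 sk2])
  qed
  show thesis
  proof (rule that[OF bA1 bA2 bk])
    fix u q assume q: "q \<le> b"
    define x where "x = cos (2 * pi * u)"
    have x: "-1 \<le> x" "x \<le> 1" by (auto simp: x_def)
    \<comment> \<open>For \<open>q < b\<close> the good profile is differentiated more than
      \<open>a\<close> times and gives 0; for \<open>q = b\<close> exactly \<open>a\<close> times,
      giving 1.\<close>
    have aq: "a \<le> a + b - q" "a + b - q = a \<longleftrightarrow> q = b" using q by auto
    have mq: "(deriv ^^ b) (\<lambda>x::real. x ^ b / fact b) x = 1" by (simp add: higher_deriv_monomial)
    have 1: "(deriv ^^ (a + b - q)) A1 u = (if q = b then 1 else 0)" if "-1/2 < x"
      using goodA1[OF aq(1), of u] that aq(2) by (simp add: x_def)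
    have 2: "(deriv ^^ (a + b - q)) A2 u = (if q = b then 1 else 0)" if "x < 1/2"
      using goodA2[OF aq(1), of u] that aq(2) by (simp add: x_def)
    consider "x > 1/3" | "x < -1/3" | "\<bar>x\<bar> \<le> 1/3" by linarith
    then show "(deriv ^^ (a + b - q)) A1 u * (deriv ^^ q) \<kappa>1 (cos (2 * pi * u)) +
      (deriv ^^ (a + b - q)) A2 u * (deriv ^^ q) \<kappa>2 (cos (2 * pi * u)) = (if q = b then 1 else 0)"
      unfolding x_def[symmetric]
    proof cases
      case 1
      then show "(deriv ^^ (a + b - q)) A1 u * (deriv ^^ q) \<kappa>1 x +
          (deriv ^^ (a + b - q)) A2 u * (deriv ^^ q) \<kappa>2 x = (if q = b then 1 else 0)"
        using \<open>-1/2 < x \<Longrightarrow> _\<close> right[of x q] mq x by auto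
    next
      case 2
      then show "(deriv ^^ (a + b - q)) A1 u * (deriv ^^ q) \<kappa>1 x +
          (deriv ^^ (a + b - q)) A2 u * (deriv ^^ q) \<kappa>2 x = (if q = b then 1 else 0)"
        using \<open>x < 1/2 \<Longrightarrow> _\<close> left[of x q] mq x by auto
    next
      case 3
      then have "-1/2 < x" "x < 1/2" "x \<in> {-3/2<..<3/2}" by auto
      then show "(deriv ^^ (a + b - q)) A1 u * (deriv ^^ q) \<kappa>1 x +
          (deriv ^^ (a + b - q)) A2 u * (deriv ^^ q) \<kappa>2 x = (if q = b then 1 else 0)"
        using \<open>-1/2 < x \<Longrightarrow> _\<close> \<open>x < 1/2 \<Longrightarrow> _\<close> both[of x q] mq by auto
    qed
  qed
qed

section \<open>Derivatives of oscillating functions\<close>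

text \<open>Parameter and point form one variable on a product space, so a smooth family is a single
  smooth function; only the second component is differentiated.\<close>

definition pd :: "'m \<Rightarrow> ((real^'q) \<times> (real^'m) \<Rightarrow> real) \<Rightarrow> (real^'q) \<times> (real^'m) \<Rightarrow> real" where
  "pd i g = (\<lambda>p. frechet_derivative g (at p) (0, axis i 1))"

definition pdl :: "'m list \<Rightarrow> ((real^'q) \<times> (real^'m) \<Rightarrow> real) \<Rightarrow> (real^'q) \<times> (real^'m) \<Rightarrow> real" where
  "pdl js g = fold pd js g"

lemma pdl_Nil [simp]: "pdl [] g = g"
  and pdl_Cons [simp]: "pdl (i # js) g = pdl js (pd i g)"
  by (simp_all add: pdl_def)

text \<open>The reversal turns the \<open>foldr\<close> of \<open>hpartial\<close> into the
  \<open>fold\<close> of \<open>pdl\<close> with the partial derivatives taken in the same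
  order.\<close>

definition ilist :: "('m::finite \<Rightarrow> nat) \<Rightarrow> 'm list" where
  "ilist \<alpha> = rev (concat (map (\<lambda>i. replicate (\<alpha> i) i) coord_list))"

lemma coord_list: "distinct (coord_list :: 'm::finite list)" "set (coord_list :: 'm list) = UNIV"
proof -
  have "\<exists>xs. distinct xs \<and> set xs = (UNIV :: 'm set)"
    using finite_distinct_list[of "UNIV :: 'm set"] by auto
  from someI_ex[OF this] show "distinct (coord_list :: 'm list)" "set (coord_list :: 'm list) = UNIV"
    by (auto simp: coord_list_def)
qed

lemma prod_list_ilist: "(\<Prod>i\<leftarrow>ilist \<alpha>. f i) = (\<Prod>i\<in>UNIV. (f i :: real) ^ \<alpha> i)"
proof -
  have "(\<Prod>i\<leftarrow>concat (map (\<lambda>i. replicate (\<alpha> i) i) xs). f i) = (\<Prod>i\<leftarrow>xs. f i ^ \<alpha> i)" for xs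
    by (induction xs) (auto simp: prod_list_replicate)
  then have "(\<Prod>i\<leftarrow>ilist \<alpha>. f i) = (\<Prod>i\<leftarrow>coord_list. f i ^ \<alpha> i)"
    by (simp add: ilist_def rev_map[symmetric] prod_list.rev)
  then show ?thesis
    using prod.distinct_set_conv_list[OF coord_list(1), of "\<lambda>i. f i ^ \<alpha> i"] by (simp add: coord_list(2))
qed

lemma length_ilist: "length (ilist \<alpha>) = mdeg \<alpha>"
proof -
  have "length (ilist \<alpha>) = (\<Sum>i\<leftarrow>coord_list. \<alpha> i)"
    by (simp add: ilist_def length_concat o_def)
  then show ?thesis
    using sum.distinct_set_conv_list[OF coord_list(1), of \<alpha>] by (simp add: coord_list(2) mdeg_def)
qed

lemma count_ilist: "count_list (ilist \<alpha>) i = \<alpha> i"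
proof -
  have "count_list (replicate n x) y = (if x = y then n else 0)" for n and x y :: 'a
    by (induction n) auto
  note count_list_replicate = this
  have "count_list (concat (map (\<lambda>i. replicate (\<alpha> i) i) xs)) i = (if i \<in> set xs then \<alpha> i else 0)"
    if "distinct xs" for xs
    using that by (induction xs) (auto simp: count_list_append count_list_replicate)
  from this[OF coord_list(1)] show ?thesis
    by (simp add: ilist_def count_list_rev coord_list(2))
qed

lemma pd_eqI: "(g has_derivative D) (at p) \<Longrightarrow> pd i g p = D (0, axis i 1)"
  unfolding pd_def by (simp add: frechet_derivative_at[symmetric])

lemma smooth_on_pd: "smooth_on UNIV g \<Longrightarrow> smooth_on UNIV (pd i g)"
  unfolding pd_def by (rule smooth_on_frechet_derivative)

lemma smooth_on_pdl: "smooth_on UNIV g \<Longrightarrow> smooth_on UNIV (pdl js g)"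
  by (induction js arbitrary: g) (auto intro: smooth_on_pd)

lemma smooth_on_UNIV_has_derivative:
  "smooth_on UNIV g \<Longrightarrow> (g has_derivative frechet_derivative g (at p)) (at p)"
  by (rule smooth_on_has_derivative) auto

lemma pd_linear:
  assumes "smooth_on UNIV f" "smooth_on UNIV g"
  shows "pd i (\<lambda>p. a * f p + b * g p) = (\<lambda>p. a * pd i f p + b * pd i g p)"
proof
  fix p
  have "((\<lambda>p. a * f p + b * g p) has_derivative
      (\<lambda>v. a * frechet_derivative f (at p) v + b * frechet_derivative g (at p) v)) (at p)"
    by (intro has_derivative_add has_derivative_mult_right smooth_on_UNIV_has_derivative assms)
  from pd_eqI[OF this] show "pd i (\<lambda>p. a * f p + b * g p) p = a * pd i f p + b * pd i g p"
    by (simp add: pd_def)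
qed

lemma smooth_on_linear_combination:
  fixes f g :: "'a::real_normed_vector \<Rightarrow> real"
  shows "smooth_on UNIV f \<Longrightarrow> smooth_on UNIV g \<Longrightarrow> smooth_on UNIV (\<lambda>p. a * f p + b * g p)"
  by (intro smooth_on_add smooth_on_mult) auto

lemma pdl_linear:
  assumes "smooth_on UNIV f" "smooth_on UNIV g"
  shows "pdl js (\<lambda>p. a * f p + b * g p) = (\<lambda>p. a * pdl js f p + b * pdl js g p)"
  using assms
proof (induction js arbitrary: f g)
  case (Cons i js)
  show ?case
    by (simp add: pd_linear[OF Cons.prems] Cons.IH[OF Cons.prems[THEN smooth_on_pd]])
qed simp

lemma pdl_add:
  assumes "smooth_on UNIV f" "smooth_on UNIV g"
  shows "pdl js (\<lambda>p. f p + g p) = (\<lambda>p. pdl js f p + pdl js g p)"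
  using pdl_linear[OF assms, of js 1 1] by simp

lemma pdl_cmult:
  assumes "smooth_on UNIV f"
  shows "pdl js (\<lambda>p. a * f p) = (\<lambda>p. a * pdl js f p)"
  using pdl_linear[OF assms assms, of js a 0] by simp

lemma pd_zero_on_open:
  assumes "open S" "\<And>p. p \<in> S \<Longrightarrow> g p = 0" "p \<in> S"
  shows "pd i g p = 0"
proof -
  have "(g has_derivative (\<lambda>_. 0)) (at p)"
    by (rule has_derivative_transform_within_open[OF has_derivative_const assms(1,3)])
      (simp add: assms(2))
  from pd_eqI[OF this] show ?thesis by simp
qed

lemma pdl_zero_on_open:
  assumes "open S" "\<And>p. p \<in> S \<Longrightarrow> g p = 0" "p \<in> S"
  shows "pdl js g p = 0"
  using assms(2)
proof (induction js arbitrary: g)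
  case (Cons i js)
  have "pd i g p = 0" if "p \<in> S" for p
    by (rule pd_zero_on_open[OF assms(1) Cons.prems that])
  from Cons.IH[OF this] show ?case by simp
qed (use assms in auto)

lemma partial_eq_pd:
  assumes "smooth_on UNIV g"
  shows "partial i (\<lambda>x. g (z, x)) = (\<lambda>x. pd i g (z, x))"
proof
  fix x
  have "((\<lambda>x. g (z, x)) has_derivative (\<lambda>v. frechet_derivative g (at (z, x)) (0, v))) (at x)"
    by (rule has_derivative_compose[OF _ smooth_on_UNIV_has_derivative[OF assms]])
      (intro has_derivative_Pair has_derivative_const has_derivative_ident)
  from frechet_derivative_at[OF this, symmetric]
  show "partial i (\<lambda>x. g (z, x)) x = pd i g (z, x)"
    by (simp add: partial_def pd_def)
qed

lemma hpartial_eq_pdl: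
  assumes "smooth_on UNIV g"
  shows "hpartial \<alpha> (\<lambda>x. g (z, x)) x = pdl (ilist \<alpha>) g (z, x)"
proof -
  have sm: "smooth_on UNIV ((pd i ^^ n) g)" if "smooth_on UNIV g" for g :: "(real^'a) \<times> (real^'b) \<Rightarrow> real" and i n
    using that by (induction n) (auto intro: smooth_on_pd)
  have 1: "(partial i ^^ n) (\<lambda>x. g (z, x)) = (\<lambda>x. (pd i ^^ n) g (z, x))"
    if "smooth_on UNIV g" for g :: "(real^'a) \<times> (real^'b) \<Rightarrow> real" and i n
    using that by (induction n) (auto simp: partial_eq_pd sm)
  have 2: "foldr (\<lambda>i g. (pd i ^^ \<alpha> i) g) xs g = foldr pd (concat (map (\<lambda>i. replicate (\<alpha> i) i) xs)) g" for xs
    by (induction xs) (auto simp: foldr_replicate)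
  have 3: "smooth_on UNIV (foldr (\<lambda>i g. (pd i ^^ \<alpha> i) g) xs g)" for xs
    by (induction xs) (auto simp: sm assms)
  have "foldr (\<lambda>i g. (partial i ^^ \<alpha> i) g) xs (\<lambda>x. g (z, x)) =
      (\<lambda>x. foldr (\<lambda>i g. (pd i ^^ \<alpha> i) g) xs g (z, x))" for xs
    by (induction xs) (auto simp: 1 3)
  then have "hpartial \<alpha> (\<lambda>x. g (z, x)) x = foldr pd (concat (map (\<lambda>i. replicate (\<alpha> i) i) coord_list)) g (z, x)"
    by (simp add: hpartial_def 2)
  then show ?thesis
    by (simp add: pdl_def ilist_def foldr_conv_fold)
qed

section \<open>Functions supported in a fixed compact set\<close>

definition csupp :: "'a::real_normed_vector set \<Rightarrow> ('a \<Rightarrow> real) \<Rightarrow> bool" where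
  "csupp Q g \<longleftrightarrow> smooth_on UNIV g \<and> (\<forall>p. p \<notin> Q \<longrightarrow> g p = 0)"

lemma csupp_smooth: "csupp Q g \<Longrightarrow> smooth_on UNIV g"
  and csupp_zero: "csupp Q g \<Longrightarrow> p \<notin> Q \<Longrightarrow> g p = 0"
  by (simp_all add: csupp_def)

lemma csupp_bound:
  assumes "compact Q" "csupp Q g"
  obtains B where "\<And>p. \<bar>g p\<bar> \<le> B"
proof -
  have "continuous_on Q g"
    using smooth_on_continuous_on[OF csupp_smooth[OF assms(2)]] continuous_on_subset by blast
  then have "bounded (g ` Q)"
    using assms(1) compact_continuous_image compact_imp_bounded by blast
  then obtain B where B: "\<And>p. p \<in> Q \<Longrightarrow> \<bar>g p\<bar> \<le> B" by (auto simp: bounded_iff)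
  have "\<bar>g p\<bar> \<le> max B 0" for p
    using B[of p] csupp_zero[OF assms(2), of p] by (cases "p \<in> Q") auto
  then show thesis by (rule that)
qed

lemma csupp_mult_right:
  "csupp Q c \<Longrightarrow> smooth_on UNIV g \<Longrightarrow> csupp Q (\<lambda>p. c p * g p)"
  by (auto simp: csupp_def intro: smooth_on_mult)

lemma csupp_add: "csupp Q f \<Longrightarrow> csupp Q g \<Longrightarrow> csupp Q (\<lambda>p. f p + g p)"
  by (auto simp: csupp_def intro: smooth_on_add)

lemma csupp_diff: "csupp Q f \<Longrightarrow> csupp Q g \<Longrightarrow> csupp Q (\<lambda>p. f p - g p)"
  by (auto simp: csupp_def intro: smooth_on_diff)

lemma csupp_cmult: "csupp Q f \<Longrightarrow> csupp Q (\<lambda>p. a * f p)"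
  by (auto simp: csupp_def intro!: smooth_on_mult)

lemma csupp_0: "csupp Q (\<lambda>_. 0)"
  by (simp add: csupp_def)

lemma csupp_pd:
  fixes g :: "(real^'q) \<times> (real^'m) \<Rightarrow> real"
  assumes "closed Q" "csupp Q g" shows "csupp Q (pd i g)"
  unfolding csupp_def
proof (intro conjI allI impI)
  show "smooth_on UNIV (pd i g)" using assms(2) by (simp add: csupp_def smooth_on_pd)
  show "pd i g p = 0" if "p \<notin> Q" for p
    by (rule pd_zero_on_open[of "- Q"]) (use assms that in \<open>auto simp: csupp_def open_Compl\<close>)
qed

lemma csupp_pdl:
  fixes g :: "(real^'q) \<times> (real^'m) \<Rightarrow> real"
  assumes "closed Q" "csupp Q g" shows "csupp Q (pdl js g)"
  using assms(2) by (induction js arbitrary: g) (auto intro: csupp_pd[OF assms(1)])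

text \<open>The coefficient of \<open>T ^ q\<close> in \<open>\<Prod>i\<leftarrow>js. (v $ i + pd i Y p * T)\<close>.\<close>

primrec mc :: "real^'m \<Rightarrow> ((real^'q) \<times> (real^'m) \<Rightarrow> real) \<Rightarrow> 'm list \<Rightarrow> nat \<Rightarrow> (real^'q) \<times> (real^'m) \<Rightarrow> real" where
  "mc v Y [] q p = (if q = 0 then 1 else 0)"
| "mc v Y (i # js) q p = v $ i * mc v Y js q p + (if q = 0 then 0 else pd i Y p * mc v Y js (q - 1) p)"

lemma mc_gt_length: "length js < q \<Longrightarrow> mc v Y js q p = 0"
  by (induction js arbitrary: q) auto

lemma smooth_on_mc: "smooth_on UNIV Y \<Longrightarrow> smooth_on UNIV (mc v Y js q)"
proof (induction js arbitrary: q)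
  case Nil
  then show ?case by (cases "q = 0") auto
next
  case (Cons i js)
  then show ?case
    by (cases "q = 0") (auto intro!: smooth_on_add smooth_on_mult smooth_on_pd)
qed

text \<open>As \<open>v\<close> has no component along \<open>i0\<close> and \<open>Y\<close> has
  unit derivative there, each occurrence of \<open>i0\<close> contributes the bare factor
  \<open>T\<close>. The product is thus divisible by \<open>T ^ count_list js i0\<close>.\<close>

lemma mc_lt_count:
  assumes "v $ i0 = 0" "pd i0 Y p = 1"
  shows "q < count_list js i0 \<Longrightarrow> mc v Y js q p = 0"
proof (induction js arbitrary: q)
  case (Cons i js)
  show ?case
  proof (cases "i = i0")
    case True
    then show ?thesis using Cons.IH[of "q - 1"] Cons.prems assms by simp
  next
    case False
    then show ?thesis using Cons.IH[of q] Cons.IH[of "q - 1"] Cons.prems by simp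
  qed
qed simp

text \<open>The lowest power of \<open>T\<close> takes the constant term \<open>v $ i\<close> of
  every factor with \<open>i \<noteq> i0\<close>, so the horizontal derivatives of \<open>Y\<close>
  do not enter it. This makes the system of equations triangular in the exponent of
  \<open>i0\<close>.\<close>

lemma mc_count:
  assumes "v $ i0 = 0" "pd i0 Y p = 1"
  shows "mc v Y js (count_list js i0) p = (\<Prod>i\<leftarrow>js. if i = i0 then 1 else v $ i)"
  by (induction js) (auto simp: assms mc_lt_count[OF assms])

section \<open>Oscillating products and their leading terms\<close>

definition osc :: "real^'m \<Rightarrow> ((real^'q) \<times> (real^'m) \<Rightarrow> real) \<Rightarrow> ((real^'q) \<times> (real^'m) \<Rightarrow> real) \<Rightarrow>
    (real \<Rightarrow> real) \<Rightarrow> (real \<Rightarrow> real) \<Rightarrow> real \<Rightarrow> (real^'q) \<times> (real^'m) \<Rightarrow> real" where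
  "osc v Y c A C N p = c p * (A (N * (v \<bullet> snd p)) * C (N * Y p))"

text \<open>The coefficient of \<open>N ^ length js\<close> in the derivative of \<open>osc\<close>
  along \<open>js\<close>: every derivative falls on \<open>A\<close> or on \<open>C\<close>,
  exactly \<open>q\<close> of them on \<open>C\<close>, and the inner derivatives of all such
  choices sum to \<open>mc\<close>.\<close>

definition osc_main :: "real^'m \<Rightarrow> ((real^'q) \<times> (real^'m) \<Rightarrow> real) \<Rightarrow> 'm list \<Rightarrow> ((real^'q) \<times> (real^'m) \<Rightarrow> real) \<Rightarrow>
    (real \<Rightarrow> real) \<Rightarrow> (real \<Rightarrow> real) \<Rightarrow> real \<Rightarrow> (real^'q) \<times> (real^'m) \<Rightarrow> real" where
  "osc_main v Y js c A C N p = (\<Sum>q\<le>length js. c p * mc v Y js q p *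
      ((deriv ^^ (length js - q)) A (N * (v \<bullet> snd p)) * (deriv ^^ q) C (N * Y p)))"

lemma smooth_on_osc:
  fixes Y :: "(real^'q) \<times> (real^'m) \<Rightarrow> real"
  assumes "smooth_on UNIV Y" "smooth_on UNIV c" "smooth_on UNIV A" "smooth_on UNIV C"
  shows "smooth_on UNIV (osc v Y c A C N)"
proof -
  have "smooth_on UNIV (\<lambda>p::(real^'q) \<times> (real^'m). N * (v \<bullet> snd p))"
    by (intro smooth_on_mult smooth_on_const open_UNIV smooth_on_bounded_linear
        bounded_linear_intros)
  then have "smooth_on UNIV (\<lambda>p::(real^'q) \<times> (real^'m). A (N * (v \<bullet> snd p)))"
    by (rule smooth_on_compose[OF assms(3)]) simp
  moreover have "smooth_on UNIV (\<lambda>p. C (N * Y p))"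
    by (rule smooth_on_compose[OF assms(4)]) (auto intro!: smooth_on_mult assms)
  ultimately show ?thesis
    unfolding osc_def[abs_def] by (intro smooth_on_mult assms)
qed

text \<open>The coefficients \<open>1\<close> give the right-hand side the exact shape in which
  \<open>pdl_linear\<close> rewrites it.\<close>

lemma pd_osc:
  fixes Y :: "(real^'q) \<times> (real^'m) \<Rightarrow> real"
  assumes Y: "smooth_on UNIV Y" and c: "smooth_on UNIV c"
    and A: "smooth_on UNIV A" and C: "smooth_on UNIV C"
  shows "pd i (osc v Y c A C N) =
    (\<lambda>p. N * (1 * osc v Y (\<lambda>p. c p * v $ i) (deriv A) C N p + 1 * osc v Y (\<lambda>p. c p * pd i Y p) A (deriv C) N p)
      + 1 * osc v Y (pd i c) A C N p)"
proof
  fix p :: "(real^'q) \<times> (real^'m)"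
  have a: "((\<lambda>p::(real^'q) \<times> (real^'m). A (N * (v \<bullet> snd p))) has_derivative
      (\<lambda>h. deriv A (N * (v \<bullet> snd p)) * (N * (v \<bullet> snd h)))) (at p)"
    by (rule has_derivative_compose[OF _ smooth_on_real_deriv(1)[OF A, unfolded has_field_derivative_def]])
      (auto intro!: derivative_eq_intros)
  have b: "((\<lambda>p. C (N * Y p)) has_derivative
      (\<lambda>h. deriv C (N * Y p) * (N * frechet_derivative Y (at p) h))) (at p)"
    by (rule has_derivative_compose[OF _ smooth_on_real_deriv(1)[OF C, unfolded has_field_derivative_def]])
      (intro has_derivative_mult_right smooth_on_UNIV_has_derivative Y)
  have "((\<lambda>p. c p * (A (N * (v \<bullet> snd p)) * C (N * Y p))) has_derivative
      (\<lambda>h. c p * (A (N * (v \<bullet> snd p)) * (deriv C (N * Y p) * (N * frechet_derivative Y (at p) h)) +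
          (deriv A (N * (v \<bullet> snd p)) * (N * (v \<bullet> snd h))) * C (N * Y p)) +
        frechet_derivative c (at p) h * (A (N * (v \<bullet> snd p)) * C (N * Y p)))) (at p)"
    by (intro has_derivative_mult a b smooth_on_UNIV_has_derivative c)
  from pd_eqI[OF this, of i]
  have "pd i (osc v Y c A C N) p =
      c p * (A (N * (v \<bullet> snd p)) * (deriv C (N * Y p) * (N * pd i Y p)) +
          (deriv A (N * (v \<bullet> snd p)) * (N * (v $ i))) * C (N * Y p)) +
        pd i c p * (A (N * (v \<bullet> snd p)) * C (N * Y p))"
    unfolding osc_def[abs_def] by (simp add: pd_def inner_axis)
  then show "pd i (osc v Y c A C N) p =
    N * (1 * osc v Y (\<lambda>p. c p * v $ i) (deriv A) C N p + 1 * osc v Y (\<lambda>p. c p * pd i Y p) A (deriv C) N p)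
      + 1 * osc v Y (pd i c) A C N p"
    by (simp add: osc_def algebra_simps)
qed

lemma osc_main_bound:
  fixes Y :: "(real^'q) \<times> (real^'m) \<Rightarrow> real"
  assumes Q: "compact Q" and Y: "smooth_on UNIV Y" and c: "csupp Q c"
    and A: "smooth_bdd A" and C: "smooth_bdd C"
  obtains B where "\<And>N p. \<bar>osc_main v Y js c A C N p\<bar> \<le> B"
proof -
  have "\<exists>B. \<forall>N p. \<bar>c p * mc v Y js q p *
      ((deriv ^^ (length js - q)) A (N * (v \<bullet> snd p)) * (deriv ^^ q) C (N * Y p))\<bar> \<le> B" for q
  proof -
    obtain B1 where B1: "\<And>p. \<bar>c p * mc v Y js q p\<bar> \<le> B1"
      using csupp_bound[OF Q csupp_mult_right[OF c smooth_on_mc[OF Y]]] by metis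
    obtain B2 where B2: "\<And>x. \<bar>(deriv ^^ (length js - q)) A x\<bar> \<le> B2"
      using smooth_bddE[OF A] by metis
    obtain B3 where B3: "\<And>x. \<bar>(deriv ^^ q) C x\<bar> \<le> B3"
      using smooth_bddE[OF C] by metis
    have "\<bar>c p * mc v Y js q p *
      ((deriv ^^ (length js - q)) A (N * (v \<bullet> snd p)) * (deriv ^^ q) C (N * Y p))\<bar> \<le> B1 * (B2 * B3)" for N p
      unfolding abs_mult[of "c p * mc v Y js q p"] abs_mult[of "(deriv ^^ (length js - q)) A (N * (v \<bullet> snd p))"]
      by (intro mult_mono B1 B2 B3 mult_nonneg_nonneg)
        (use B1 B2 B3 in \<open>auto intro: order_trans[OF abs_ge_zero]\<close>)
    then show ?thesis by blast
  qed
  then obtain B where B: "\<And>q N p. \<bar>c p * mc v Y js q p *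
      ((deriv ^^ (length js - q)) A (N * (v \<bullet> snd p)) * (deriv ^^ q) C (N * Y p))\<bar> \<le> B q"
    by metis
  have "\<bar>osc_main v Y js c A C N p\<bar> \<le> (\<Sum>q\<le>length js. B q)" for N p
    unfolding osc_main_def by (rule order_trans[OF sum_abs sum_mono]) (rule B)
  then show thesis by (rule that)
qed

text \<open>The recursion of \<open>mc\<close> splits according to whether the first derivative hits
  \<open>A\<close> or \<open>C\<close>. The first sum loses its top term and the second its bottom
  term, which leaves two sums of the length for \<open>js\<close>.\<close>

lemma osc_main_Cons:
  "osc_main v Y (i # js) c A C N p =
    osc_main v Y js (\<lambda>p. c p * v $ i) (deriv A) C N p + osc_main v Y js (\<lambda>p. c p * pd i Y p) A (deriv C) N p"
proof -
  let ?s = "length js"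
  let ?a = "\<lambda>k. (deriv ^^ k) A (N * (v \<bullet> snd p))" and ?c = "\<lambda>k. (deriv ^^ k) C (N * Y p)"
  have d: "(deriv ^^ k) (deriv f) = (deriv ^^ Suc k) f" for k and f :: "real \<Rightarrow> real"
    by (simp only: funpow_Suc_right o_apply)
  have "osc_main v Y (i # js) c A C N p =
      (\<Sum>q\<le>Suc ?s. c p * (v $ i * mc v Y js q p) * (?a (Suc ?s - q) * ?c q)) +
      (\<Sum>q\<le>Suc ?s. c p * (if q = 0 then 0 else pd i Y p * mc v Y js (q - 1) p) * (?a (Suc ?s - q) * ?c q))"
    unfolding osc_main_def by (simp add: distrib_left distrib_right sum.distrib del: sum.atMost_Suc)
  also have "(\<Sum>q\<le>Suc ?s. c p * (v $ i * mc v Y js q p) * (?a (Suc ?s - q) * ?c q)) =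
      osc_main v Y js (\<lambda>p. c p * v $ i) (deriv A) C N p"
  proof -
    have "(\<Sum>q\<le>Suc ?s. c p * (v $ i * mc v Y js q p) * (?a (Suc ?s - q) * ?c q)) =
        (\<Sum>q\<le>?s. c p * (v $ i * mc v Y js q p) * (?a (Suc ?s - q) * ?c q))"
      by (simp add: mc_gt_length)
    also have "\<dots> = osc_main v Y js (\<lambda>p. c p * v $ i) (deriv A) C N p"
      unfolding osc_main_def d by (intro sum.cong) (auto simp: Suc_diff_le mult_ac)
    finally show ?thesis .
  qed
  also have "(\<Sum>q\<le>Suc ?s. c p * (if q = 0 then 0 else pd i Y p * mc v Y js (q - 1) p) * (?a (Suc ?s - q) * ?c q)) =
      osc_main v Y js (\<lambda>p. c p * pd i Y p) A (deriv C) N p"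
    unfolding osc_main_def d sum.atMost_Suc_shift by (simp add: mult_ac)
  finally show ?thesis .
qed

text \<open>A derivative that falls on a profile brings out a factor \<open>N\<close>. One that
  falls on the amplitude, into which the factors \<open>v $ i\<close> and \<open>pd i Y\<close> are
  absorbed, does not; all terms containing such a derivative belong to the remainder, one power of
  \<open>N\<close> lower. The induction therefore varies \<open>c\<close>, \<open>A\<close> and
  \<open>C\<close>, and the constants are uniform because these classes are closed under
  differentiation.\<close>

lemma pdl_osc_asymptotics:
  fixes Y :: "(real^'q) \<times> (real^'m) \<Rightarrow> real"
  assumes Q: "compact Q" and Y: "smooth_on UNIV Y"
  shows "csupp Q c \<Longrightarrow> smooth_bdd A \<Longrightarrow> smooth_bdd C \<Longrightarrow>
    \<exists>B. \<forall>N\<ge>1. \<forall>p. \<bar>pdl js (osc v Y c A C N) p - N ^ length js * osc_main v Y js c A C N p\<bar>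
      \<le> B * N ^ length js / N"
proof (induction js arbitrary: c A C)
  case Nil
  show ?case by (intro exI[of _ 0]) (simp add: osc_def osc_main_def)
next
  case (Cons i js)
  let ?s = "length js"
  note sm = csupp_smooth[OF Cons.prems(1)] smooth_bdd_smooth[OF Cons.prems(2)] smooth_bdd_smooth[OF Cons.prems(3)]
  define g1 where "g1 = osc v Y (\<lambda>p. c p * v $ i) (deriv A) C"
  define g2 where "g2 = osc v Y (\<lambda>p. c p * pd i Y p) A (deriv C)"
  define g3 where "g3 = osc v Y (pd i c) A C"
  define M1 where "M1 = osc_main v Y js (\<lambda>p. c p * v $ i) (deriv A) C"
  define M2 where "M2 = osc_main v Y js (\<lambda>p. c p * pd i Y p) A (deriv C)"
  define M3 where "M3 = osc_main v Y js (pd i c) A C"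
  have c1: "csupp Q (\<lambda>p. c p * v $ i)" and c2: "csupp Q (\<lambda>p. c p * pd i Y p)" and c3: "csupp Q (pd i c)"
    by (intro csupp_mult_right Cons.prems smooth_on_const open_UNIV smooth_on_pd Y
        csupp_pd compact_imp_closed Q)+
  have A': "smooth_bdd (deriv A)" and C': "smooth_bdd (deriv C)"
    by (intro smooth_bdd_deriv Cons.prems)+
  obtain B1 where B1: "\<And>N p. N \<ge> 1 \<Longrightarrow> \<bar>pdl js (g1 N) p - N ^ ?s * M1 N p\<bar> \<le> B1 * N ^ ?s / N"
    using Cons.IH[OF c1 A' Cons.prems(3)] unfolding g1_def M1_def by auto
  obtain B2 where B2: "\<And>N p. N \<ge> 1 \<Longrightarrow> \<bar>pdl js (g2 N) p - N ^ ?s * M2 N p\<bar> \<le> B2 * N ^ ?s / N"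
    using Cons.IH[OF c2 Cons.prems(2) C'] unfolding g2_def M2_def by auto
  obtain B3 where B3: "\<And>N p. N \<ge> 1 \<Longrightarrow> \<bar>pdl js (g3 N) p - N ^ ?s * M3 N p\<bar> \<le> B3 * N ^ ?s / N"
    using Cons.IH[OF c3 Cons.prems(2,3)] unfolding g3_def M3_def by auto
  obtain B4 where "\<And>N p. \<bar>osc_main v Y js (pd i c) A C N p\<bar> \<le> B4"
    by (rule osc_main_bound[OF Q Y c3 Cons.prems(2,3), where v = v and js = js], rule that)
  then have B4: "\<And>N p. \<bar>M3 N p\<bar> \<le> B4" by (simp add: M3_def)
  have g: "smooth_on UNIV (g1 N)" "smooth_on UNIV (g2 N)" "smooth_on UNIV (g3 N)" for N
    unfolding g1_def g2_def g3_def
    by (intro smooth_on_osc Y csupp_smooth[OF c1] csupp_smooth[OF c2] csupp_smooth[OF c3] sm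
        smooth_bdd_smooth[OF A'] smooth_bdd_smooth[OF C'])+
  show ?case
  proof (intro exI[of _ "B1 + B2 + B4 + \<bar>B3\<bar>"] allI impI)
    fix N :: real and p assume N: "1 \<le> N"
    have "pdl (i # js) (osc v Y c A C N) p = N * (pdl js (g1 N) p + pdl js (g2 N) p) + pdl js (g3 N) p"
    proof -
      have "pdl (i # js) (osc v Y c A C N) =
          pdl js (\<lambda>p. N * (1 * g1 N p + 1 * g2 N p) + 1 * g3 N p)"
        by (simp only: pdl_Cons pd_osc[OF Y sm] g1_def g2_def g3_def)
      also have "\<dots> = (\<lambda>p. N * (1 * pdl js (g1 N) p + 1 * pdl js (g2 N) p) + 1 * pdl js (g3 N) p)"
        by (simp only: pdl_linear g smooth_on_linear_combination)
      finally show ?thesis by simp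
    qed
    moreover have "osc_main v Y (i # js) c A C N p = M1 N p + M2 N p"
      unfolding M1_def M2_def by (rule osc_main_Cons)
    ultimately have "pdl (i # js) (osc v Y c A C N) p - N ^ length (i # js) * osc_main v Y (i # js) c A C N p =
        N * (pdl js (g1 N) p - N ^ ?s * M1 N p) + N * (pdl js (g2 N) p - N ^ ?s * M2 N p) +
        ((pdl js (g3 N) p - N ^ ?s * M3 N p) + N ^ ?s * M3 N p)"
      by (simp add: algebra_simps)
    also have "\<bar>\<dots>\<bar> \<le> N * (B1 * N ^ ?s / N) + N * (B2 * N ^ ?s / N) + (\<bar>B3\<bar> * N ^ ?s + N ^ ?s * B4)"
    proof -
      have "\<bar>N * (pdl js (g1 N) p - N ^ ?s * M1 N p)\<bar> \<le> N * (B1 * N ^ ?s / N)"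
        using mult_left_mono[OF B1[OF N, of p], of N] N by (simp add: abs_mult)
      moreover have "\<bar>N * (pdl js (g2 N) p - N ^ ?s * M2 N p)\<bar> \<le> N * (B2 * N ^ ?s / N)"
        using mult_left_mono[OF B2[OF N, of p], of N] N by (simp add: abs_mult)
      moreover have "\<bar>N ^ ?s * M3 N p\<bar> \<le> N ^ ?s * B4"
        using B4[of N p] N by (simp add: abs_mult)
      moreover have "\<bar>pdl js (g3 N) p - N ^ ?s * M3 N p\<bar> \<le> \<bar>B3\<bar> * N ^ ?s"
      proof -
        have "B3 * N ^ ?s / N \<le> \<bar>B3\<bar> * N ^ ?s / 1"
          using N by (intro frac_le mult_right_mono) auto
        with B3[OF N, of p] show ?thesis by simp
      qed
      ultimately show ?thesis by linarith
    qed
    also have "\<dots> = (B1 + B2 + B4 + \<bar>B3\<bar>) * N ^ length (i # js) / N"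
      using N by (simp add: field_simps)
    finally show "\<bar>pdl (i # js) (osc v Y c A C N) p - N ^ length (i # js) * osc_main v Y (i # js) c A C N p\<bar>
        \<le> (B1 + B2 + B4 + \<bar>B3\<bar>) * N ^ length (i # js) / N" .
  qed
qed

section \<open>Polarization and wiggled hyperplanes\<close>

text \<open>Lagrange interpolation at the nodes \<open>0, ..., n\<close>: the polynomial
  \<open>T ^ i\<close> is the sum of its values at the nodes times the basis polynomials
  \<open>\<Lambda> t\<close>. Comparing coefficients of \<open>T ^ e\<close> gives the
  weights.\<close>

lemma lagrange_coefficient_extraction:
  assumes e: "e \<le> n"
  obtains w :: "nat \<Rightarrow> real"
  where "\<And>i. i \<le> n \<Longrightarrow> (\<Sum>t\<le>n. w t * real t ^ i) = (if i = e then 1 else 0)"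
proof -
  define \<Lambda> :: "nat \<Rightarrow> real poly" where
    "\<Lambda> t = (\<Prod>s\<in>{..n} - {t}. smult (1 / (real t - real s)) [:- real s, 1:])" for t
  have deg: "degree (\<Lambda> t) \<le> n" if "t \<le> n" for t
  proof -
    have "degree (\<Lambda> t) \<le> sum (degree \<circ> (\<lambda>s. smult (1 / (real t - real s)) [:- real s, 1:])) ({..n} - {t})"
      unfolding \<Lambda>_def by (rule degree_prod_sum_le) simp
    also have "\<dots> \<le> (\<Sum>s\<in>{..n} - {t}. 1)" by (intro sum_mono) simp
    also have "\<dots> = n" using that by simp
    finally show ?thesis .
  qed
  have val: "poly (\<Lambda> t) (real u) = (if u = t then 1 else 0)" if "u \<le> n" for t u
  proof -
    have "poly (\<Lambda> t) (real u) = (\<Prod>s\<in>{..n} - {t}. (real u - real s) / (real t - real s))"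
      unfolding \<Lambda>_def by (simp add: poly_prod diff_divide_distrib)
    also have "\<dots> = (if u = t then 1 else 0)"
    proof (cases "u = t")
      case True
      then show ?thesis by (auto intro!: prod.neutral)
    next
      case False
      then show ?thesis using that by (auto intro!: prod_zero)
    qed
    finally show ?thesis .
  qed
  show thesis
  proof (rule that[of "\<lambda>t. coeff (\<Lambda> t) e"])
    fix i assume i: "i \<le> n"
    let ?p = "\<Sum>t\<le>n. smult (real t ^ i) (\<Lambda> t)"
    have "monom 1 i = ?p"
    proof (rule poly_eqI_degree[where A = "real ` {..n}"])
      have card: "card (real ` {..n}) = Suc n" by (simp add: card_image)
      show "degree (monom 1 i :: real poly) < card (real ` {..n})"
        using i degree_monom_le[of "1::real" i] card by simp
      have "degree ?p \<le> n"
        using deg by (intro degree_sum_le) (auto intro: order_trans[OF degree_smult_le])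
      then show "degree ?p < card (real ` {..n})" using card by simp
      fix x assume "x \<in> real ` {..n}"
      then obtain u where u: "u \<le> n" "x = real u" by auto
      have "poly ?p x = (\<Sum>t\<le>n. if t = u then real u ^ i else 0)"
        unfolding poly_sum by (intro sum.cong) (auto simp: u val)
      then show "poly (monom 1 i) x = poly ?p x" using u by (simp add: poly_monom)
    qed
    then have "coeff (monom 1 i) e = coeff ?p e" by simp
    then show "(\<Sum>t\<le>n. coeff (\<Lambda> t) e * real t ^ i) = (if i = e then 1 else 0)"
      by (simp add: coeff_sum mult.commute)
  qed
qed

lemma le_mdeg: "\<alpha> i \<le> mdeg \<alpha>"
  unfolding mdeg_def by (rule member_le_sum) auto

lemma finite_mdeg_le: "finite {\<alpha> :: 'm::finite \<Rightarrow> nat. mdeg \<alpha> \<le> d}"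
proof (rule finite_subset)
  show "{\<alpha> :: 'm \<Rightarrow> nat. mdeg \<alpha> \<le> d} \<subseteq> PiE UNIV (\<lambda>_. {..d})"
    by (auto simp: PiE_def extensional_def intro: order_trans[OF le_mdeg])
  show "finite (PiE (UNIV :: 'm set) (\<lambda>_. {..d}))" by (intro finite_PiE) auto
qed

text \<open>Polarization: among monomials with a fixed exponent at \<open>i0\<close>, each one is a combination of powers
  of the linear forms in the other variables whose coefficient vectors \<open>t\<close> lie on a grid.\<close>

lemma grid_polarization:
  fixes i0 :: "'m::finite"
  obtains W :: "('m \<Rightarrow> nat) \<Rightarrow> ('m \<Rightarrow> nat) \<Rightarrow> real"
  where "\<And>\<alpha> \<alpha>0. mdeg \<alpha> = d \<Longrightarrow> mdeg \<alpha>0 = d \<Longrightarrow> \<alpha> i0 = \<alpha>0 i0 \<Longrightarrow>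
    (\<Sum>t\<in>PiE UNIV (\<lambda>_. {..d}). W \<alpha>0 t * (\<Prod>i\<in>UNIV. (if i = i0 then 1 else real (t i)) ^ \<alpha> i)) =
      (if \<alpha> = \<alpha>0 then 1 else 0)"
proof -
  have "\<exists>w :: nat \<Rightarrow> real. \<forall>i\<le>d. (\<Sum>t\<le>d. w t * real t ^ i) = (if i = e then 1 else 0)" if "e \<le> d" for e
    by (rule lagrange_coefficient_extraction[OF that]) blast
  then obtain w :: "nat \<Rightarrow> nat \<Rightarrow> real" where
    w: "\<And>e i. e \<le> d \<Longrightarrow> i \<le> d \<Longrightarrow> (\<Sum>t\<le>d. w e t * real t ^ i) = (if i = e then 1 else 0)"
    by metis
  \<comment> \<open>At \<open>i0\<close> the two exponents agree by assumption, so the weights there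
    only have to sum to 1; they are concentrated at \<open>t = 0\<close>.\<close>
  define \<mu> where "\<mu> \<alpha>0 i t = (if i = i0 then (if t = 0 then 1 else 0) else w (\<alpha>0 i) t)"
    for \<alpha>0 :: "'m \<Rightarrow> nat" and i t
  show thesis
  proof (rule that[of "\<lambda>\<alpha>0 t. \<Prod>i\<in>UNIV. \<mu> \<alpha>0 i (t i)"])
    fix \<alpha> \<alpha>0 :: "'m \<Rightarrow> nat"
    assume *: "mdeg \<alpha> = d" "mdeg \<alpha>0 = d" "\<alpha> i0 = \<alpha>0 i0"
    have le: "\<alpha> i \<le> d" "\<alpha>0 i \<le> d" for i using le_mdeg[of \<alpha> i] le_mdeg[of \<alpha>0 i] * by auto
    let ?\<nu> = "\<lambda>i t. (if i = i0 then 1 else real t) ^ \<alpha> i"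
    have "(\<Sum>t\<in>PiE UNIV (\<lambda>_. {..d}). (\<Prod>i\<in>UNIV. \<mu> \<alpha>0 i (t i)) * (\<Prod>i\<in>UNIV. ?\<nu> i (t i))) =
        (\<Sum>t\<in>PiE UNIV (\<lambda>_. {..d}). \<Prod>i\<in>UNIV. \<mu> \<alpha>0 i (t i) * ?\<nu> i (t i))"
      by (simp add: prod.distrib)
    also have "\<dots> = (\<Prod>i\<in>UNIV. \<Sum>t\<le>d. \<mu> \<alpha>0 i t * ?\<nu> i t)"
      by (rule prod_sum_PiE[symmetric]) auto
    also have "\<dots> = (\<Prod>i\<in>UNIV. if \<alpha> i = \<alpha>0 i then 1 else 0)"
    proof (rule prod.cong[OF refl])
      fix i
      show "(\<Sum>t\<le>d. \<mu> \<alpha>0 i t * ?\<nu> i t) = (if \<alpha> i = \<alpha>0 i then 1 else 0)"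
      proof (cases "i = i0")
        case True
        then show ?thesis using * by (simp add: \<mu>_def)
      next
        case False
        then show ?thesis using w[OF le(2) le(1), of i i] by (simp add: \<mu>_def)
      qed
    qed
    also have "\<dots> = (if \<alpha> = \<alpha>0 then 1 else 0)"
    proof (cases "\<alpha> = \<alpha>0")
      case False
      then obtain i where "\<alpha> i \<noteq> \<alpha>0 i" by blast
      then have "(\<Prod>i\<in>UNIV. if \<alpha> i = \<alpha>0 i then 1 else (0::real)) = 0" by (intro prod_zero) auto
      then show ?thesis using False by simp
    qed simp
    finally show "(\<Sum>t\<in>PiE UNIV (\<lambda>_. {..d}). (\<Prod>i\<in>UNIV. \<mu> \<alpha>0 i (t i)) * (\<Prod>i\<in>UNIV. ?\<nu> i (t i))) =
        (if \<alpha> = \<alpha>0 then 1 else 0)" .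
  qed
qed

lemma finite_uniform_bound:
  fixes f :: "'a \<Rightarrow> 'b \<Rightarrow> real"
  assumes "finite S" "\<And>a. a \<in> S \<Longrightarrow> \<exists>B. \<forall>x. f a x \<le> B"
  obtains B where "\<And>a x. a \<in> S \<Longrightarrow> f a x \<le> B" "B \<ge> 0"
proof -
  obtain B where B: "\<And>a x. a \<in> S \<Longrightarrow> f a x \<le> B a" using assms(2) by metis
  have "f a x \<le> (\<Sum>a\<in>S. \<bar>B a\<bar>)" if "a \<in> S" for a x
    using B[OF that, of x] member_le_sum[of a S "\<lambda>a. \<bar>B a\<bar>"] that assms(1) by fastforce
  then show thesis by (rule that) (auto intro: sum_nonneg)
qed

text \<open>Coefficients are supported in this box, while wiggles may reach up to the margin
  \<open>\<delta> / 2\<close>. The strip in between leaves room to cut off a wiggle without changing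
  it where a coefficient is nonzero.\<close>

definition Qbox :: "real \<Rightarrow> ((real^'q) \<times> (real^'m)) set" where
  "Qbox \<delta> = {p. (\<forall>i. \<bar>fst p $ i\<bar> \<le> 1 - \<delta>) \<and> (\<forall>i. \<bar>snd p $ i\<bar> \<le> 1 - \<delta>)}"

lemma compact_Qbox: "compact (Qbox \<delta> :: ((real^'q) \<times> (real^'m)) set)"
proof -
  have "(Qbox \<delta> :: ((real^'q) \<times> (real^'m)) set) =
      cbox (\<chi> i. - (1 - \<delta>)) (\<chi> i. 1 - \<delta>) \<times> cbox (\<chi> i. - (1 - \<delta>)) (\<chi> i. 1 - \<delta>)"
    by (auto simp: Qbox_def mem_box_cart abs_le_iff) (smt (verit))+
  then show ?thesis by (simp add: compact_Times)
qed

text \<open>Admissible heights \<open>x $ i0 = W (z, x)\<close> of the wiggled hyperplane.\<close>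

definition wig :: "real \<Rightarrow> 'm \<Rightarrow> ((real^'q) \<times> (real^'m) \<Rightarrow> real) \<Rightarrow> bool" where
  "wig \<delta> i0 W \<longleftrightarrow> smooth_on UNIV W \<and> (\<forall>z x t. W (z, x + t *\<^sub>R axis i0 1) = W (z, x)) \<and>
    (\<forall>z x. (\<exists>i. 1 - \<delta> / 2 < \<bar>z $ i\<bar>) \<or> (\<exists>i. i \<noteq> i0 \<and> 1 - \<delta> / 2 < \<bar>x $ i\<bar>) \<longrightarrow> W (z, x) = 0)"

lemma wig_smooth: "wig \<delta> i0 W \<Longrightarrow> smooth_on UNIV W"
  and wig_shift: "wig \<delta> i0 W \<Longrightarrow> W (z, x + t *\<^sub>R axis i0 1) = W (z, x)"
  and wig_zero: "wig \<delta> i0 W \<Longrightarrow>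
    (\<exists>i. 1 - \<delta> / 2 < \<bar>z $ i\<bar>) \<or> (\<exists>i. i \<noteq> i0 \<and> 1 - \<delta> / 2 < \<bar>x $ i\<bar>) \<Longrightarrow> W (z, x) = 0"
  unfolding wig_def by blast+

lemma smooth_on_coord:
  "smooth_on UNIV (\<lambda>p::(real^'q) \<times> (real^'m). fst p $ i)"
  "smooth_on UNIV (\<lambda>p::(real^'q) \<times> (real^'m). snd p $ j)"
  by (intro smooth_on_bounded_linear open_UNIV bounded_linear_vec_nth[THEN bounded_linear_compose]
      bounded_linear_fst bounded_linear_snd)+

text \<open>A product of bumps in the coordinates; the factor for \<open>i0\<close> is left out,
  which keeps the cut-off constant along \<open>i0\<close>, as \<open>wig\<close> demands.\<close>

lemma cutoff_exists:
  fixes i0 :: "'m::finite"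
  assumes \<delta>: "0 < \<delta>" "\<delta> < 1"
  obtains \<kappa> :: "(real^'q) \<times> (real^'m) \<Rightarrow> real"
  where "wig \<delta> i0 \<kappa>" "\<And>p. p \<in> Qbox \<delta> \<Longrightarrow> \<kappa> p = 1" "\<And>p. \<bar>\<kappa> p\<bar> \<le> 1"
proof -
  obtain b :: "real \<Rightarrow> real" where b: "smooth_on UNIV b" "\<And>x. 0 \<le> b x" "\<And>x. b x \<le> 1"
    "\<And>x. \<bar>x\<bar> \<le> 1 - \<delta> \<Longrightarrow> b x = 1" "\<And>x. 1 - \<delta> / 2 \<le> \<bar>x\<bar> \<Longrightarrow> b x = 0"
    by (rule smooth_bump_exists[of "1 - \<delta>" "1 - \<delta> / 2"]) (use \<delta> in auto)
  define \<kappa> where "\<kappa> p = (\<Prod>i\<in>UNIV. b (fst p $ i)) * (\<Prod>i\<in>UNIV - {i0}. b (snd p $ i))"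
    for p :: "(real^'q) \<times> (real^'m)"
  show thesis
  proof
    show "\<kappa> p = 1" if "p \<in> Qbox \<delta>" for p
      using that by (simp add: \<kappa>_def Qbox_def b(4))
    show "\<bar>\<kappa> p\<bar> \<le> 1" for p
      unfolding \<kappa>_def by (subst abs_of_nonneg)
        (auto intro!: mult_nonneg_nonneg mult_le_one prod_nonneg prod_le_1 b)
    show "wig \<delta> i0 \<kappa>"
      unfolding wig_def
    proof (intro conjI allI impI)
      show "smooth_on UNIV \<kappa>"
        unfolding \<kappa>_def
        by (intro smooth_on_mult smooth_on_prod smooth_on_compose[OF b(1)] smooth_on_coord) auto
      show "\<kappa> (z, x + t *\<^sub>R axis i0 1) = \<kappa> (z, x)" for z x t
        by (simp add: \<kappa>_def axis_def)
      fix z :: "real^'q" and x :: "real^'m"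
      assume "(\<exists>i. 1 - \<delta> / 2 < \<bar>z $ i\<bar>) \<or> (\<exists>i. i \<noteq> i0 \<and> 1 - \<delta> / 2 < \<bar>x $ i\<bar>)"
      then have "(\<Prod>i\<in>UNIV. b (z $ i)) = 0 \<or> (\<Prod>i\<in>UNIV - {i0}. b (x $ i)) = 0"
      proof (elim disjE exE conjE)
        fix i assume "1 - \<delta> / 2 < \<bar>z $ i\<bar>"
        then have "b (z $ i) = 0" by (intro b) simp
        then show ?thesis by (auto simp: prod_zero_iff)
      next
        fix i assume "i \<noteq> i0" "1 - \<delta> / 2 < \<bar>x $ i\<bar>"
        then have "b (x $ i) = 0" "i \<in> UNIV - {i0}" by (auto intro: b)
        then show ?thesis by (auto simp: prod_zero_iff)
      qed
      then show "\<kappa> (z, x) = 0" by (auto simp: \<kappa>_def)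
    qed
  qed
qed

text \<open>Derivatives of order above \<open>d\<close> are not controlled: they are corrected when the next order is
  treated.\<close>

definition realizable :: "real \<Rightarrow> 'm::finite \<Rightarrow> nat \<Rightarrow> (('m \<Rightarrow> nat) \<Rightarrow> 'n \<Rightarrow> (real^'q) \<times> (real^'m) \<Rightarrow> real) \<Rightarrow>
    ((real^'q) \<times> (real^'m) \<Rightarrow> real) \<Rightarrow> bool" where
  "realizable \<delta> i0 d c W0 \<longleftrightarrow> (\<forall>\<epsilon>>0. \<exists>(h :: 'n \<Rightarrow> (real^'q) \<times> (real^'m) \<Rightarrow> real) W.
    (\<forall>j. csupp (Qbox \<delta>) (h j)) \<and> wig \<delta> i0 W \<and> (\<forall>p. \<bar>W p - W0 p\<bar> < \<epsilon>) \<and>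
    (\<forall>\<alpha> j p. mdeg \<alpha> < d \<longrightarrow> \<bar>pdl (ilist \<alpha>) (h j) p\<bar> < \<epsilon>) \<and>
    (\<forall>\<alpha> j p. mdeg \<alpha> = d \<longrightarrow> snd p $ i0 = W p \<longrightarrow> \<bar>pdl (ilist \<alpha>) (h j) p - c \<alpha> j p\<bar> < \<epsilon>))"

lemma smooth_on_height:
  "smooth_on UNIV W \<Longrightarrow> smooth_on UNIV (\<lambda>p::(real^'q) \<times> (real^'m). snd p $ i0 - W p)"
  by (intro smooth_on_diff smooth_on_coord)

lemma pd_height:
  fixes W :: "(real^'q) \<times> (real^'m) \<Rightarrow> real"
  assumes "wig \<delta> i0 W"
  shows "pd i0 (\<lambda>p. snd p $ i0 - W p) p = 1"
proof -
  have W: "smooth_on UNIV W" and inv: "\<And>z x t. W (z, x + t *\<^sub>R axis i0 1) = W (z, x)"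
    using assms by (auto simp: wig_def)
  have d: "((\<lambda>t::real. (fst p, snd p + t *\<^sub>R axis i0 1)) has_derivative
      (\<lambda>t. (0, t *\<^sub>R axis i0 1))) (at 0)"
    by (auto intro!: derivative_eq_intros)
  have "((\<lambda>t::real. W (fst p, snd p + t *\<^sub>R axis i0 1)) has_derivative
      (\<lambda>t. frechet_derivative W (at p) (0, t *\<^sub>R axis i0 1))) (at 0)"
    by (rule has_derivative_compose[OF d]) (simp add: smooth_on_UNIV_has_derivative[OF W])
  moreover have "((\<lambda>t::real. W (fst p, snd p + t *\<^sub>R axis i0 1)) has_derivative (\<lambda>t. 0)) (at 0)"
    by (simp add: inv)
  ultimately have "(\<lambda>t::real. frechet_derivative W (at p) (0, t *\<^sub>R axis i0 1)) = (\<lambda>t. 0)"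
    by (rule has_derivative_unique)
  from fun_cong[OF this, of 1] have "frechet_derivative W (at p) (0, axis i0 1) = 0" by simp
  moreover have "((\<lambda>p. snd p $ i0 - W p) has_derivative (\<lambda>h. snd h $ i0 - frechet_derivative W (at p) h)) (at p)"
    by (intro has_derivative_diff smooth_on_UNIV_has_derivative W bounded_linear_imp_has_derivative
        bounded_linear_vec_nth[THEN bounded_linear_compose] bounded_linear_snd)
  ultimately show ?thesis using pd_eqI by fastforce
qed

section \<open>Prescribing the derivatives of one order\<close>

lemma smooth_bdd_rescale:
  assumes "smooth_bdd f"
  shows "smooth_bdd (\<lambda>v. k * f (c * v))"
  unfolding smooth_bdd_def
proof (intro conjI allI)
  show "smooth_on UNIV (\<lambda>v. k * f (c * v))"
    by (intro smooth_on_mult smooth_on_compose[OF smooth_bdd_smooth[OF assms]] smooth_on_ident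
        smooth_on_const open_UNIV UNIV_I)
  fix n
  have "bounded (range ((deriv ^^ n) f))" using assms by (simp add: smooth_bdd_def)
  then have "bounded ((\<lambda>y. k * c ^ n * y) ` range ((deriv ^^ n) f))"
    by (rule bounded_linear_image[OF _ bounded_linear_mult_right])
  moreover have "range ((deriv ^^ n) (\<lambda>v. k * f (c * v))) \<subseteq> (\<lambda>y. k * c ^ n * y) ` range ((deriv ^^ n) f)"
    by (auto simp: higher_deriv_scale[OF smooth_bdd_smooth[OF assms]])
  ultimately show "bounded (range ((deriv ^^ n) (\<lambda>v. k * f (c * v))))"
    by (rule bounded_subset)
qed

lemma realizableD:
  fixes c :: "('m::finite \<Rightarrow> nat) \<Rightarrow> 'n \<Rightarrow> (real^'q) \<times> (real^'m) \<Rightarrow> real"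
  assumes "realizable \<delta> i0 d c W0" "\<epsilon> > 0"
  obtains h :: "'n \<Rightarrow> (real^'q) \<times> (real^'m) \<Rightarrow> real" and W
  where "\<And>j. csupp (Qbox \<delta>) (h j)" "wig \<delta> i0 W" "\<And>p. \<bar>W p - W0 p\<bar> < \<epsilon>"
    "\<And>\<alpha> j p. mdeg \<alpha> < d \<Longrightarrow> \<bar>pdl (ilist \<alpha>) (h j) p\<bar> < \<epsilon>"
    "\<And>\<alpha> j p. mdeg \<alpha> = d \<Longrightarrow> snd p $ i0 = W p \<Longrightarrow> \<bar>pdl (ilist \<alpha>) (h j) p - c \<alpha> j p\<bar> < \<epsilon>"
proof -
  from assms obtain h :: "'n \<Rightarrow> (real^'q) \<times> (real^'m) \<Rightarrow> real" and W
    where *: "\<forall>j. csupp (Qbox \<delta>) (h j)" "wig \<delta> i0 W" "\<forall>p. \<bar>W p - W0 p\<bar> < \<epsilon>"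
    "\<forall>\<alpha> j p. mdeg \<alpha> < d \<longrightarrow> \<bar>pdl (ilist \<alpha>) (h j) p\<bar> < \<epsilon>"
    "\<forall>\<alpha> j p. mdeg \<alpha> = d \<longrightarrow> snd p $ i0 = W p \<longrightarrow> \<bar>pdl (ilist \<alpha>) (h j) p - c \<alpha> j p\<bar> < \<epsilon>"
    unfolding realizable_def by blast
  show thesis
    by (rule that[OF *(1)[rule_format] *(2) *(3)[rule_format] *(4)[rule_format] *(5)[rule_format]])
qed

lemma realizableI:
  fixes c :: "('m::finite \<Rightarrow> nat) \<Rightarrow> 'n \<Rightarrow> (real^'q) \<times> (real^'m) \<Rightarrow> real"
  assumes "\<And>\<epsilon>. \<epsilon> > 0 \<Longrightarrow> \<exists>(h :: 'n \<Rightarrow> (real^'q) \<times> (real^'m) \<Rightarrow> real) W.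
    (\<forall>j. csupp (Qbox \<delta>) (h j)) \<and> wig \<delta> i0 W \<and> (\<forall>p. \<bar>W p - W0 p\<bar> < \<epsilon>) \<and>
    (\<forall>\<alpha> j p. mdeg \<alpha> < d \<longrightarrow> \<bar>pdl (ilist \<alpha>) (h j) p\<bar> < \<epsilon>) \<and>
    (\<forall>\<alpha> j p. mdeg \<alpha> = d \<longrightarrow> snd p $ i0 = W p \<longrightarrow> \<bar>pdl (ilist \<alpha>) (h j) p - c \<alpha> j p\<bar> < \<epsilon>)"
  shows "realizable \<delta> i0 d c W0"
  using assms unfolding realizable_def by blast

text \<open>Stretching a weight to \<open>L ^ b * \<kappa> (v / L)\<close> multiplies its derivative
  of order \<open>q\<close> by \<open>L ^ b / L ^ q\<close>, and on the wiggled graph the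
  unstretched argument is exactly \<open>cos (2 * pi * u)\<close>. By \<open>prof\<close> the terms
  with \<open>q < b\<close> vanish and \<open>q = b\<close> yields the target; the other
  \<open>a\<close> terms are at most \<open>B / L\<close> each.\<close>

lemma osc_main_on_wiggle:
  fixes Y :: "(real^'q) \<times> (real^'m) \<Rightarrow> real"
  assumes sm: "smooth_on UNIV \<kappa>1" "smooth_on UNIV \<kappa>2" and L: "L \<ge> 1"
    and len: "length js = a + b"
    and prof: "\<And>q. q \<le> b \<Longrightarrow>
      (deriv ^^ (a + b - q)) A1 u * (deriv ^^ q) \<kappa>1 (cos (2 * pi * u)) +
      (deriv ^^ (a + b - q)) A2 u * (deriv ^^ q) \<kappa>2 (cos (2 * pi * u)) = (if q = b then 1 else 0)"
    and u: "N * (v \<bullet> snd p) = u" and Y: "N * Y p = L * cos (2 * pi * u)"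
    and B: "\<And>q. q \<le> a + b \<Longrightarrow> \<bar>c p * mc v Y js q p *
      ((deriv ^^ (a + b - q)) A1 u * (deriv ^^ q) \<kappa>1 (cos (2 * pi * u)) +
       (deriv ^^ (a + b - q)) A2 u * (deriv ^^ q) \<kappa>2 (cos (2 * pi * u)))\<bar> \<le> B"
  shows "\<bar>osc_main v Y js c A1 (\<lambda>v. L ^ b * \<kappa>1 (1 / L * v)) N p +
    osc_main v Y js c A2 (\<lambda>v. L ^ b * \<kappa>2 (1 / L * v)) N p - c p * mc v Y js b p\<bar> \<le> real a * B / L"
proof -
  define S where "S q = (deriv ^^ (a + b - q)) A1 u * (deriv ^^ q) \<kappa>1 (cos (2 * pi * u)) +
       (deriv ^^ (a + b - q)) A2 u * (deriv ^^ q) \<kappa>2 (cos (2 * pi * u))" for q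
  define T where "T q = c p * mc v Y js q p * S q" for q
  have "osc_main v Y js c A1 (\<lambda>v. L ^ b * \<kappa>1 (1 / L * v)) N p +
      osc_main v Y js c A2 (\<lambda>v. L ^ b * \<kappa>2 (1 / L * v)) N p = (\<Sum>q\<le>a + b. L ^ b * (1 / L) ^ q * T q)"
    unfolding osc_main_def higher_deriv_scale[OF sm(1)] higher_deriv_scale[OF sm(2)] len u Y
      sum.distrib[symmetric] T_def S_def
    using L by (intro sum.cong refl) (simp add: algebra_simps)
  also have "\<dots> = (\<Sum>q\<in>{..b}. L ^ b * (1 / L) ^ q * T q) + (\<Sum>q\<in>{b<..a + b}. L ^ b * (1 / L) ^ q * T q)"
    by (subst sum.union_disjoint[symmetric]) (auto intro!: sum.cong)
  also have "(\<Sum>q\<in>{..b}. L ^ b * (1 / L) ^ q * T q) = (\<Sum>q\<in>{..b}. if q = b then c p * mc v Y js b p else 0)"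
    by (intro sum.cong refl) (use L in \<open>auto simp: T_def S_def prof power_one_over\<close>)
  also have "\<dots> = c p * mc v Y js b p" by simp
  finally have "osc_main v Y js c A1 (\<lambda>v. L ^ b * \<kappa>1 (1 / L * v)) N p +
      osc_main v Y js c A2 (\<lambda>v. L ^ b * \<kappa>2 (1 / L * v)) N p - c p * mc v Y js b p =
      (\<Sum>q\<in>{b<..a + b}. L ^ b * (1 / L) ^ q * T q)" by simp
  also have "\<bar>\<dots>\<bar> \<le> (\<Sum>q\<in>{b<..a + b}. B / L)"
  proof (rule order_trans[OF sum_abs sum_mono])
    fix q assume q: "q \<in> {b<..a + b}"
    then obtain k where k: "q = Suc (b + k)" by (auto dest: less_imp_Suc_add)
    have "L ^ b * (1 / L) ^ q = 1 / L ^ Suc k"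
      using L by (simp add: k power_add power_one_over field_simps)
    also have "\<dots> \<le> 1 / L ^ 1"
      using L by (intro divide_left_mono power_increasing) auto
    finally have 1: "L ^ b * (1 / L) ^ q \<le> 1 / L" by simp
    have 2: "\<bar>T q\<bar> \<le> B" unfolding T_def S_def using q by (intro B) auto
    have "\<bar>L ^ b * (1 / L) ^ q * T q\<bar> = L ^ b * (1 / L) ^ q * \<bar>T q\<bar>" using L by (simp add: abs_mult)
    also have "\<dots> \<le> 1 / L * B" by (intro mult_mono 1 2) (use L in auto)
    finally show "\<bar>L ^ b * (1 / L) ^ q * T q\<bar> \<le> B / L" by simp
  qed
  also have "\<dots> = real a * B / L" by simp
  finally show ?thesis .
qed

lemma realizable_primitive:
  fixes W0 c :: "(real^'q) \<times> (real^'m) \<Rightarrow> real" and j0 :: 'n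
  assumes \<delta>: "0 < \<delta>" "\<delta> < 1" and W0: "wig \<delta> i0 W0" and v: "v $ i0 = 0"
    and c: "csupp (Qbox \<delta>) c" and b: "b \<le> d"
  defines "Y \<equiv> \<lambda>p. snd p $ i0 - W0 p"
  shows "realizable \<delta> i0 d (\<lambda>\<alpha> j p. if j = j0 then c p * mc v Y (ilist \<alpha>) b p else 0) W0"
proof (rule realizableI)
  fix \<epsilon> :: real assume \<epsilon>: "\<epsilon> > 0"
  define a where "a = d - b"
  have d: "d = a + b" using b by (simp add: a_def)
  note Q = compact_Qbox[of \<delta>]
  have sW0: "smooth_on UNIV W0" using W0 by (simp add: wig_def)
  have Y: "smooth_on UNIV Y" unfolding Y_def by (rule smooth_on_height[OF sW0])
  obtain A1 A2 \<kappa>1 \<kappa>2 :: "real \<Rightarrow> real"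
    where A: "smooth_bdd A1" "smooth_bdd A2" and K: "smooth_bdd \<kappa>1" "smooth_bdd \<kappa>2"
      and prof: "\<And>u q. q \<le> b \<Longrightarrow>
      (deriv ^^ (a + b - q)) A1 u * (deriv ^^ q) \<kappa>1 (cos (2 * pi * u)) +
      (deriv ^^ (a + b - q)) A2 u * (deriv ^^ q) \<kappa>2 (cos (2 * pi * u)) = (if q = b then 1 else 0)"
    by (rule wiggle_profiles_exist[of b a], rule that)
  define S where "S q u = (deriv ^^ (a + b - q)) A1 u * (deriv ^^ q) \<kappa>1 (cos (2 * pi * u)) +
       (deriv ^^ (a + b - q)) A2 u * (deriv ^^ q) \<kappa>2 (cos (2 * pi * u))" for q u
  have bound: "\<exists>B. \<forall>x. \<bar>c (fst x) * mc v Y (ilist \<alpha>) q (fst x) * S q (snd x)\<bar> \<le> B" for q \<alpha>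
  proof -
    have "csupp (Qbox \<delta>) (\<lambda>p. c p * mc v Y (ilist \<alpha>) q p)"
      by (intro csupp_mult_right c smooth_on_mc Y)
    from csupp_bound[OF Q this] obtain B1 where B1: "\<And>p. \<bar>c p * mc v Y (ilist \<alpha>) q p\<bar> \<le> B1"
      by auto
    obtain B2 where B2: "\<And>x. \<bar>(deriv ^^ (a + b - q)) A1 x\<bar> \<le> B2" by (rule smooth_bddE[OF A(1)], rule that)
    obtain B3 where B3: "\<And>x. \<bar>(deriv ^^ q) \<kappa>1 x\<bar> \<le> B3" by (rule smooth_bddE[OF K(1)], rule that)
    obtain B4 where B4: "\<And>x. \<bar>(deriv ^^ (a + b - q)) A2 x\<bar> \<le> B4" by (rule smooth_bddE[OF A(2)], rule that)
    obtain B5 where B5: "\<And>x. \<bar>(deriv ^^ q) \<kappa>2 x\<bar> \<le> B5" by (rule smooth_bddE[OF K(2)], rule that)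
    have nn: "0 \<le> B1" "0 \<le> B2" "0 \<le> B4"
      using order_trans[OF abs_ge_zero B1] order_trans[OF abs_ge_zero B2] order_trans[OF abs_ge_zero B4] by auto
    have "\<bar>S q u\<bar> \<le> B2 * B3 + B4 * B5" for u
      unfolding S_def
      by (rule order_trans[OF abs_triangle_ineq add_mono]; unfold abs_mult; intro mult_mono B2 B3 B4 B5 nn abs_ge_zero)
    then have "\<bar>c p * mc v Y (ilist \<alpha>) q p * S q u\<bar> \<le> B1 * (B2 * B3 + B4 * B5)" for p u
      unfolding abs_mult[of "c p * mc v Y (ilist \<alpha>) q p"] by (intro mult_mono B1 nn abs_ge_zero)
    then show ?thesis by blast
  qed
  have fin: "finite ({\<alpha>::'m \<Rightarrow> nat. mdeg \<alpha> \<le> d} \<times> {..d})"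
    by (intro finite_SigmaI finite_mdeg_le finite_atMost)
  obtain B where B': "\<And>aq x. aq \<in> {\<alpha>::'m \<Rightarrow> nat. mdeg \<alpha> \<le> d} \<times> {..d} \<Longrightarrow>
      \<bar>c (fst x) * mc v Y (ilist (fst aq)) (snd aq) (fst x) * S (snd aq) (snd x)\<bar> \<le> B" "B \<ge> 0"
    by (rule finite_uniform_bound[OF fin bound], rule that)
  have B: "\<bar>c p * mc v Y (ilist \<alpha>) q p * S q u\<bar> \<le> B" if "mdeg \<alpha> \<le> d" "q \<le> d" for \<alpha> q p u
    using B'(1)[of "(\<alpha>, q)" "(p, u)"] that by simp
  \<comment> \<open>Forces \<open>real a * B / L < \<epsilon> / 2\<close>. The choice is not
    circular: \<open>B\<close> bounds expressions in the profiles before they are stretched by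
    \<open>L\<close>.\<close>
  define L where "L = 1 + 2 * real a * B / \<epsilon>"
  have L: "L \<ge> 1" using B'(2) \<epsilon> by (simp add: L_def)
  have LB: "real a * B / L < \<epsilon> / 2"
  proof -
    have "2 * (real a * B) < \<epsilon> * L" using \<epsilon> by (simp add: L_def field_simps)
    then show ?thesis using L by (simp add: field_simps)
  qed
  define C1 where "C1 v = L ^ b * \<kappa>1 (1 / L * v)" for v
  define C2 where "C2 v = L ^ b * \<kappa>2 (1 / L * v)" for v
  have C: "smooth_bdd C1" "smooth_bdd C2"
    unfolding C1_def[abs_def] C2_def[abs_def] by (intro smooth_bdd_rescale K)+
  define M where "M \<alpha> N p = osc_main v Y (ilist \<alpha>) c A1 C1 N p + osc_main v Y (ilist \<alpha>) c A2 C2 N p" for \<alpha> N p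
  define g where "g N p = 1 * osc v Y c A1 C1 N p + 1 * osc v Y c A2 C2 N p" for N p
  have so: "smooth_on UNIV (osc v Y c A1 C1 N)" "smooth_on UNIV (osc v Y c A2 C2 N)" for N
    by (intro smooth_on_osc Y csupp_smooth[OF c] smooth_bdd_smooth A C)+
  have sg: "smooth_on UNIV (g N)" for N
    unfolding g_def by (intro smooth_on_linear_combination so)
  \<comment> \<open>\<open>N\<close> and \<open>p\<close> are packed into one variable, and the
    remainder and the leading term into one quantity, so that \<open>finite_uniform_bound\<close>
    yields a single constant for all multi-indices; the default 0 discards
    \<open>N < 1\<close>.\<close>
  have asym: "\<exists>B. \<forall>x. (if fst x \<ge> 1 then \<bar>pdl (ilist \<alpha>) (g (fst x)) (snd x) - fst x ^ mdeg \<alpha> * M \<alpha> (fst x) (snd x)\<bar> /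
      (fst x ^ mdeg \<alpha> / fst x) + \<bar>M \<alpha> (fst x) (snd x)\<bar> else 0) \<le> B" for \<alpha>
  proof -
    obtain B1 where B1: "\<forall>N\<ge>1. \<forall>p. \<bar>pdl (ilist \<alpha>) (osc v Y c A1 C1 N) p -
        N ^ mdeg \<alpha> * osc_main v Y (ilist \<alpha>) c A1 C1 N p\<bar> \<le> B1 * N ^ mdeg \<alpha> / N"
      using pdl_osc_asymptotics[OF Q Y c A(1) C(1), where v = v and js = "ilist \<alpha>"] by (auto simp: length_ilist)
    obtain B2 where B2: "\<forall>N\<ge>1. \<forall>p. \<bar>pdl (ilist \<alpha>) (osc v Y c A2 C2 N) p -
        N ^ mdeg \<alpha> * osc_main v Y (ilist \<alpha>) c A2 C2 N p\<bar> \<le> B2 * N ^ mdeg \<alpha> / N"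
      using pdl_osc_asymptotics[OF Q Y c A(2) C(2), where v = v and js = "ilist \<alpha>"] by (auto simp: length_ilist)
    obtain B3 where B3: "\<And>N p. \<bar>osc_main v Y (ilist \<alpha>) c A1 C1 N p\<bar> \<le> B3"
      by (rule osc_main_bound[OF Q Y c A(1) C(1), where v = v and js = "ilist \<alpha>"], rule that)
    obtain B4 where B4: "\<And>N p. \<bar>osc_main v Y (ilist \<alpha>) c A2 C2 N p\<bar> \<le> B4"
      by (rule osc_main_bound[OF Q Y c A(2) C(2), where v = v and js = "ilist \<alpha>"], rule that)
    have "\<bar>pdl (ilist \<alpha>) (g N) p - N ^ mdeg \<alpha> * M \<alpha> N p\<bar> / (N ^ mdeg \<alpha> / N) + \<bar>M \<alpha> N p\<bar> \<le> B1 + B2 + (B3 + B4)"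
      if N: "N \<ge> 1" for N p
    proof (rule add_mono)
      have "pdl (ilist \<alpha>) (g N) p - N ^ mdeg \<alpha> * M \<alpha> N p =
          (pdl (ilist \<alpha>) (osc v Y c A1 C1 N) p - N ^ mdeg \<alpha> * osc_main v Y (ilist \<alpha>) c A1 C1 N p) +
          (pdl (ilist \<alpha>) (osc v Y c A2 C2 N) p - N ^ mdeg \<alpha> * osc_main v Y (ilist \<alpha>) c A2 C2 N p)"
        unfolding g_def M_def pdl_linear[OF so] by (simp add: algebra_simps)
      also have "\<bar>\<dots>\<bar> \<le> B1 * N ^ mdeg \<alpha> / N + B2 * N ^ mdeg \<alpha> / N"
        by (rule order_trans[OF abs_triangle_ineq add_mono[OF B1[rule_format, OF N] B2[rule_format, OF N]]])
      also have "\<dots> = (B1 + B2) * (N ^ mdeg \<alpha> / N)" by (simp add: algebra_simps add_divide_distrib)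
      finally show "\<bar>pdl (ilist \<alpha>) (g N) p - N ^ mdeg \<alpha> * M \<alpha> N p\<bar> / (N ^ mdeg \<alpha> / N) \<le> B1 + B2"
        using N by (subst pos_divide_le_eq) auto
      show "\<bar>M \<alpha> N p\<bar> \<le> B3 + B4"
        unfolding M_def by (rule order_trans[OF abs_triangle_ineq add_mono]) (rule B3 B4)+
    qed
    then have "\<forall>x. (if fst x \<ge> 1 then \<bar>pdl (ilist \<alpha>) (g (fst x)) (snd x) - fst x ^ mdeg \<alpha> * M \<alpha> (fst x) (snd x)\<bar> /
      (fst x ^ mdeg \<alpha> / fst x) + \<bar>M \<alpha> (fst x) (snd x)\<bar> else 0) \<le> max 0 (B1 + B2 + (B3 + B4))"
      by (auto simp: le_max_iff_disj)
    then show ?thesis by blast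
  qed
  obtain D where D: "\<And>\<alpha> x. \<alpha> \<in> {\<alpha>. mdeg \<alpha> \<le> d} \<Longrightarrow> (if fst x \<ge> 1 then
      \<bar>pdl (ilist \<alpha>) (g (fst x)) (snd x) - fst x ^ mdeg \<alpha> * M \<alpha> (fst x) (snd x)\<bar> /
      (fst x ^ mdeg \<alpha> / fst x) + \<bar>M \<alpha> (fst x) (snd x)\<bar> else 0) \<le> D" "D \<ge> 0"
    by (rule finite_uniform_bound[OF finite_mdeg_le asym], rule that)
  have D1: "\<bar>pdl (ilist \<alpha>) (g N) p - N ^ mdeg \<alpha> * M \<alpha> N p\<bar> \<le> D * (N ^ mdeg \<alpha> / N)"
    and D2: "\<bar>M \<alpha> N p\<bar> \<le> D" if \<alpha>: "mdeg \<alpha> \<le> d" and N: "N \<ge> 1" for \<alpha> N p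
  proof -
    have *: "\<bar>pdl (ilist \<alpha>) (g N) p - N ^ mdeg \<alpha> * M \<alpha> N p\<bar> / (N ^ mdeg \<alpha> / N) + \<bar>M \<alpha> N p\<bar> \<le> D"
      using D(1)[of \<alpha> "(N, p)"] \<alpha> N by simp
    moreover have "0 \<le> \<bar>pdl (ilist \<alpha>) (g N) p - N ^ mdeg \<alpha> * M \<alpha> N p\<bar> / (N ^ mdeg \<alpha> / N)"
      using N by simp
    ultimately show "\<bar>M \<alpha> N p\<bar> \<le> D" by linarith
    have "\<bar>pdl (ilist \<alpha>) (g N) p - N ^ mdeg \<alpha> * M \<alpha> N p\<bar> / (N ^ mdeg \<alpha> / N) \<le> D"
      using * by linarith
    moreover have "N ^ mdeg \<alpha> / N > 0" using N by simp
    ultimately show "\<bar>pdl (ilist \<alpha>) (g N) p - N ^ mdeg \<alpha> * M \<alpha> N p\<bar> \<le> D * (N ^ mdeg \<alpha> / N)"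
      by (simp only: pos_divide_le_eq)
  qed
  \<comment> \<open>\<open>D\<close> depends on \<open>L\<close> through \<open>C1\<close> and
    \<open>C2\<close>, so \<open>N\<close> is chosen last. The summand \<open>4 * D\<close> serves
    the lower derivatives and the remainder, the summand \<open>L\<close> the amplitude
    \<open>L / N\<close> of the wiggle.\<close>
  define N where "N = 1 + (4 * D + L) / \<epsilon>"
  have N: "N \<ge> 1" using D(2) L \<epsilon> by (simp add: N_def)
  have N1: "2 * D / N < \<epsilon>" "D / N < \<epsilon> / 2" "L / N < \<epsilon>"
  proof -
    have "\<epsilon> * N = \<epsilon> + (4 * D + L)" using \<epsilon> by (simp add: N_def field_simps)
    then have "2 * D < \<epsilon> * N" "2 * D < \<epsilon> * N" "L < \<epsilon> * N" using \<epsilon> D(2) L by linarith+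
    then show "2 * D / N < \<epsilon>" "D / N < \<epsilon> / 2" "L / N < \<epsilon>" using N by (simp_all add: field_simps)
  qed
  obtain \<kappa> :: "(real^'q) \<times> (real^'m) \<Rightarrow> real"
    where \<kappa>: "wig \<delta> i0 \<kappa>" "\<And>p. p \<in> Qbox \<delta> \<Longrightarrow> \<kappa> p = 1" "\<And>p. \<bar>\<kappa> p\<bar> \<le> 1"
    by (rule cutoff_exists[OF \<delta>], rule that)
  \<comment> \<open>Where \<open>\<kappa> p = 1\<close>, lying on this graph means
    \<open>N * Y p = L * cos (2 * pi * u)\<close> with \<open>u = N * (v \<bullet> snd p)\<close>,
    as \<open>osc_main_on_wiggle\<close> requires. Since \<open>v $ i0 = 0\<close>, the wiggle is
    constant along \<open>i0\<close>.\<close>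
  define W where "W p = W0 p + \<kappa> p * (L / N * cos (2 * pi * (N * (v \<bullet> snd p))))" for p
  define h where "h j p = (if j = j0 then 1 / N ^ d * g N p else 0)" for j :: 'n and p
  have h: "h j = (\<lambda>p. (if j = j0 then 1 / N ^ d else 0) * g N p)" for j by (auto simp: h_def)
  have pdl_h: "pdl (ilist \<alpha>) (h j) p = (if j = j0 then 1 / N ^ d * pdl (ilist \<alpha>) (g N) p else 0)" for \<alpha> j p
    unfolding h pdl_cmult[OF sg] by simp
  show "\<exists>(h :: 'n \<Rightarrow> (real^'q) \<times> (real^'m) \<Rightarrow> real) W.
    (\<forall>j. csupp (Qbox \<delta>) (h j)) \<and> wig \<delta> i0 W \<and> (\<forall>p. \<bar>W p - W0 p\<bar> < \<epsilon>) \<and>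
    (\<forall>\<alpha> j p. mdeg \<alpha> < d \<longrightarrow> \<bar>pdl (ilist \<alpha>) (h j) p\<bar> < \<epsilon>) \<and>
    (\<forall>\<alpha> j p. mdeg \<alpha> = d \<longrightarrow> snd p $ i0 = W p \<longrightarrow>
      \<bar>pdl (ilist \<alpha>) (h j) p - (if j = j0 then c p * mc v Y (ilist \<alpha>) b p else 0)\<bar> < \<epsilon>)"
  proof (intro exI[of _ h] exI[of _ W] conjI allI impI)
    show "csupp (Qbox \<delta>) (h j)" for j
    proof -
      have "csupp (Qbox \<delta>) (g N)" using sg by (auto simp: csupp_def g_def osc_def csupp_zero[OF c])
      then show ?thesis unfolding h by (rule csupp_cmult)
    qed
    show "wig \<delta> i0 W"
      unfolding wig_def
    proof (intro conjI allI impI)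
      have "smooth_on UNIV (\<lambda>p::(real^'q) \<times> (real^'m). 2 * pi * (N * (v \<bullet> snd p)))"
        by (intro smooth_on_mult smooth_on_const open_UNIV smooth_on_bounded_linear bounded_linear_intros)
      then have "smooth_on UNIV (\<lambda>p::(real^'q) \<times> (real^'m). cos (2 * pi * (N * (v \<bullet> snd p))))"
        by (rule smooth_on_compose[OF smooth_on_cos]) simp
      then show "smooth_on UNIV W"
        unfolding W_def using \<kappa>(1) sW0
        by (intro smooth_on_add smooth_on_mult smooth_on_const open_UNIV) (auto simp: wig_def)
      show "W (z, x + t *\<^sub>R axis i0 1) = W (z, x)" for z x t
        using W0 \<kappa>(1) v by (simp add: W_def wig_def inner_add_right inner_axis)
      show "W (z, x) = 0" if "(\<exists>i. 1 - \<delta> / 2 < \<bar>z $ i\<bar>) \<or> (\<exists>i. i \<noteq> i0 \<and> 1 - \<delta> / 2 < \<bar>x $ i\<bar>)" for z x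
        using wig_zero[OF W0 that] wig_zero[OF \<kappa>(1) that] by (simp add: W_def)
    qed
    show "\<bar>W p - W0 p\<bar> < \<epsilon>" for p
    proof -
      have "\<bar>W p - W0 p\<bar> = \<bar>\<kappa> p\<bar> * (L / N * \<bar>cos (2 * pi * (N * (v \<bullet> snd p)))\<bar>)"
        using L N by (simp add: W_def abs_mult)
      also have "\<dots> \<le> 1 * (L / N * 1)"
        using L N \<kappa>(3) by (intro mult_mono) auto
      finally show ?thesis using N1 by simp
    qed
    show "\<bar>pdl (ilist \<alpha>) (h j) p\<bar> < \<epsilon>" if \<alpha>: "mdeg \<alpha> < d" for \<alpha> j p
    proof (cases "j = j0")
      case True
      have "\<bar>pdl (ilist \<alpha>) (g N) p\<bar> \<le> D * (N ^ mdeg \<alpha> / N) + N ^ mdeg \<alpha> * D"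
      proof -
        have "\<bar>N ^ mdeg \<alpha> * M \<alpha> N p\<bar> \<le> N ^ mdeg \<alpha> * D"
          using D2[of \<alpha> N p] \<alpha> N by (simp add: abs_mult)
        with D1[of \<alpha> N p] \<alpha> N show ?thesis by linarith
      qed
      also have "\<dots> \<le> D * (N ^ mdeg \<alpha> / 1) + N ^ mdeg \<alpha> * D"
        using N D(2) by (intro add_mono mult_left_mono divide_left_mono) auto
      also have "\<dots> = 2 * D * N ^ mdeg \<alpha>" by simp
      finally have "\<bar>pdl (ilist \<alpha>) (h j) p\<bar> \<le> 2 * D * N ^ mdeg \<alpha> / N ^ d"
        using True N by (simp add: pdl_h divide_right_mono abs_mult)
      also have "\<dots> \<le> 2 * D / N"
      proof -
        have "N ^ Suc (mdeg \<alpha>) \<le> N ^ d" using \<alpha> N by (intro power_increasing) auto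
        then have "2 * D * (N ^ mdeg \<alpha> * N) \<le> 2 * D * N ^ d" using D(2) by (intro mult_left_mono) (auto simp: mult.commute)
        then show ?thesis using N by (simp add: field_simps)
      qed
      also have "\<dots> < \<epsilon>" by (rule N1)
      finally show ?thesis .
    qed (use \<epsilon> in \<open>simp add: pdl_h\<close>)
    fix \<alpha> :: "'m \<Rightarrow> nat" and j p
    assume \<alpha>: "mdeg \<alpha> = d" and p: "snd p $ i0 = W p"
    show "\<bar>pdl (ilist \<alpha>) (h j) p - (if j = j0 then c p * mc v Y (ilist \<alpha>) b p else 0)\<bar> < \<epsilon>"
    proof (cases "j = j0")
      case True
      have "\<bar>pdl (ilist \<alpha>) (g N) p / N ^ d - M \<alpha> N p\<bar> = \<bar>pdl (ilist \<alpha>) (g N) p - N ^ d * M \<alpha> N p\<bar> / N ^ d"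
        using N by (simp add: field_simps abs_divide)
      also have "\<dots> \<le> D * (N ^ d / N) / N ^ d"
        using D1[of \<alpha> N p] \<alpha> N by (intro divide_right_mono) auto
      also have "\<dots> < \<epsilon> / 2" using N1 N by simp
      finally have 1: "\<bar>pdl (ilist \<alpha>) (g N) p / N ^ d - M \<alpha> N p\<bar> < \<epsilon> / 2" .
      have 2: "\<bar>M \<alpha> N p - c p * mc v Y (ilist \<alpha>) b p\<bar> < \<epsilon> / 2"
      proof (cases "p \<in> Qbox \<delta>")
        case True
        have "N * Y p = L * cos (2 * pi * (N * (v \<bullet> snd p)))"
          using N p by (simp add: Y_def W_def \<kappa>(2)[OF True])
        then have "\<bar>M \<alpha> N p - c p * mc v Y (ilist \<alpha>) b p\<bar> \<le> real a * B / L"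
          unfolding M_def C1_def[abs_def] C2_def[abs_def]
          using B[of \<alpha> _ p "N * (v \<bullet> snd p)"] \<alpha> d
          by (intro osc_main_on_wiggle[OF smooth_bdd_smooth[OF K(1)] smooth_bdd_smooth[OF K(2)] L _ prof refl])
            (auto simp: length_ilist S_def)
        then show ?thesis using LB by linarith
      next
        case False
        \<comment> \<open>Here \<open>c p = 0\<close>, so the leading term and the target both
          vanish, whatever the cut-off does to the graph.\<close>
        then show ?thesis using \<epsilon> csupp_zero[OF c False] by (simp add: M_def osc_main_def)
      qed
      have "\<bar>pdl (ilist \<alpha>) (g N) p / N ^ d - c p * mc v Y (ilist \<alpha>) b p\<bar> < \<epsilon>"
        using 1 2 by linarith
      then show ?thesis using True by (simp add: pdl_h)
    qed (use \<epsilon> in \<open>simp add: pdl_h\<close>)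
  qed
qed

section \<open>Passing from one graph to a nearby one\<close>

lemma csupp_vertical_uniform_continuity:
  fixes g :: "(real^'q) \<times> (real^'m) \<Rightarrow> real"
  assumes g: "csupp (Qbox \<delta>) g"
  obtains B where "B > 0" "\<And>z x t. \<bar>g (z, x + t *\<^sub>R axis i 1) - g (z, x)\<bar> \<le> B * \<bar>t\<bar>"
proof -
  obtain B where B: "\<And>p. \<bar>pd i g p\<bar> \<le> B"
    by (rule csupp_bound[OF compact_Qbox csupp_pd[OF compact_imp_closed[OF compact_Qbox] g]], rule that)
  have "\<bar>g (z, x + t *\<^sub>R axis i 1) - g (z, x)\<bar> \<le> B * \<bar>t\<bar>" for z x t
  proof -
    let ?l = "\<lambda>t::real. (z, x + t *\<^sub>R axis i 1)"
    have der: "((\<lambda>t. g (?l t)) has_real_derivative pd i g (?l s)) (at s)" for s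
    proof -
      have "(?l has_derivative (\<lambda>t. t *\<^sub>R (0, axis i 1))) (at s)"
        by (auto intro!: derivative_eq_intros)
      from has_derivative_compose[OF this smooth_on_UNIV_has_derivative[OF csupp_smooth[OF g]]]
      have "((\<lambda>t. g (?l t)) has_derivative (\<lambda>t. frechet_derivative g (at (?l s)) (t *\<^sub>R (0, axis i 1)))) (at s)" .
      moreover have "frechet_derivative g (at (?l s)) (t *\<^sub>R (0, axis i 1)) = pd i g (?l s) * t" for t
        using linear_scale[OF has_derivative_linear[OF smooth_on_UNIV_has_derivative[OF csupp_smooth[OF g]]],
            of "?l s" t "(0, axis i 1)"]
        unfolding pd_def by (simp only: real_scaleR_def mult.commute)
      ultimately show ?thesis by (simp add: has_field_derivative_def)
    qed
    have "norm ((\<lambda>t. g (?l t)) t - (\<lambda>t. g (?l t)) 0) \<le> B * norm (t - 0)"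
      by (rule field_differentiable_bound[of UNIV _ "\<lambda>s. pd i g (?l s)"]) (auto simp: B intro: der)
    then show ?thesis by simp
  qed
  then have "\<bar>g (z, x + t *\<^sub>R axis i 1) - g (z, x)\<bar> \<le> (\<bar>B\<bar> + 1) * \<bar>t\<bar>" for z x t
    by (rule order_trans) (auto intro: mult_right_mono)
  then show thesis by (rule that[rotated]) simp
qed

lemma csupp_vertical_modulus:
  fixes g :: "'a \<Rightarrow> (real^'q) \<times> (real^'m) \<Rightarrow> real"
  assumes "finite S" "\<And>a. a \<in> S \<Longrightarrow> csupp (Qbox \<delta>) (g a)" and \<epsilon>: "\<epsilon> > 0"
  obtains \<eta> where "\<eta> > 0"
    "\<And>a z x t. a \<in> S \<Longrightarrow> \<bar>t\<bar> < \<eta> \<Longrightarrow> \<bar>g a (z, x + t *\<^sub>R axis i 1) - g a (z, x)\<bar> < \<epsilon>"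
proof -
  have "\<exists>B>0. \<forall>z x t. \<bar>g a (z, x + t *\<^sub>R axis i 1) - g a (z, x)\<bar> \<le> B * \<bar>t\<bar>" if "a \<in> S" for a
    by (rule csupp_vertical_uniform_continuity[OF assms(2)[OF that], where i = i]) blast
  then obtain B where B: "\<And>a. a \<in> S \<Longrightarrow> B a > 0"
    "\<And>a z x t. a \<in> S \<Longrightarrow> \<bar>g a (z, x + t *\<^sub>R axis i 1) - g a (z, x)\<bar> \<le> B a * \<bar>t\<bar>"
    by metis
  define M where "M = (\<Sum>a\<in>S. B a) + 1"
  have M: "M > 0" unfolding M_def using B(1) by (intro add_nonneg_pos sum_nonneg) (auto intro: less_imp_le)
  show thesis
  proof (rule that[of "\<epsilon> / M"])
    show "\<epsilon> / M > 0" using M \<epsilon> by simp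
    fix a z x t assume a: "a \<in> S" and t: "\<bar>t\<bar> < \<epsilon> / M"
    have "B a \<le> M" unfolding M_def using member_le_sum[of a S B] a B(1) assms(1) by (force intro: less_imp_le)
    then have "B a * \<bar>t\<bar> \<le> M * \<bar>t\<bar>" by (intro mult_right_mono) auto
    also have "\<dots> < \<epsilon>" using t M by (simp add: field_simps)
    finally show "\<bar>g a (z, x + t *\<^sub>R axis i 1) - g a (z, x)\<bar> < \<epsilon>" using B(2)[OF a, of z x t] by linarith
  qed
qed

text \<open>\<open>W1\<close> is constant along \<open>i0\<close>, so moving by
  \<open>W1 p - W2 p\<close> in that direction takes a point of the second graph exactly onto the
  first; \<open>\<eta>\<close> controls the change of \<open>g\<close> on the way.\<close>

lemma graph_transport:
  fixes g :: "(real^'q) \<times> (real^'m) \<Rightarrow> real"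
  assumes W1: "wig \<delta> i0 W1" and g: "\<And>p. snd p $ i0 = W1 p \<Longrightarrow> \<bar>g p\<bar> < \<epsilon>1"
    and mod: "\<And>z x t. \<bar>t\<bar> < \<eta> \<Longrightarrow> \<bar>g (z, x + t *\<^sub>R axis i0 1) - g (z, x)\<bar> < \<epsilon>2"
    and close: "\<And>p. \<bar>W2 p - W1 p\<bar> < \<eta>" and p: "snd p $ i0 = W2 p"
  shows "\<bar>g p\<bar> < \<epsilon>1 + \<epsilon>2"
proof -
  obtain z x where zx: "p = (z, x)" by (cases p)
  define t where "t = W1 p - W2 p"
  have "axis i0 (1::real) $ i0 = 1" by (simp add: axis_def)
  then have "(x + t *\<^sub>R axis i0 1) $ i0 = W1 (z, x + t *\<^sub>R axis i0 1)"
    using p by (simp add: zx t_def wig_shift[OF W1])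
  then have "\<bar>g (z, x + t *\<^sub>R axis i0 1)\<bar> < \<epsilon>1" by (intro g) simp
  moreover have "\<bar>t\<bar> < \<eta>" using close[of p] by (simp add: t_def abs_minus_commute)
  then have "\<bar>g (z, x + t *\<^sub>R axis i0 1) - g (z, x)\<bar> < \<epsilon>2" by (rule mod)
  ultimately show ?thesis unfolding zx by linarith
qed

lemma closed_Qbox: "closed (Qbox \<delta> :: ((real^'q) \<times> (real^'m)) set)"
  by (rule compact_imp_closed[OF compact_Qbox])

text \<open>The function \<open>h1\<close> for \<open>e\<close> is chosen first. It determines a
  modulus \<open>\<eta>\<close>, and the remainder is then realized with a displacement below
  \<open>\<eta>\<close>, so that the estimate for \<open>h1\<close> survives on the final graph. As
  the first realization already moves the graph, \<open>rest\<close> has to cover every admissible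
  \<open>W1\<close>.\<close>

lemma realizable_add:
  fixes c e :: "('m::finite \<Rightarrow> nat) \<Rightarrow> 'n::finite \<Rightarrow> (real^'q) \<times> (real^'m) \<Rightarrow> real"
  assumes e: "realizable \<delta> i0 d e W0" "\<And>\<alpha> j. csupp (Qbox \<delta>) (e \<alpha> j)"
    and rest: "\<And>W1. wig \<delta> i0 W1 \<Longrightarrow> realizable \<delta> i0 d (\<lambda>\<alpha> j p. c \<alpha> j p - e \<alpha> j p) W1"
  shows "realizable \<delta> i0 d c W0"
proof (rule realizableI)
  fix \<epsilon> :: real assume \<epsilon>: "\<epsilon> > 0"
  then have \<epsilon>4: "\<epsilon> / 4 > 0" by simp
  obtain h1 :: "'n \<Rightarrow> (real^'q) \<times> (real^'m) \<Rightarrow> real" and W1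
    where h1: "\<And>j. csupp (Qbox \<delta>) (h1 j)" "wig \<delta> i0 W1" "\<And>p. \<bar>W1 p - W0 p\<bar> < \<epsilon> / 4"
    "\<And>\<alpha> j p. mdeg \<alpha> < d \<Longrightarrow> \<bar>pdl (ilist \<alpha>) (h1 j) p\<bar> < \<epsilon> / 4"
    "\<And>\<alpha> j p. mdeg \<alpha> = d \<Longrightarrow> snd p $ i0 = W1 p \<Longrightarrow> \<bar>pdl (ilist \<alpha>) (h1 j) p - e \<alpha> j p\<bar> < \<epsilon> / 4"
    by (rule realizableD[OF e(1) \<epsilon>4], rule that)
  have fin: "finite ({\<alpha> :: 'm \<Rightarrow> nat. mdeg \<alpha> \<le> d} \<times> (UNIV :: 'n set))"
    by (intro finite_SigmaI finite_mdeg_le finite)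
  define g where "g a p = pdl (ilist (fst a)) (h1 (snd a)) p - e (fst a) (snd a) p"
    for a :: "('m \<Rightarrow> nat) \<times> 'n" and p
  have gc: "csupp (Qbox \<delta>) (g a)" for a
    unfolding g_def by (intro csupp_diff csupp_pdl closed_Qbox h1 e)
  obtain \<eta> where \<eta>: "\<eta> > 0" "\<And>a z x t. a \<in> {\<alpha> :: 'm \<Rightarrow> nat. mdeg \<alpha> \<le> d} \<times> (UNIV :: 'n set) \<Longrightarrow> \<bar>t\<bar> < \<eta> \<Longrightarrow>
      \<bar>g a (z, x + t *\<^sub>R axis i0 1) - g a (z, x)\<bar> < \<epsilon> / 4"
    by (rule csupp_vertical_modulus[OF fin gc \<epsilon>4, where i = i0], rule that)
  have m: "min (\<epsilon> / 4) \<eta> > 0" using \<epsilon> \<eta> by simp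
  obtain h2 :: "'n \<Rightarrow> (real^'q) \<times> (real^'m) \<Rightarrow> real" and W2
    where h2: "\<And>j. csupp (Qbox \<delta>) (h2 j)" "wig \<delta> i0 W2" "\<And>p. \<bar>W2 p - W1 p\<bar> < min (\<epsilon> / 4) \<eta>"
    "\<And>\<alpha> j p. mdeg \<alpha> < d \<Longrightarrow> \<bar>pdl (ilist \<alpha>) (h2 j) p\<bar> < min (\<epsilon> / 4) \<eta>"
    "\<And>\<alpha> j p. mdeg \<alpha> = d \<Longrightarrow> snd p $ i0 = W2 p \<Longrightarrow>
      \<bar>pdl (ilist \<alpha>) (h2 j) p - (c \<alpha> j p - e \<alpha> j p)\<bar> < min (\<epsilon> / 4) \<eta>"
    by (rule realizableD[OF rest[OF h1(2)] m], rule that)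
  have add: "pdl (ilist \<alpha>) (\<lambda>p. h1 j p + h2 j p) p = pdl (ilist \<alpha>) (h1 j) p + pdl (ilist \<alpha>) (h2 j) p" for \<alpha> j p
    by (simp add: pdl_add[OF csupp_smooth[OF h1(1)] csupp_smooth[OF h2(1)]])
  show "\<exists>(h :: 'n \<Rightarrow> (real^'q) \<times> (real^'m) \<Rightarrow> real) W.
    (\<forall>j. csupp (Qbox \<delta>) (h j)) \<and> wig \<delta> i0 W \<and> (\<forall>p. \<bar>W p - W0 p\<bar> < \<epsilon>) \<and>
    (\<forall>\<alpha> j p. mdeg \<alpha> < d \<longrightarrow> \<bar>pdl (ilist \<alpha>) (h j) p\<bar> < \<epsilon>) \<and>
    (\<forall>\<alpha> j p. mdeg \<alpha> = d \<longrightarrow> snd p $ i0 = W p \<longrightarrow> \<bar>pdl (ilist \<alpha>) (h j) p - c \<alpha> j p\<bar> < \<epsilon>)"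
  proof (intro exI[of _ "\<lambda>j p. h1 j p + h2 j p"] exI[of _ W2] conjI allI impI)
    show "csupp (Qbox \<delta>) (\<lambda>p. h1 j p + h2 j p)" for j by (intro csupp_add h1 h2)
    show "wig \<delta> i0 W2" by (rule h2)
    show "\<bar>W2 p - W0 p\<bar> < \<epsilon>" for p using h1(3)[of p] h2(3)[of p] \<epsilon> by linarith
    show "\<bar>pdl (ilist \<alpha>) (\<lambda>p. h1 j p + h2 j p) p\<bar> < \<epsilon>" if "mdeg \<alpha> < d" for \<alpha> j p
      unfolding add using h1(4)[OF that, of j p] h2(4)[OF that, of j p] \<epsilon> by linarith
    fix \<alpha> :: "'m \<Rightarrow> nat" and j and p
    assume \<alpha>: "mdeg \<alpha> = d" and p: "snd p $ i0 = W2 p"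
    have "\<bar>g (\<alpha>, j) p\<bar> < \<epsilon> / 4 + \<epsilon> / 4"
    proof (rule graph_transport[where ?W1.0 = W1 and ?W2.0 = W2 and \<eta> = \<eta>, OF h1(2)])
      show "snd p $ i0 = W2 p" by (rule p)
      show "\<bar>g (\<alpha>, j) p\<bar> < \<epsilon> / 4" if "snd p $ i0 = W1 p" for p
        using h1(5)[OF \<alpha> that] by (simp add: g_def)
      show "\<bar>g (\<alpha>, j) (z, x + t *\<^sub>R axis i0 1) - g (\<alpha>, j) (z, x)\<bar> < \<epsilon> / 4" if "\<bar>t\<bar> < \<eta>" for z x t
        using \<alpha> that by (intro \<eta>) auto
      show "\<bar>W2 p - W1 p\<bar> < \<eta>" for p using h2(3)[of p] by simp
    qed
    then have "\<bar>pdl (ilist \<alpha>) (h1 j) p - e \<alpha> j p\<bar> < \<epsilon> / 4 + \<epsilon> / 4" by (simp add: g_def)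
    then show "\<bar>pdl (ilist \<alpha>) (\<lambda>p. h1 j p + h2 j p) p - c \<alpha> j p\<bar> < \<epsilon>"
      unfolding add using h2(5)[OF \<alpha> p, of j] \<epsilon> by linarith
  qed
qed

text \<open>Realizing a power of a linear form times \<open>dY ^ b\<close>, where \<open>Y\<close> is the height over the current
  graph, also produces terms of exponent less than \<open>b\<close> at \<open>i0\<close>, because \<open>dY\<close> has horizontal
  components that depend on the graph; \<open>lower\<close> absorbs them.\<close>

lemma realizable_powers:
  fixes c :: "('m::finite \<Rightarrow> nat) \<Rightarrow> 'n::finite \<Rightarrow> (real^'q) \<times> (real^'m) \<Rightarrow> real"
    and jj :: "'t \<Rightarrow> 'n" and cf :: "'t \<Rightarrow> (real^'q) \<times> (real^'m) \<Rightarrow> real" and vv :: "'t \<Rightarrow> real^'m"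
  assumes \<delta>: "0 < \<delta>" "\<delta> < 1" and b: "b \<le> d" and fin: "finite T"
    and lower: "\<And>(c :: ('m \<Rightarrow> nat) \<Rightarrow> 'n \<Rightarrow> (real^'q) \<times> (real^'m) \<Rightarrow> real) W0. wig \<delta> i0 W0 \<Longrightarrow>
      (\<And>\<alpha> j. csupp (Qbox \<delta>) (c \<alpha> j)) \<Longrightarrow>
      (\<And>\<alpha> j p. mdeg \<alpha> = d \<Longrightarrow> b \<le> \<alpha> i0 \<Longrightarrow> c \<alpha> j p = 0) \<Longrightarrow> realizable \<delta> i0 d c W0"
    and cf: "\<And>\<tau>. csupp (Qbox \<delta>) (cf \<tau>)" and vv: "\<And>\<tau>. vv \<tau> $ i0 = 0"
  shows "wig \<delta> i0 W0 \<Longrightarrow> (\<And>\<alpha> j. csupp (Qbox \<delta>) (c \<alpha> j)) \<Longrightarrow>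
    (\<And>\<alpha> j p. mdeg \<alpha> = d \<Longrightarrow> b < \<alpha> i0 \<Longrightarrow> c \<alpha> j p = 0) \<Longrightarrow>
    (\<And>\<alpha> j p. mdeg \<alpha> = d \<Longrightarrow> \<alpha> i0 = b \<Longrightarrow> c \<alpha> j p = (\<Sum>\<tau>\<in>T. if j = jj \<tau>
        then cf \<tau> p * (\<Prod>i\<in>UNIV. (if i = i0 then 1 else vv \<tau> $ i) ^ \<alpha> i) else 0)) \<Longrightarrow>
    realizable \<delta> i0 d c W0"
  using fin
proof (induction T arbitrary: c W0 rule: finite_induct)
  case empty
  show ?case
  proof (rule lower[OF empty.prems(1,2)])
    show "c \<alpha> j p = 0" if "mdeg \<alpha> = d" "b \<le> \<alpha> i0" for \<alpha> j p
      using empty.prems(3)[OF that(1)] empty.prems(4)[OF that(1)] that(2) by (cases "\<alpha> i0 = b") auto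
  qed
next
  case (insert \<tau> T)
  let ?Y = "\<lambda>p. snd p $ i0 - W0 p"
  define e where "e \<alpha> j p = (if j = jj \<tau> then cf \<tau> p * mc (vv \<tau>) ?Y (ilist \<alpha>) b p else 0)" for \<alpha> j p
  have ec: "csupp (Qbox \<delta>) (e \<alpha> j)" for \<alpha> j
  proof (cases "j = jj \<tau>")
    case True
    then have "e \<alpha> j = (\<lambda>p. cf \<tau> p * mc (vv \<tau>) ?Y (ilist \<alpha>) b p)" by (auto simp: e_def)
    then show ?thesis
      using csupp_mult_right[OF cf[of \<tau>] smooth_on_mc[OF smooth_on_height[OF wig_smooth[OF insert.prems(1)]]]]
      by simp
  next
    case False
    then have "e \<alpha> j = (\<lambda>p. 0)" by (auto simp: e_def)
    then show ?thesis by (simp add: csupp_0)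
  qed
  note Y1 = vv[of \<tau>] pd_height[OF insert.prems(1)]
  show ?case
  proof (rule realizable_add[of _ _ _ e])
    show "realizable \<delta> i0 d e W0"
      unfolding e_def[abs_def] by (rule realizable_primitive[OF \<delta> insert.prems(1) vv cf b])
    show "csupp (Qbox \<delta>) (e \<alpha> j)" for \<alpha> j by (rule ec)
    fix W1 :: "(real^'q) \<times> (real^'m) \<Rightarrow> real" assume W1: "wig \<delta> i0 W1"
    show "realizable \<delta> i0 d (\<lambda>\<alpha> j p. c \<alpha> j p - e \<alpha> j p) W1"
    proof (rule insert.IH[OF W1])
      show "csupp (Qbox \<delta>) (\<lambda>p. c \<alpha> j p - e \<alpha> j p)" for \<alpha> j
        by (intro csupp_diff insert.prems ec)
      show "c \<alpha> j p - e \<alpha> j p = 0" if "mdeg \<alpha> = d" "b < \<alpha> i0" for \<alpha> j p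
      proof -
        \<comment> \<open>The exponent at \<open>i0\<close> exceeds \<open>b\<close>, so
          \<open>T ^ b\<close> lies below the lowest power that occurs.\<close>
        have "mc (vv \<tau>) ?Y (ilist \<alpha>) b p = 0"
          by (rule mc_lt_count[OF Y1]) (simp add: count_ilist that)
        then show ?thesis using insert.prems(3)[OF that] by (simp add: e_def)
      qed
      show "c \<alpha> j p - e \<alpha> j p = (\<Sum>\<tau>\<in>T. if j = jj \<tau>
        then cf \<tau> p * (\<Prod>i\<in>UNIV. (if i = i0 then 1 else vv \<tau> $ i) ^ \<alpha> i) else 0)"
        if "mdeg \<alpha> = d" "\<alpha> i0 = b" for \<alpha> j p
      proof -
        have "mc (vv \<tau>) ?Y (ilist \<alpha>) b p = (\<Prod>i\<in>UNIV. (if i = i0 then 1 else vv \<tau> $ i) ^ \<alpha> i)"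
          using mc_count[OF Y1, of "ilist \<alpha>" p] that(2)
          by (simp only: count_ilist prod_list_ilist)
        then show ?thesis using insert.prems(4)[OF that] insert.hyps by (simp add: e_def)
      qed
    qed
  qed
qed

lemma realizable_zero:
  assumes "wig \<delta> i0 W0" "\<And>\<alpha> j p. mdeg \<alpha> = d \<Longrightarrow> c \<alpha> j p = 0"
  shows "realizable \<delta> i0 d c W0"
proof (rule realizableI)
  have z: "pdl js (\<lambda>_. 0) p = 0" for js and p :: "(real^'b) \<times> (real^'a)"
    by (rule pdl_zero_on_open[of UNIV]) auto
  show "\<exists>(h :: 'c \<Rightarrow> (real^'b) \<times> (real^'a) \<Rightarrow> real) W.
    (\<forall>j. csupp (Qbox \<delta>) (h j)) \<and> wig \<delta> i0 W \<and> (\<forall>p. \<bar>W p - W0 p\<bar> < \<epsilon>) \<and>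
    (\<forall>\<alpha> j p. mdeg \<alpha> < d \<longrightarrow> \<bar>pdl (ilist \<alpha>) (h j) p\<bar> < \<epsilon>) \<and>
    (\<forall>\<alpha> j p. mdeg \<alpha> = d \<longrightarrow> snd p $ i0 = W p \<longrightarrow> \<bar>pdl (ilist \<alpha>) (h j) p - c \<alpha> j p\<bar> < \<epsilon>)"
    if "\<epsilon> > 0" for \<epsilon>
    by (rule exI[of _ "\<lambda>_ _. 0"], rule exI[of _ W0]) (use assms that in \<open>simp add: csupp_0 z\<close>)
qed

text \<open>Each step alters both the coefficients and the graph, so the induction runs over all of
  them at once. The layer \<open>\<alpha> i0 = b\<close> is decomposed into powers of linear forms,
  which \<open>realizable_powers\<close> removes one by one; the induction hypothesis plays the role
  of its assumption \<open>lower\<close>.\<close>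

lemma realizable_if_zero_above:
  fixes c :: "('m::finite \<Rightarrow> nat) \<Rightarrow> 'n::finite \<Rightarrow> (real^'q) \<times> (real^'m) \<Rightarrow> real"
  assumes \<delta>: "0 < \<delta>" "\<delta> < 1"
  shows "wig \<delta> i0 W0 \<Longrightarrow> (\<And>\<alpha> j. csupp (Qbox \<delta>) (c \<alpha> j)) \<Longrightarrow>
    (\<And>\<alpha> j p. mdeg \<alpha> = d \<Longrightarrow> b \<le> \<alpha> i0 \<Longrightarrow> c \<alpha> j p = 0) \<Longrightarrow> realizable \<delta> i0 d c W0"
proof (induction b arbitrary: c W0)
  case 0
  show ?case by (rule realizable_zero[OF 0(1)]) (use 0(3) in auto)
next
  case (Suc b)
  show ?case
  proof (cases "b \<le> d")
    case False
    show ?thesis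
    proof (rule Suc.IH[OF Suc.prems(1,2)])
      show "c \<alpha> j p = 0" if "mdeg \<alpha> = d" "b \<le> \<alpha> i0" for \<alpha> j p
        using le_mdeg[of \<alpha> i0] that False by simp
    qed
  next
    case True
    obtain P :: "('m \<Rightarrow> nat) \<Rightarrow> ('m \<Rightarrow> nat) \<Rightarrow> real"
      where P: "\<And>\<alpha> \<alpha>0. mdeg \<alpha> = d \<Longrightarrow> mdeg \<alpha>0 = d \<Longrightarrow> \<alpha> i0 = \<alpha>0 i0 \<Longrightarrow>
      (\<Sum>t\<in>PiE UNIV (\<lambda>_. {..d}). P \<alpha>0 t * (\<Prod>i\<in>UNIV. (if i = i0 then 1 else real (t i)) ^ \<alpha> i)) =
        (if \<alpha> = \<alpha>0 then 1 else 0)"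
      by (rule grid_polarization[of d i0], rule that)
    define A where "A = {\<alpha>0 :: 'm \<Rightarrow> nat. mdeg \<alpha>0 = d \<and> \<alpha>0 i0 = b}"
    define G where "G = PiE (UNIV :: 'm set) (\<lambda>_. {..d})"
    have finA: "finite A" by (rule finite_subset[OF _ finite_mdeg_le[of d]]) (auto simp: A_def)
    have finG: "finite G" unfolding G_def by (intro finite_PiE) auto
    \<comment> \<open>An index \<open>\<tau>\<close> consists of a component of the fibre, the
      multi-index \<open>\<alpha>0\<close> whose coefficient is to be produced, and a grid point
      that supplies the linear form.\<close>
    define cf where "cf \<tau> p = P (fst (snd \<tau>)) (snd (snd \<tau>)) * c (fst (snd \<tau>)) (fst \<tau>) p"
      for \<tau> :: "'n \<times> ('m \<Rightarrow> nat) \<times> ('m \<Rightarrow> nat)" and p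
    define vv where "vv \<tau> = (\<chi> i. if i = i0 then 0 else real (snd (snd \<tau>) i))"
      for \<tau> :: "'n \<times> ('m \<Rightarrow> nat) \<times> ('m \<Rightarrow> nat)"
    show ?thesis
    proof (rule realizable_powers[OF \<delta> True _ Suc.IH, where T = "UNIV \<times> A \<times> G" and jj = fst and cf = cf and vv = vv])
      show "finite ((UNIV :: 'n set) \<times> A \<times> G)" by (intro finite_SigmaI finA finG finite)
      show "csupp (Qbox \<delta>) (cf \<tau>)" for \<tau> unfolding cf_def by (intro csupp_cmult Suc.prems)
      show "vv \<tau> $ i0 = 0" for \<tau> by (simp add: vv_def)
      show "wig \<delta> i0 W0" "csupp (Qbox \<delta>) (c \<alpha> j)" for \<alpha> j by (rule Suc.prems)+
      show "c \<alpha> j p = 0" if "mdeg \<alpha> = d" "b < \<alpha> i0" for \<alpha> j p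
        using that by (intro Suc.prems(3)) auto
      fix \<alpha> j p assume \<alpha>: "mdeg \<alpha> = d" "\<alpha> i0 = b"
      let ?m = "\<lambda>t. \<Prod>i\<in>UNIV. (if i = i0 then 1 else real (t i)) ^ \<alpha> i"
      have "(\<Sum>\<tau>\<in>UNIV \<times> A \<times> G. if j = fst \<tau>
        then cf \<tau> p * (\<Prod>i\<in>UNIV. (if i = i0 then 1 else vv \<tau> $ i) ^ \<alpha> i) else 0) =
        (\<Sum>j'\<in>UNIV. \<Sum>\<alpha>0\<in>A. \<Sum>t\<in>G. if j = j' then P \<alpha>0 t * c \<alpha>0 j' p * ?m t else 0)"
        unfolding sum.cartesian_product
        by (intro sum.cong) (auto simp: cf_def vv_def intro!: prod.cong)
      also have "\<dots> = (\<Sum>j'\<in>UNIV. if j = j' then \<Sum>\<alpha>0\<in>A. \<Sum>t\<in>G. P \<alpha>0 t * c \<alpha>0 j' p * ?m t else 0)"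
        by (intro sum.cong) auto
      also have "\<dots> = (\<Sum>\<alpha>0\<in>A. \<Sum>t\<in>G. P \<alpha>0 t * c \<alpha>0 j p * ?m t)" by simp
      also have "\<dots> = (\<Sum>\<alpha>0\<in>A. c \<alpha>0 j p * (\<Sum>t\<in>G. P \<alpha>0 t * ?m t))"
        by (simp add: sum_distrib_left mult_ac)
      also have "\<dots> = (\<Sum>\<alpha>0\<in>A. if \<alpha> = \<alpha>0 then c \<alpha>0 j p else 0)"
        by (intro sum.cong refl) (use \<alpha> in \<open>auto simp: A_def G_def P\<close>)
      also have "\<dots> = c \<alpha> j p" using \<alpha> finA by (simp add: A_def)
      finally show "c \<alpha> j p = (\<Sum>\<tau>\<in>UNIV \<times> A \<times> G. if j = fst \<tau>
        then cf \<tau> p * (\<Prod>i\<in>UNIV. (if i = i0 then 1 else vv \<tau> $ i) ^ \<alpha> i) else 0)" by simp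
    qed
  qed
qed

text \<open>No exponent of a multi-index of degree \<open>d\<close> reaches \<open>Suc d\<close>, so
  with this bound the vanishing condition of \<open>realizable_if_zero_above\<close> is
  vacuous.\<close>

lemma realizable_csupp:
  fixes c :: "('m::finite \<Rightarrow> nat) \<Rightarrow> 'n::finite \<Rightarrow> (real^'q) \<times> (real^'m) \<Rightarrow> real"
  assumes \<delta>: "0 < \<delta>" "\<delta> < 1" and W0: "wig \<delta> i0 W0" and c: "\<And>\<alpha> j. csupp (Qbox \<delta>) (c \<alpha> j)"
  shows "realizable \<delta> i0 d c W0"
proof (rule realizable_if_zero_above[OF \<delta> W0 c, of d "Suc d"])
  show "c \<alpha> j p = 0" if "mdeg \<alpha> = d" "Suc d \<le> \<alpha> i0" for \<alpha> j p
    using le_mdeg[of \<alpha> i0] that by simp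
qed

section \<open>Induction over the orders of differentiation\<close>

lemma wig_0: "wig \<delta> i0 (\<lambda>_. 0)"
  by (simp add: wig_def)

text \<open>The defect of \<open>h0\<close> in order \<open>Suc d\<close> is realized over the graph
  already found. The correction is small in all orders up to \<open>d\<close> everywhere, so it
  preserves the global bound for orders up to \<open>l\<close> and, after
  \<open>graph_transport\<close>, the approximation on the graph. The start is the zero function
  over the flat graph, because \<open>c\<close> vanishes up to order \<open>l\<close>.\<close>

lemma jets_approximable_on_graph:
  fixes c :: "('m::finite \<Rightarrow> nat) \<Rightarrow> 'n::finite \<Rightarrow> (real^'q) \<times> (real^'m) \<Rightarrow> real"
  assumes \<delta>: "0 < \<delta>" "\<delta> < 1" and c: "\<And>\<alpha> j. csupp (Qbox \<delta>) (c \<alpha> j)"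
    and low: "\<And>\<alpha> j p. mdeg \<alpha> \<le> l \<Longrightarrow> c \<alpha> j p = 0"
  shows "l \<le> d \<Longrightarrow> \<epsilon> > 0 \<Longrightarrow> \<exists>(h :: 'n \<Rightarrow> (real^'q) \<times> (real^'m) \<Rightarrow> real) W.
    (\<forall>j. csupp (Qbox \<delta>) (h j)) \<and> wig \<delta> i0 W \<and> (\<forall>p. \<bar>W p\<bar> < \<epsilon>) \<and>
    (\<forall>\<alpha> j p. mdeg \<alpha> \<le> l \<longrightarrow> \<bar>pdl (ilist \<alpha>) (h j) p\<bar> < \<epsilon>) \<and>
    (\<forall>\<alpha> j p. mdeg \<alpha> \<le> d \<longrightarrow> snd p $ i0 = W p \<longrightarrow> \<bar>pdl (ilist \<alpha>) (h j) p - c \<alpha> j p\<bar> < \<epsilon>)"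
proof (induction d arbitrary: \<epsilon> rule: dec_induct)
  case base
  have z: "pdl js (\<lambda>_. 0) p = 0" for js and p :: "(real^'q) \<times> (real^'m)"
    by (rule pdl_zero_on_open[of UNIV]) auto
  show ?case
    by (rule exI[of _ "\<lambda>_ _. 0"], rule exI[of _ "\<lambda>_. 0"]) (use base low in \<open>simp add: csupp_0 z wig_0\<close>)
next
  case (step d)
  have \<epsilon>4: "\<epsilon> / 4 > 0" using step.prems by simp
  from step.IH[OF this] obtain h0 :: "'n \<Rightarrow> (real^'q) \<times> (real^'m) \<Rightarrow> real" and W0
    where h0: "\<And>j. csupp (Qbox \<delta>) (h0 j)" "wig \<delta> i0 W0" and W0: "\<forall>p. \<bar>W0 p\<bar> < \<epsilon> / 4" and
    h0l: "\<forall>\<alpha> j p. mdeg \<alpha> \<le> l \<longrightarrow> \<bar>pdl (ilist \<alpha>) (h0 j) p\<bar> < \<epsilon> / 4" and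
    h0d: "\<forall>\<alpha> j p. mdeg \<alpha> \<le> d \<longrightarrow> snd p $ i0 = W0 p \<longrightarrow> \<bar>pdl (ilist \<alpha>) (h0 j) p - c \<alpha> j p\<bar> < \<epsilon> / 4"
    by auto
  have fin: "finite ({\<alpha> :: 'm \<Rightarrow> nat. mdeg \<alpha> \<le> d} \<times> (UNIV :: 'n set))"
    by (intro finite_SigmaI finite_mdeg_le finite)
  define g where "g a p = pdl (ilist (fst a)) (h0 (snd a)) p - c (fst a) (snd a) p"
    for a :: "('m \<Rightarrow> nat) \<times> 'n" and p
  have gc: "csupp (Qbox \<delta>) (g a)" for a
    unfolding g_def by (intro csupp_diff csupp_pdl closed_Qbox h0 c)
  obtain \<eta> where \<eta>: "\<eta> > 0" "\<And>a z x t. a \<in> {\<alpha> :: 'm \<Rightarrow> nat. mdeg \<alpha> \<le> d} \<times> (UNIV :: 'n set) \<Longrightarrow> \<bar>t\<bar> < \<eta> \<Longrightarrow>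
      \<bar>g a (z, x + t *\<^sub>R axis i0 1) - g a (z, x)\<bar> < \<epsilon> / 4"
    by (rule csupp_vertical_modulus[OF fin gc \<epsilon>4, where i = i0], rule that)
  have m: "min (\<epsilon> / 4) \<eta> > 0" using \<epsilon>4 \<eta> by simp
  have "realizable \<delta> i0 (Suc d) (\<lambda>\<alpha> j p. c \<alpha> j p - pdl (ilist \<alpha>) (h0 j) p) W0"
    by (intro realizable_csupp \<delta> h0 csupp_diff csupp_pdl closed_Qbox c)
  from realizableD[OF this m] obtain h1 :: "'n \<Rightarrow> (real^'q) \<times> (real^'m) \<Rightarrow> real" and W1
    where h1: "\<And>j. csupp (Qbox \<delta>) (h1 j)" "wig \<delta> i0 W1" and W1: "\<And>p. \<bar>W1 p - W0 p\<bar> < min (\<epsilon> / 4) \<eta>"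
    and h1l: "\<And>\<alpha> j p. mdeg \<alpha> < Suc d \<Longrightarrow> \<bar>pdl (ilist \<alpha>) (h1 j) p\<bar> < min (\<epsilon> / 4) \<eta>"
    and h1d: "\<And>\<alpha> j p. mdeg \<alpha> = Suc d \<Longrightarrow> snd p $ i0 = W1 p \<Longrightarrow>
      \<bar>pdl (ilist \<alpha>) (h1 j) p - (c \<alpha> j p - pdl (ilist \<alpha>) (h0 j) p)\<bar> < min (\<epsilon> / 4) \<eta>"
    by metis
  have add: "pdl (ilist \<alpha>) (\<lambda>p. h0 j p + h1 j p) p = pdl (ilist \<alpha>) (h0 j) p + pdl (ilist \<alpha>) (h1 j) p" for \<alpha> j p
    by (simp add: pdl_add[OF csupp_smooth[OF h0(1)] csupp_smooth[OF h1(1)]])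
  show ?case
  proof (intro exI[of _ "\<lambda>j p. h0 j p + h1 j p"] exI[of _ W1] conjI allI impI)
    show "csupp (Qbox \<delta>) (\<lambda>p. h0 j p + h1 j p)" for j by (intro csupp_add h0 h1)
    show "wig \<delta> i0 W1" by (rule h1)
    show "\<bar>W1 p\<bar> < \<epsilon>" for p using W0[rule_format, of p] W1[of p] step.prems by linarith
    show "\<bar>pdl (ilist \<alpha>) (\<lambda>p. h0 j p + h1 j p) p\<bar> < \<epsilon>" if "mdeg \<alpha> \<le> l" for \<alpha> j p
      unfolding add using h0l[rule_format, OF that, of j p] h1l[of \<alpha> j p] that step.hyps(1) step.prems by linarith
    fix \<alpha> :: "'m \<Rightarrow> nat" and j and p
    assume \<alpha>: "mdeg \<alpha> \<le> Suc d" and p: "snd p $ i0 = W1 p"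
    show "\<bar>pdl (ilist \<alpha>) (\<lambda>p. h0 j p + h1 j p) p - c \<alpha> j p\<bar> < \<epsilon>"
    proof (cases "mdeg \<alpha> = Suc d")
      case True
      show ?thesis unfolding add using h1d[OF True p, of j] step.prems by linarith
    next
      case False
      then have \<alpha>d: "mdeg \<alpha> \<le> d" using \<alpha> by simp
      have "\<bar>g (\<alpha>, j) p\<bar> < \<epsilon> / 4 + \<epsilon> / 4"
      proof (rule graph_transport[where ?W1.0 = W0 and ?W2.0 = W1 and \<eta> = \<eta>, OF h0(2)])
        show "snd p $ i0 = W1 p" by (rule p)
        show "\<bar>g (\<alpha>, j) p\<bar> < \<epsilon> / 4" if "snd p $ i0 = W0 p" for p
          using h0d[rule_format, OF \<alpha>d that] by (simp add: g_def)
        show "\<bar>g (\<alpha>, j) (z, x + t *\<^sub>R axis i0 1) - g (\<alpha>, j) (z, x)\<bar> < \<epsilon> / 4" if "\<bar>t\<bar> < \<eta>" for z x t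
          using \<alpha>d that by (intro \<eta>) auto
        show "\<bar>W1 p - W0 p\<bar> < \<eta>" for p using W1[of p] by simp
      qed
      then have "\<bar>pdl (ilist \<alpha>) (h0 j) p - c \<alpha> j p\<bar> < \<epsilon> / 4 + \<epsilon> / 4" by (simp add: g_def)
      then show ?thesis
        unfolding add using h1l[of \<alpha> j p] \<alpha>d step.prems by linarith
    qed
  qed
qed

section \<open>Fibre isotopies and cut-offs\<close>

text \<open>Differentiability comes from the inverse function theorem for
  \<open>(s, y) \<mapsto> (s, y + s * \<beta> y)\<close>. The derivative of \<open>H\<close> is a
  smooth expression in \<open>s\<close> and \<open>H\<close> itself, so each order of regularity of
  \<open>H\<close> gives the next.\<close>

lemma smooth_fiber_inverse:
  fixes \<beta> :: "real \<Rightarrow> real" and H :: "real \<Rightarrow> real \<Rightarrow> real"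
  assumes \<beta>: "smooth_on UNIV \<beta>" and pos: "\<And>s y. \<bar>s\<bar> < s0 \<Longrightarrow> 0 < 1 + s * deriv \<beta> y"
    and HF: "\<And>s y. \<bar>s\<bar> < s0 \<Longrightarrow> H s (y + s * \<beta> y) = y"
    and FH: "\<And>s y. \<bar>s\<bar> < s0 \<Longrightarrow> H s y + s * \<beta> (H s y) = y"
  shows "smooth_on ({-s0<..<s0} \<times> UNIV) (\<lambda>p. H (fst p) (snd p))"
proof -
  let ?S = "{-s0<..<s0} \<times> (UNIV :: real set)"
  have S: "open ?S" by (intro open_Times) auto
  have inS: "\<bar>fst p\<bar> < s0" if "p \<in> ?S" for p using that by auto
  define F where "F p = (fst p, snd p + fst p * \<beta> (snd p))" for p :: "real \<times> real"
  define G where "G p = (fst p, H (fst p) (snd p))" for p :: "real \<times> real"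
  define D where "D p v = (snd v + - (\<beta> (H (fst p) (snd p)) * fst v)) *
      inverse (1 + fst p * deriv \<beta> (H (fst p) (snd p)))" for p v :: "real \<times> real"
  have dF: "(F has_derivative (\<lambda>v. (fst v, snd v + (fst p * (deriv \<beta> (snd p) * snd v) + fst v * \<beta> (snd p))))) (at p)" for p
  proof -
    have "((\<lambda>p::real \<times> real. \<beta> (snd p)) has_derivative (\<lambda>v. deriv \<beta> (snd p) * snd v)) (at p)"
      by (rule has_derivative_compose[OF has_derivative_snd[OF has_derivative_ident]
            smooth_on_real_deriv(1)[OF \<beta>, unfolded has_field_derivative_def]])
    then show ?thesis
      unfolding F_def by (intro has_derivative_Pair has_derivative_add has_derivative_mult
          has_derivative_fst has_derivative_snd has_derivative_ident)
  qed
  have dG: "(G has_derivative (\<lambda>v. (fst v, D p v))) (at p)" if p: "p \<in> ?S" for p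
  proof (rule has_derivative_inverse_strong_x[OF S])
    show "G p \<in> ?S" using p by (auto simp: G_def)
    show "continuous_on ?S F"
      using dF by (auto intro!: continuous_at_imp_continuous_on intro: has_derivative_continuous)
    show "G (F x) = x" if "x \<in> ?S" for x using HF[OF inS[OF that]] by (simp add: F_def G_def)
    show "(F has_derivative (\<lambda>v. (fst v, snd v + (fst (G p) * (deriv \<beta> (snd (G p)) * snd v) + fst v * \<beta> (snd (G p)))))) (at (G p))"
      by (rule dF)
    show "(\<lambda>v. (fst v, snd v + (fst (G p) * (deriv \<beta> (snd (G p)) * snd v) + fst v * \<beta> (snd (G p))))) \<circ>
        (\<lambda>v. (fst v, D p v)) = id"
    proof
      fix v
      have "D p v * (1 + fst p * deriv \<beta> (H (fst p) (snd p))) = snd v - \<beta> (H (fst p) (snd p)) * fst v"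
        using pos[OF inS[OF p], of "H (fst p) (snd p)"] by (simp add: D_def)
      then show "((\<lambda>v. (fst v, snd v + (fst (G p) * (deriv \<beta> (snd (G p)) * snd v) + fst v * \<beta> (snd (G p))))) \<circ>
        (\<lambda>v. (fst v, D p v))) v = id v"
        by (simp add: G_def prod_eq_iff algebra_simps)
    qed
    show "F (G p) = p" using FH[OF inS[OF p]] by (simp add: F_def G_def)
  qed
  have dH: "((\<lambda>p. H (fst p) (snd p)) has_derivative D p) (at p)" if "p \<in> ?S" for p
    using has_derivative_snd[OF dG[OF that]] by (simp add: G_def)
  have "Ck k ?S (\<lambda>p. H (fst p) (snd p))" for k
  proof (induction k)
    case 0
    show ?case using dH by (auto intro!: continuous_at_imp_continuous_on intro: has_derivative_continuous)
  next
    case (Suc k)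
    have lin: "Ck k ?S fst" "Ck k ?S snd"
      by (intro Ck_bounded_linear bounded_linear_fst bounded_linear_snd)+
    have G: "Ck k ?S G"
    proof -
      have "Ck k ?S (\<lambda>p. fst p *\<^sub>R (1 :: real, 0 :: real) + H (fst p) (snd p) *\<^sub>R (0, 1))"
        by (intro Ck_add Ck_scaleR Ck_const lin Suc)
      then show ?thesis by (simp add: G_def[abs_def])
    qed
    have R: "smooth_on ?S (\<lambda>p. inverse (1 + fst p * deriv \<beta> (snd p)))"
    proof (rule smooth_on_inverse)
      have "smooth_on ?S (\<lambda>p. deriv \<beta> (snd p))"
        by (rule smooth_on_compose[OF smooth_on_real_deriv(2)[OF \<beta>] smooth_on_bounded_linear[OF bounded_linear_snd S]]) simp
      then show "smooth_on ?S (\<lambda>p. 1 + fst p * deriv \<beta> (snd p))"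
        by (intro smooth_on_add smooth_on_mult smooth_on_const S
            smooth_on_bounded_linear[OF bounded_linear_fst S])
      show "1 + fst p * deriv \<beta> (snd p) \<noteq> 0" if "p \<in> ?S" for p
        using pos[OF inS[OF that], of "snd p"] by simp
    qed
    have "Ck k ?S (\<lambda>p. (\<lambda>p. inverse (1 + fst p * deriv \<beta> (snd p))) (G p))"
      by (rule Ck_compose[OF _ G]) (use R in \<open>auto simp: smooth_on_def G_def\<close>)
    then have 1: "Ck k ?S (\<lambda>p. inverse (1 + fst p * deriv \<beta> (H (fst p) (snd p))))" by (simp add: G_def)
    have 2: "Ck k ?S (\<lambda>p. \<beta> (H (fst p) (snd p)))"
      by (rule Ck_compose[OF _ Suc]) (use \<beta> in \<open>auto simp: smooth_on_def\<close>)
    have 3: "Ck k ?S (\<lambda>p. D p v)" for v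
    proof -
      have "Ck k ?S (\<lambda>p. (snd v + \<beta> (H (fst p) (snd p)) * (- fst v)) *
        inverse (1 + fst p * deriv \<beta> (H (fst p) (snd p))))"
        by (intro Ck_mult Ck_add Ck_const 1 2)
      then show ?thesis by (simp add: D_def)
    qed
    show ?case by (rule Ck_SucI[OF dH 3])
  qed
  then show ?thesis by (rule smooth_onI[OF S])
qed

text \<open>For small \<open>s\<close> the map \<open>y \<mapsto> y + s * \<beta> y\<close> has
  positive derivative and is the identity off a bounded interval, hence is a bijection of the line;
  \<open>H s\<close> is its inverse.\<close>

lemma fiber_isotopy_exists:
  obtains \<beta> :: "real \<Rightarrow> real" and H :: "real \<Rightarrow> real \<Rightarrow> real" and s0 :: real
  where "smooth_on UNIV \<beta>" "\<beta> 0 = 1" "\<And>y. \<bar>\<beta> y\<bar> \<le> 1" "\<And>y. 3 / 4 \<le> \<bar>y\<bar> \<Longrightarrow> \<beta> y = 0"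
    "0 < s0" "s0 \<le> 1 / 4"
    "smooth_on ({-s0<..<s0} \<times> UNIV) (\<lambda>p. H (fst p) (snd p))"
    "\<And>s y. \<bar>s\<bar> < s0 \<Longrightarrow> H s (y + s * \<beta> y) = y"
    "\<And>s y. \<bar>s\<bar> < s0 \<Longrightarrow> H s y + s * \<beta> (H s y) = y"
proof -
  obtain \<beta> :: "real \<Rightarrow> real" where \<beta>: "smooth_on UNIV \<beta>" "\<And>x. 0 \<le> \<beta> x" "\<And>x. \<beta> x \<le> 1"
    "\<And>x. \<bar>x\<bar> \<le> 1 / 4 \<Longrightarrow> \<beta> x = 1" "\<And>x. 3 / 4 \<le> \<bar>x\<bar> \<Longrightarrow> \<beta> x = 0"
    by (rule smooth_bump_exists[of "1 / 4" "3 / 4"], simp, simp, rule that)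
  have "smooth_bdd \<beta>" by (rule smooth_bdd_compact_support[OF \<beta>(1,5)])
  from smooth_bddE[OF this, of 1] obtain M where M: "\<And>x. \<bar>deriv \<beta> x\<bar> \<le> M" by auto
  have M0: "M \<ge> 0" using order_trans[OF abs_ge_zero M] by blast
  \<comment> \<open>Gives \<open>s0 * M < 1\<close>, so that the maps increase, and
    \<open>s0 \<le> 1 / 4\<close>, so that points with \<open>\<bar>y\<bar> < 3 / 4\<close> stay
    between -1 and 1.\<close>
  define s0 where "s0 = 1 / (4 * (M + 1))"
  have s0: "0 < s0" "s0 \<le> 1 / 4" using M0 by (simp_all add: s0_def field_simps)
  have pos: "0 < 1 + s * deriv \<beta> y" if "\<bar>s\<bar> < s0" for s y
  proof -
    have "\<bar>s * deriv \<beta> y\<bar> \<le> s0 * M"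
      unfolding abs_mult using that M[of y] by (intro mult_mono) auto
    also have "\<dots> < 1" using M0 by (simp add: s0_def field_simps)
    finally show ?thesis by linarith
  qed
  define H where "H s w = (SOME y. y + s * \<beta> y = w)" for s w
  have FH: "H s w + s * \<beta> (H s w) = w" if s: "\<bar>s\<bar> < s0" for s w
  proof -
    have cont: "continuous_on {- (\<bar>w\<bar> + 1)..\<bar>w\<bar> + 1} (\<lambda>y. y + s * \<beta> y)"
      by (intro continuous_intros continuous_on_subset[OF smooth_on_continuous_on[OF \<beta>(1)]]) auto
    have "\<beta> (- (\<bar>w\<bar> + 1)) = 0" "\<beta> (\<bar>w\<bar> + 1) = 0" by (intro \<beta>(5); simp)+
    then have "\<exists>y\<ge>- (\<bar>w\<bar> + 1). y \<le> \<bar>w\<bar> + 1 \<and> y + s * \<beta> y = w"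
      by (intro IVT'[OF _ _ _ cont]) auto
    then show ?thesis unfolding H_def by (metis (mono_tags, lifting) someI_ex)
  qed
  have inj: "y = y'" if s: "\<bar>s\<bar> < s0" and eq: "y + s * \<beta> y = y' + s * \<beta> y'" for s y y'
  proof -
    have der: "((\<lambda>y. y + s * \<beta> y) has_real_derivative 1 + s * deriv \<beta> y) (at y)" for y
      by (intro DERIV_add DERIV_ident DERIV_cmult smooth_on_real_deriv \<beta>)
    have less: "y + s * \<beta> y < y' + s * \<beta> y'" if "y < y'" for y y'
      by (rule DERIV_pos_imp_increasing[OF that, of "\<lambda>y. y + s * \<beta> y"]) (use der pos[OF s] in blast)
    show ?thesis using less[of y y'] less[of y' y] eq by (cases y y' rule: linorder_cases) auto
  qed
  have HF: "H s (y + s * \<beta> y) = y" if "\<bar>s\<bar> < s0" for s y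
    by (rule inj[OF that]) (rule FH[OF that])
  show thesis
  proof (rule that[of \<beta> s0 H])
    show "\<bar>\<beta> y\<bar> \<le> 1" for y using \<beta>(2,3)[of y] by simp
    show "smooth_on ({-s0<..<s0} \<times> UNIV) (\<lambda>p. H (fst p) (snd p))"
      by (rule smooth_fiber_inverse[OF \<beta>(1) pos HF FH])
  qed (use \<beta> s0 HF FH in auto)
qed

section \<open>Cubes, boundary layers and cut-offs\<close>

lemma icube_eq_cbox: "(icube :: (real^'a) set) = cbox (\<chi> i. -1) (\<chi> i. 1)"
  by (auto simp: icube_def mem_box_cart abs_le_iff minus_le_iff)

lemma compact_icube: "compact (icube :: (real^'a) set)"
  by (simp add: icube_eq_cbox)

lemma frontier_icube: "frontier (icube :: (real^'a) set) = {x \<in> icube. \<exists>i. \<bar>x $ i\<bar> = 1}"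
proof -
  have "\<bar>x $ i\<bar> = 1 \<longleftrightarrow> \<not> (-1 < x $ i \<and> x $ i < 1)" if "x \<in> icube" for x :: "real^'a" and i
  proof -
    have "\<bar>x $ i\<bar> \<le> 1" using that by (simp add: icube_def)
    then show ?thesis by linarith
  qed
  then show ?thesis
    unfolding icube_eq_cbox frontier_cbox by (auto simp: mem_box_cart)
qed

text \<open>Coordinate \<open>i\<close> is moved to its sign; \<open>\<delta> \<le> 1\<close>
  ensures that it is nonzero.\<close>

lemma near_frontier:
  fixes x :: "real^'a"
  assumes x: "x \<in> icube" and i: "1 - \<delta> < \<bar>x $ i\<bar>" and \<delta>: "\<delta> \<le> 1"
  obtains y where "y \<in> icube" "y \<in> frontier icube" "dist x y < \<delta>"
proof -
  define t where "t = sgn (x $ i) - x $ i"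
  define y where "y = x + t *\<^sub>R axis i 1"
  have x1: "\<bar>x $ j\<bar> \<le> 1" for j using x by (simp add: icube_def)
  have nz: "x $ i \<noteq> 0" using i \<delta> by auto
  have yj: "y $ j = (if j = i then sgn (x $ i) else x $ j)" for j
    by (simp add: y_def t_def axis_def)
  have y: "y \<in> icube" using x1 by (auto simp: icube_def yj abs_sgn_eq)
  moreover have "\<bar>y $ i\<bar> = 1" using nz by (simp add: yj abs_sgn_eq)
  then have "y \<in> frontier icube" using y unfolding frontier_icube by blast
  moreover have "dist x y = \<bar>t\<bar>" by (simp add: y_def dist_norm norm_axis_1)
  moreover have "\<bar>t\<bar> < \<delta>" using x1[of i] i nz by (auto simp: t_def sgn_if abs_if split: if_splits)
  ultimately show thesis by (intro that[of y]) auto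
qed

text \<open>Uniform continuity on the compact product turns vanishing on the boundary into smallness
  on a layer of uniform width. The width is \<open>2 * \<delta>\<close> so that a cut-off can
  descend between the depths \<open>2 * \<delta>\<close> and \<open>\<delta>\<close>.\<close>

lemma small_near_frontier:
  fixes f :: "(real^'q) \<times> (real^'m) \<Rightarrow> real"
  assumes cont: "continuous_on (icube \<times> icube) f" and \<epsilon>: "\<epsilon> > 0"
    and zero: "\<And>z x. z \<in> icube \<Longrightarrow> x \<in> icube \<Longrightarrow> z \<in> frontier icube \<or> x \<in> frontier icube \<Longrightarrow> f (z, x) = 0"
  obtains \<delta> where "0 < \<delta>" "\<delta> \<le> 1 / 4"
    "\<And>z x. z \<in> icube \<Longrightarrow> x \<in> icube \<Longrightarrow> (\<exists>i. 1 - 2 * \<delta> < \<bar>z $ i\<bar>) \<or> (\<exists>i. 1 - 2 * \<delta> < \<bar>x $ i\<bar>) \<Longrightarrow> \<bar>f (z, x)\<bar> < \<epsilon>"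
proof -
  have "uniformly_continuous_on (icube \<times> icube) f"
    by (rule compact_uniformly_continuous[OF cont]) (intro compact_Times compact_icube)
  then obtain \<eta> where \<eta>: "\<eta> > 0" "\<And>p p'. p \<in> icube \<times> icube \<Longrightarrow> p' \<in> icube \<times> icube \<Longrightarrow> dist p' p < \<eta> \<Longrightarrow>
      dist (f p') (f p) < \<epsilon>"
    using \<epsilon> unfolding uniformly_continuous_on_def by metis
  define \<delta> where "\<delta> = min \<eta> (1 / 2) / 2"
  have \<delta>: "0 < \<delta>" "\<delta> \<le> 1 / 4" "2 * \<delta> \<le> 1" "2 * \<delta> \<le> \<eta>" using \<eta>(1) by (auto simp: \<delta>_def)
  show thesis
  proof (rule that[OF \<delta>(1,2)])
    fix z :: "real^'q" and x :: "real^'m"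
    assume z: "z \<in> icube" and x: "x \<in> icube"
      and "(\<exists>i. 1 - 2 * \<delta> < \<bar>z $ i\<bar>) \<or> (\<exists>i. 1 - 2 * \<delta> < \<bar>x $ i\<bar>)"
    then show "\<bar>f (z, x)\<bar> < \<epsilon>"
    proof (elim disjE exE)
      fix i assume "1 - 2 * \<delta> < \<bar>z $ i\<bar>"
      from near_frontier[OF z this \<delta>(3)] obtain y where y: "y \<in> icube" "y \<in> frontier icube" "dist z y < 2 * \<delta>"
        by blast
      have "dist (f (z, x)) (f (y, x)) < \<epsilon>"
        using z x y \<delta>(4) by (intro \<eta>) (auto simp: dist_Pair_Pair)
      moreover have "f (y, x) = 0" using zero[OF y(1) x] y(2) by blast
      ultimately show ?thesis by (simp add: dist_real_def)
    next
      fix i assume "1 - 2 * \<delta> < \<bar>x $ i\<bar>"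
      from near_frontier[OF x this \<delta>(3)] obtain y where y: "y \<in> icube" "y \<in> frontier icube" "dist x y < 2 * \<delta>"
        by blast
      have "dist (f (z, x)) (f (z, y)) < \<epsilon>"
        using z x y \<delta>(4) by (intro \<eta>) (auto simp: dist_Pair_Pair)
      moreover have "f (z, y) = 0" using zero[OF z y(1)] y(2) by blast
      ultimately show ?thesis by (simp add: dist_real_def)
    qed
  qed
qed

lemma box_cutoff_exists:
  assumes \<delta>: "0 < \<delta>" "\<delta> \<le> 1 / 4"
  obtains \<phi> :: "(real^'q) \<times> (real^'m) \<Rightarrow> real"
  where "csupp (Qbox \<delta>) \<phi>" "\<And>p. 0 \<le> \<phi> p \<and> \<phi> p \<le> 1" "\<And>p. p \<in> Qbox (2 * \<delta>) \<Longrightarrow> \<phi> p = 1"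
proof -
  obtain b :: "real \<Rightarrow> real" where b: "smooth_on UNIV b" "\<And>x. 0 \<le> b x" "\<And>x. b x \<le> 1"
    "\<And>x. \<bar>x\<bar> \<le> 1 - 2 * \<delta> \<Longrightarrow> b x = 1" "\<And>x. 1 - \<delta> \<le> \<bar>x\<bar> \<Longrightarrow> b x = 0"
    by (rule smooth_bump_exists[of "1 - 2 * \<delta>" "1 - \<delta>"]) (use \<delta> in auto)
  define \<phi> where "\<phi> p = (\<Prod>i\<in>UNIV. b (fst p $ i)) * (\<Prod>i\<in>UNIV. b (snd p $ i))"
    for p :: "(real^'q) \<times> (real^'m)"
  show thesis
  proof
    show "\<phi> p = 1" if "p \<in> Qbox (2 * \<delta>)" for p
      using that by (simp add: \<phi>_def Qbox_def b(4))
    show "0 \<le> \<phi> p \<and> \<phi> p \<le> 1" for p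
      unfolding \<phi>_def by (auto intro!: mult_nonneg_nonneg mult_le_one prod_nonneg prod_le_1 b)
    show "csupp (Qbox \<delta>) \<phi>"
      unfolding csupp_def
    proof (intro conjI allI impI)
      show "smooth_on UNIV \<phi>"
        unfolding \<phi>_def
        by (intro smooth_on_mult smooth_on_prod smooth_on_compose[OF b(1)] smooth_on_coord) auto
      fix p :: "(real^'q) \<times> (real^'m)" assume "p \<notin> Qbox \<delta>"
      then consider i where "1 - \<delta> < \<bar>fst p $ i\<bar>" | i where "1 - \<delta> < \<bar>snd p $ i\<bar>"
        by (auto simp: Qbox_def not_le)
      then show "\<phi> p = 0"
      proof cases
        case 1
        then have "b (fst p $ i) = 0" by (intro b) simp
        then show ?thesis by (auto simp: \<phi>_def prod_zero_iff)
      next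
        case 2
        then have "b (snd p $ i) = 0" by (intro b) simp
        then show ?thesis by (auto simp: \<phi>_def prod_zero_iff)
      qed
    qed
  qed
qed

lemma jdist_triangle: "jdist r s u \<le> jdist r s t + jdist r t u"
  unfolding jdist_def jnorm_def sum.distrib[symmetric] by (intro sum_mono) linarith

lemma jnorm_mono:
  "(\<And>\<alpha> j. mdeg \<alpha> \<le> r \<Longrightarrow> \<bar>s \<alpha> j\<bar> \<le> \<bar>t \<alpha> j\<bar>) \<Longrightarrow> jnorm r s \<le> jnorm r t"
  unfolding jnorm_def by (intro sum_mono) auto

lemma jnorm_less:
  fixes s :: "('m::finite, 'n::finite) jetfib"
  assumes "\<And>\<alpha> j. mdeg \<alpha> \<le> r \<Longrightarrow> \<bar>s \<alpha> j\<bar> < e"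
    and "e * (real (card {\<alpha> :: 'm \<Rightarrow> nat. mdeg \<alpha> \<le> r}) * real CARD('n)) < \<epsilon>"
  shows "jnorm r s < \<epsilon>"
proof -
  have "jnorm r s \<le> (\<Sum>\<alpha>\<in>{\<alpha> :: 'm \<Rightarrow> nat. mdeg \<alpha> \<le> r}. \<Sum>j\<in>(UNIV :: 'n set). e)"
    unfolding jnorm_def by (intro sum_mono) (use assms(1) in \<open>auto intro: less_imp_le\<close>)
  also have "\<dots> = e * (real (card {\<alpha> :: 'm \<Rightarrow> nat. mdeg \<alpha> \<le> r}) * real CARD('n))" by simp
  finally show ?thesis using assms(2) by linarith
qed

lemma continuous_on_jnorm:
  fixes s :: "'a::topological_space \<Rightarrow> ('m::finite, 'n::finite) jetfib"
  assumes "\<And>\<alpha> j. mdeg \<alpha> \<le> r \<Longrightarrow> continuous_on S (\<lambda>p. s p \<alpha> j)"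
  shows "continuous_on S (\<lambda>p. jnorm r (s p))"
  unfolding jnorm_def by (intro continuous_on_sum continuous_on_rabs assms) auto

text \<open>The section is replaced by a globally smooth one supported in the interior of the cubes;
  the given neighbourhoods of the boundary need not be uniform in \<open>z\<close>, so the cut-off uses only that
  the section vanishes on the boundary.\<close>

lemma section_cutoff:
  fixes \<sigma> :: "real^'q \<Rightarrow> real^'m \<Rightarrow> ('m::finite, 'n::finite) jetfib"
  assumes smooth: "\<And>\<alpha> j. mdeg \<alpha> \<le> r \<Longrightarrow>
      smooth_near (icube \<times> icube) (\<lambda>p. \<sigma> (fst p) (snd p) \<alpha> j)"
    and zero: "\<And>z x \<alpha> j. z \<in> icube \<Longrightarrow> x \<in> icube \<Longrightarrow> z \<in> frontier icube \<or> x \<in> frontier icube \<Longrightarrow>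
      mdeg \<alpha> \<le> r \<Longrightarrow> \<sigma> z x \<alpha> j = 0"
    and low: "\<And>z x \<alpha> j. z \<in> icube \<Longrightarrow> x \<in> icube \<Longrightarrow> mdeg \<alpha> \<le> l \<Longrightarrow> \<sigma> z x \<alpha> j = 0"
    and \<epsilon>: "\<epsilon> > 0"
  obtains \<delta> and c :: "('m \<Rightarrow> nat) \<Rightarrow> 'n \<Rightarrow> (real^'q) \<times> (real^'m) \<Rightarrow> real"
  where "0 < \<delta>" "\<delta> \<le> 1 / 4" "\<And>\<alpha> j. csupp (Qbox \<delta>) (c \<alpha> j)" "\<And>\<alpha> j p. mdeg \<alpha> \<le> l \<Longrightarrow> c \<alpha> j p = 0"
    "\<And>z x. z \<in> icube \<Longrightarrow> x \<in> icube \<Longrightarrow> jdist r (\<lambda>\<alpha> j. c \<alpha> j (z, x)) (\<sigma> z x) < \<epsilon>"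
proof -
  define S where "S \<alpha> j = (SOME S. open S \<and> icube \<times> icube \<subseteq> S \<and>
      smooth_on S (\<lambda>p. \<sigma> (fst p) (snd p) \<alpha> j))" for \<alpha> j
  have S: "open (S \<alpha> j)" "icube \<times> icube \<subseteq> S \<alpha> j" "smooth_on (S \<alpha> j) (\<lambda>p. \<sigma> (fst p) (snd p) \<alpha> j)"
    if "mdeg \<alpha> \<le> r" for \<alpha> j
    using someI_ex[OF smooth[OF that, of j, unfolded smooth_near_def]] unfolding S_def by simp_all
  have cont: "continuous_on (icube \<times> icube) (\<lambda>p. jnorm r (\<sigma> (fst p) (snd p)))"
    by (intro continuous_on_jnorm continuous_on_subset[OF smooth_on_continuous_on[OF S(3)] S(2)])
  have z: "jnorm r (\<sigma> (fst (z, x)) (snd (z, x))) = 0"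
    if "z \<in> icube" "x \<in> icube" "z \<in> frontier icube \<or> x \<in> frontier icube" for z x
    using zero[OF that] by (simp add: jnorm_def)
  obtain \<delta> where \<delta>: "0 < \<delta>" "\<delta> \<le> 1 / 4"
    "\<And>z x. z \<in> icube \<Longrightarrow> x \<in> icube \<Longrightarrow> (\<exists>i. 1 - 2 * \<delta> < \<bar>z $ i\<bar>) \<or> (\<exists>i. 1 - 2 * \<delta> < \<bar>x $ i\<bar>) \<Longrightarrow>
      \<bar>jnorm r (\<sigma> (fst (z, x)) (snd (z, x)))\<bar> < \<epsilon>"
    by (rule small_near_frontier[OF cont \<epsilon> z], assumption+, rule that)
  obtain \<phi> :: "(real^'q) \<times> (real^'m) \<Rightarrow> real"
    where \<phi>: "csupp (Qbox \<delta>) \<phi>" "\<And>p. 0 \<le> \<phi> p \<and> \<phi> p \<le> 1" "\<And>p. p \<in> Qbox (2 * \<delta>) \<Longrightarrow> \<phi> p = 1"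
    by (rule box_cutoff_exists[OF \<delta>(1,2)], rule that)
  have Qi: "Qbox \<delta> \<subseteq> icube \<times> icube"
    using \<delta> by (auto simp: Qbox_def icube_def intro: order_trans[of _ "1 - \<delta>"])
  \<comment> \<open>The hypotheses say nothing about components of order above \<open>r\<close>, nor
    about \<open>\<sigma>\<close> outside \<open>S \<alpha> j\<close>; both are replaced by
    0.\<close>
  define c where "c \<alpha> j p = (if mdeg \<alpha> \<le> r then if p \<in> S \<alpha> j then \<phi> p * \<sigma> (fst p) (snd p) \<alpha> j else 0 else 0)"
    for \<alpha> j p
  show thesis
  proof (rule that[OF \<delta>(1,2), of c])
    show "csupp (Qbox \<delta>) (c \<alpha> j)" for \<alpha> j
    proof (cases "mdeg \<alpha> \<le> r")
      case True
      have "smooth_on UNIV (\<lambda>p. if p \<in> S \<alpha> j then \<phi> p * \<sigma> (fst p) (snd p) \<alpha> j else 0)"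
        by (rule smooth_on_extend_by_zero[OF csupp_smooth[OF \<phi>(1)] S(3)[OF True] closed_Qbox])
          (use Qi S(2)[OF True, of j] csupp_zero[OF \<phi>(1)] in auto)
      then show ?thesis using True csupp_zero[OF \<phi>(1)] by (simp add: csupp_def c_def[abs_def])
    next
      case False
      then have "c \<alpha> j = (\<lambda>_. 0)" by (auto simp: c_def)
      then show ?thesis by (simp add: csupp_0)
    qed
    show "c \<alpha> j p = 0" if "mdeg \<alpha> \<le> l" for \<alpha> j p
    proof (cases "p \<in> Qbox \<delta>")
      case True
      then have "\<sigma> (fst p) (snd p) \<alpha> j = 0" using Qi that by (intro low) auto
      then show ?thesis by (simp add: c_def)
    qed (simp add: c_def csupp_zero[OF \<phi>(1)])
    fix z :: "real^'q" and x :: "real^'m" assume zx: "z \<in> icube" "x \<in> icube"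
    have c: "c \<alpha> j (z, x) = \<phi> (z, x) * \<sigma> z x \<alpha> j" if "mdeg \<alpha> \<le> r" for \<alpha> j
      using S(2)[OF that, of j] zx that by (auto simp: c_def)
    show "jdist r (\<lambda>\<alpha> j. c \<alpha> j (z, x)) (\<sigma> z x) < \<epsilon>"
    proof (cases "(z, x) \<in> Qbox (2 * \<delta>)")
      case True
      then have "jdist r (\<lambda>\<alpha> j. c \<alpha> j (z, x)) (\<sigma> z x) = 0"
        by (simp add: jdist_def jnorm_def c \<phi>(3))
      then show ?thesis using \<epsilon> by simp
    next
      case False
      \<comment> \<open>In the boundary layer the section itself is small, and the factor
        \<open>1 - \<phi> (z, x)\<close> only shrinks it.\<close>
      have "jdist r (\<lambda>\<alpha> j. c \<alpha> j (z, x)) (\<sigma> z x) \<le> jnorm r (\<sigma> z x)"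
        unfolding jdist_def
      proof (rule jnorm_mono)
        fix \<alpha> :: "'m \<Rightarrow> nat" and j :: 'n assume "mdeg \<alpha> \<le> r"
        then have "c \<alpha> j (z, x) - \<sigma> z x \<alpha> j = - ((1 - \<phi> (z, x)) * \<sigma> z x \<alpha> j)"
          by (simp add: c algebra_simps)
        also have "\<bar>\<dots>\<bar> \<le> 1 * \<bar>\<sigma> z x \<alpha> j\<bar>"
          unfolding abs_minus_cancel abs_mult using \<phi>(2)[of "(z, x)"] by (intro mult_right_mono) auto
        finally show "\<bar>c \<alpha> j (z, x) - \<sigma> z x \<alpha> j\<bar> \<le> \<bar>\<sigma> z x \<alpha> j\<bar>" by simp
      qed
      also have "\<dots> < \<epsilon>"
      proof -
        have "(\<exists>i. 1 - 2 * \<delta> < \<bar>z $ i\<bar>) \<or> (\<exists>i. 1 - 2 * \<delta> < \<bar>x $ i\<bar>)"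
          using False by (auto simp: Qbox_def not_le)
        from \<delta>(3)[OF zx this] show ?thesis by simp
      qed
      finally show ?thesis .
    qed
  qed
qed

lemma open_coord: "open {x :: real^'a. \<exists>i. a < \<bar>x $ i\<bar>}"
proof -
  have "{x :: real^'a. \<exists>i. a < \<bar>x $ i\<bar>} = (\<Union>i. {x. a < \<bar>x $ i\<bar>})" by auto
  also have "open \<dots>" by (intro open_UN ballI open_Collect_less continuous_intros)
  finally show ?thesis .
qed

lemma frontier_icube_subset:
  assumes "a < 1"
  shows "frontier icube \<subseteq> {x :: real^'a. \<exists>i. a < \<bar>x $ i\<bar>}"
proof
  fix x :: "real^'a" assume "x \<in> frontier icube"
  then obtain i where "\<bar>x $ i\<bar> = 1" by (auto simp: frontier_icube)
  then have "a < \<bar>x $ i\<bar>" using assms by simp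
  then show "x \<in> {x. \<exists>i. a < \<bar>x $ i\<bar>}" by blast
qed

section \<open>The isotopy and the holonomic family\<close>

theorem mainTheorem9:
  fixes \<sigma> :: "real^'q \<Rightarrow> real^'m \<Rightarrow> ('m, 'n::finite) jetfib"
    and K :: "'m set" and k r l :: nat
  assumes "card K = k" and "k < CARD('m)" and "l < r"
    and smooth: "\<forall>\<alpha> j. mdeg \<alpha> \<le> r \<longrightarrow>
                  smooth_near (icube \<times> icube) (\<lambda>p. \<sigma> (fst p) (snd p) \<alpha> j)"
    and bdry_m: "\<forall>z\<in>icube. \<exists>U. open U \<and> frontier icube \<subseteq> U \<and>
                  (\<forall>x\<in>U \<inter> icube. \<forall>\<alpha> j. mdeg \<alpha> \<le> r \<longrightarrow> \<sigma> z x \<alpha> j = 0)"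
    and low: "\<forall>z\<in>icube. \<forall>x\<in>icube. \<forall>\<alpha> j. mdeg \<alpha> \<le> l \<longrightarrow> \<sigma> z x \<alpha> j = 0"
    and bdry_q: "\<exists>V. open V \<and> frontier icube \<subseteq> V \<and>
                  (\<forall>z\<in>V \<inter> icube. \<forall>x\<in>icube. \<forall>\<alpha> j. mdeg \<alpha> \<le> r \<longrightarrow> \<sigma> z x \<alpha> j = 0)"
    and "\<epsilon> > 0"
  shows "\<exists>(F :: real^'q \<Rightarrow> real \<Rightarrow> real^'m \<Rightarrow> real^'m) G (h :: real^'q \<Rightarrow> real^'m \<Rightarrow> real^'n).
    \<comment> \<open>F is a smooth family of isotopies of I^m, with smooth inverses G, starting at id\<close>
    smooth_near (icube \<times> {0..1} \<times> icube) (\<lambda>(z, t, x). F z t x) \<and>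
    smooth_near (icube \<times> {0..1} \<times> icube) (\<lambda>(z, t, x). G z t x) \<and>
    (\<forall>z\<in>icube. \<forall>t\<in>{0..1}. \<forall>x\<in>icube.
        F z t x \<in> icube \<and> G z t x \<in> icube \<and> G z t (F z t x) = x \<and> F z t (G z t x) = x) \<and>
    (\<forall>z\<in>icube. \<forall>x\<in>icube. F z 0 x = x) \<and>
    \<comment> \<open>the holonomic sections are the r-jets of the smooth family h\<close>
    smooth_near (icube \<times> icube) (\<lambda>(z, x). h z x) \<and>
    (\<forall>z\<in>icube. \<exists>U. open U \<and> F z 1 ` isubcube K \<subseteq> U \<and>
        (\<forall>x\<in>U \<inter> icube. jdist r (jet (h z) x) (\<sigma> z x) < \<epsilon>)) \<and>
    (\<forall>z\<in>icube. \<forall>x\<in>icube. jnorm l (jet (h z) x) < \<epsilon>) \<and>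
    (\<forall>z\<in>icube. \<forall>t\<in>{0..1}. \<forall>x\<in>icube. dist (F z t x) x < \<epsilon>) \<and>
    (\<forall>z\<in>icube. \<exists>U. open U \<and> frontier icube \<subseteq> U \<and>
        (\<forall>x\<in>U \<inter> icube. (\<forall>t\<in>{0..1}. F z t x = x) \<and>
            (\<forall>\<alpha> j. mdeg \<alpha> \<le> r \<longrightarrow> jet (h z) x \<alpha> j = 0))) \<and>
    (\<exists>V. open V \<and> frontier icube \<subseteq> V \<and>
        (\<forall>z\<in>V \<inter> icube. \<forall>x\<in>icube. (\<forall>t\<in>{0..1}. F z t x = x) \<and>
            (\<forall>\<alpha> j. mdeg \<alpha> \<le> r \<longrightarrow> jet (h z) x \<alpha> j = 0)))"
proof -
  \<comment> \<open>\<open>card K < CARD('m)\<close> leaves a direction transverse to the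
    sub-cube.\<close>
  obtain i0 where i0: "i0 \<notin> K"
  proof -
    have "K \<noteq> UNIV" using assms(1,2) by auto
    then show thesis using that by blast
  qed
  have z0: "\<sigma> z x \<alpha> j = 0"
    if "z \<in> icube" "x \<in> icube" "z \<in> frontier icube \<or> x \<in> frontier icube" "mdeg \<alpha> \<le> r" for z x \<alpha> j
    using that(3)
  proof
    assume "z \<in> frontier icube"
    then show ?thesis using bdry_q that by blast
  next
    assume "x \<in> frontier icube"
    then show ?thesis using bdry_m[rule_format, OF that(1)] that by blast
  qed
  have \<epsilon>2: "\<epsilon> / 2 > 0" using \<open>\<epsilon> > 0\<close> by simp
  obtain \<delta> and c :: "('m \<Rightarrow> nat) \<Rightarrow> 'n \<Rightarrow> (real^'q) \<times> (real^'m) \<Rightarrow> real"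
    where \<delta>: "0 < \<delta>" "\<delta> \<le> 1 / 4" and c: "\<And>\<alpha> j. csupp (Qbox \<delta>) (c \<alpha> j)"
      and c_low: "\<And>\<alpha> j p. mdeg \<alpha> \<le> l \<Longrightarrow> c \<alpha> j p = 0"
      and c_near: "\<And>z x. z \<in> icube \<Longrightarrow> x \<in> icube \<Longrightarrow> jdist r (\<lambda>\<alpha> j. c \<alpha> j (z, x)) (\<sigma> z x) < \<epsilon> / 2"
    by (rule section_cutoff[OF smooth[rule_format] z0 low[rule_format] \<epsilon>2], assumption+, rule that)
  obtain \<beta> :: "real \<Rightarrow> real" and H :: "real \<Rightarrow> real \<Rightarrow> real" and s0 :: real
    where \<beta>: "smooth_on UNIV \<beta>" "\<beta> 0 = 1" "\<And>y. \<bar>\<beta> y\<bar> \<le> 1" "\<And>y. 3 / 4 \<le> \<bar>y\<bar> \<Longrightarrow> \<beta> y = 0"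
      and s0: "0 < s0" "s0 \<le> 1 / 4"
      and smH: "smooth_on ({-s0<..<s0} \<times> UNIV) (\<lambda>p. H (fst p) (snd p))"
      and HF: "\<And>s y. \<bar>s\<bar> < s0 \<Longrightarrow> H s (y + s * \<beta> y) = y"
      and FH: "\<And>s y. \<bar>s\<bar> < s0 \<Longrightarrow> H s y + s * \<beta> (H s y) = y"
    by (rule fiber_isotopy_exists, rule that)
  define M where "M = real (card {\<alpha> :: 'm \<Rightarrow> nat. mdeg \<alpha> \<le> r}) * real CARD('n) + 1"
  have M: "M \<ge> 1" by (simp add: M_def)
  \<comment> \<open>The bound \<open>s0 / 2\<close> keeps
    \<open>\<bar>t * W (z, x)\<bar> < s0\<close> even for \<open>\<bar>t\<bar> < 2\<close>, which
    gives the inverse a neighbourhood of the time interval; \<open>\<epsilon> / (4 * M)\<close>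
    leaves less than \<open>\<epsilon> / 2\<close> after summing over all components of a
    jet.\<close>
  define e where "e = min (s0 / 2) (\<epsilon> / (4 * M))"
  have e: "e > 0" "e \<le> s0 / 2" using M s0 \<open>\<epsilon> > 0\<close> by (auto simp: e_def)
  have eM: "e * M < \<epsilon> / 2"
  proof -
    have "e * M \<le> \<epsilon> / (4 * M) * M" using M by (intro mult_right_mono) (auto simp: e_def)
    also have "\<dots> < \<epsilon> / 2" using M \<open>\<epsilon> > 0\<close> by simp
    finally show ?thesis .
  qed
  have small: "jnorm k s < \<epsilon> / 2" if "\<And>\<alpha> j. mdeg \<alpha> \<le> k \<Longrightarrow> \<bar>s \<alpha> j\<bar> < e" "k \<le> r" for k and s :: "('m, 'n) jetfib"
  proof (rule jnorm_less[OF that(1)])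
    have "card {\<alpha> :: 'm \<Rightarrow> nat. mdeg \<alpha> \<le> k} \<le> card {\<alpha> :: 'm \<Rightarrow> nat. mdeg \<alpha> \<le> r}"
      using that(2) by (intro card_mono finite_mdeg_le) auto
    then have "real (card {\<alpha> :: 'm \<Rightarrow> nat. mdeg \<alpha> \<le> k}) * real CARD('n) \<le> M"
      unfolding M_def by (intro add_increasing2 mult_right_mono) auto
    then have "e * (real (card {\<alpha> :: 'm \<Rightarrow> nat. mdeg \<alpha> \<le> k}) * real CARD('n)) \<le> e * M"
      using e by (intro mult_left_mono) auto
    then show "e * (real (card {\<alpha> :: 'm \<Rightarrow> nat. mdeg \<alpha> \<le> k}) * real CARD('n)) < \<epsilon> / 2"
      using eM by linarith
  qed
  have \<delta>1: "\<delta> < 1" using \<delta> by simp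
  have lr: "l \<le> r" using \<open>l < r\<close> by simp
  from jets_approximable_on_graph[where c = c and l = l and ?i0.0 = i0, OF \<delta>(1) \<delta>1 c c_low lr e(1)]
  obtain f :: "'n \<Rightarrow> (real^'q) \<times> (real^'m) \<Rightarrow> real" and W
    where f: "\<forall>j. csupp (Qbox \<delta>) (f j)" and W: "wig \<delta> i0 W" and We: "\<forall>p. \<bar>W p\<bar> < e"
      and f_low: "\<forall>\<alpha> j p. mdeg \<alpha> \<le> l \<longrightarrow> \<bar>pdl (ilist \<alpha>) (f j) p\<bar> < e"
      and f_graph: "\<forall>\<alpha> j p. mdeg \<alpha> \<le> r \<longrightarrow> snd p $ i0 = W p \<longrightarrow> \<bar>pdl (ilist \<alpha>) (f j) p - c \<alpha> j p\<bar> < e"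
    by blast
  note smf = csupp_smooth[OF f[rule_format]]
  let ?e = "axis i0 (1::real) :: real^'m"
  have e_nth: "?e $ i = (if i = i0 then 1 else 0)" for i by (simp add: axis_def)
  define h where "h z x = (\<chi> j. f j (z, x))" for z :: "real^'q" and x :: "real^'m"
  \<comment> \<open>Where \<open>x $ i0 = 0\<close> the factor \<open>\<beta>\<close> is 1, so time
    1 carries the sub-cube into the graph of \<open>W\<close>. Near the faces
    \<open>x $ i0 = 1\<close> and \<open>x $ i0 = - 1\<close> the motion is stopped by
    \<open>\<beta>\<close>, since \<open>W\<close> does not see that coordinate; near all other
    faces it is stopped by \<open>W\<close>.\<close>
  define F where "F z t x = x + (t * W (z, x) * \<beta> (x $ i0)) *\<^sub>R ?e" for z :: "real^'q" and t and x :: "real^'m"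
  \<comment> \<open>\<open>W\<close> takes the same value at a point and at its image, so the
    inverse is computed on each line along \<open>i0\<close> with \<open>t * W (z, x)\<close> as a
    constant.\<close>
  define G where "G z t x = x + (H (t * W (z, x)) (x $ i0) - x $ i0) *\<^sub>R ?e" for z :: "real^'q" and t and x :: "real^'m"
  have jet: "jet (h z) x \<alpha> j = pdl (ilist \<alpha>) (f j) (z, x)" for z x \<alpha> j
    unfolding jet_def h_def by (simp add: hpartial_eq_pdl[OF smf])
  have tW: "\<bar>t * W (z, x)\<bar> < e" if "t \<in> {0..1}" for t z x
  proof -
    have "\<bar>t * W (z, x)\<bar> \<le> 1 * \<bar>W (z, x)\<bar>"
      unfolding abs_mult using that by (intro mult_right_mono) auto
    then show ?thesis using We[rule_format, of "(z, x)"] by simp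
  qed
  have tWs: "\<bar>t * W (z, x)\<bar> < s0" if "t \<in> {0..1}" for t z x
    using tW[OF that, of z x] e s0 by linarith
  have F_nth: "F z t x $ i = (if i = i0 then x $ i0 + t * W (z, x) * \<beta> (x $ i0) else x $ i)" for z t x i
    by (simp add: F_def e_nth)
  have G_nth: "G z t x $ i = (if i = i0 then H (t * W (z, x)) (x $ i0) else x $ i)" for z t x i
    by (simp add: G_def e_nth)
  have WF: "W (z, F z t x) = W (z, x)" and WG: "W (z, G z t x) = W (z, x)" for z t x
    unfolding F_def G_def by (rule wig_shift[OF W])+
  have in1: "\<bar>y + s * \<beta> y\<bar> \<le> 1" if "\<bar>y\<bar> \<le> 1" "\<bar>s\<bar> < s0" for y s
  proof (cases "3 / 4 \<le> \<bar>y\<bar>")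
    case True
    then show ?thesis using that \<beta>(4) by simp
  next
    case False
    have "\<bar>s * \<beta> y\<bar> \<le> \<bar>s\<bar> * 1" unfolding abs_mult using \<beta>(3) by (intro mult_left_mono) auto
    then show ?thesis using False that(2) s0 by linarith
  qed
  have in2: "\<bar>H s y\<bar> \<le> 1" if "\<bar>y\<bar> \<le> 1" "\<bar>s\<bar> < s0" for y s
  proof (rule ccontr)
    assume *: "\<not> \<bar>H s y\<bar> \<le> 1"
    \<comment> \<open>Outside the interval \<open>\<beta>\<close> vanishes, so such a value would be
      equal to \<open>y\<close>.\<close>
    then have "\<beta> (H s y) = 0" by (intro \<beta>(4)) linarith
    then show False using FH[OF that(2), of y] that(1) * by simp
  qed
  have F_near: "F z t x = x" if t: "t \<in> {0..1}"
    and b: "(\<exists>i. 1 - \<delta> / 2 < \<bar>z $ i\<bar>) \<or> (\<exists>i. 1 - \<delta> / 2 < \<bar>x $ i\<bar>)" for z t x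
  proof -
    have "W (z, x) = 0 \<or> \<beta> (x $ i0) = 0"
    proof (cases "1 - \<delta> / 2 < \<bar>x $ i0\<bar>")
      case True
      then have "3 / 4 \<le> \<bar>x $ i0\<bar>" using \<delta> by linarith
      then show ?thesis using \<beta>(4) by blast
    next
      case False
      then have "(\<exists>i. 1 - \<delta> / 2 < \<bar>z $ i\<bar>) \<or> (\<exists>i. i \<noteq> i0 \<and> 1 - \<delta> / 2 < \<bar>x $ i\<bar>)" using b by metis
      then show ?thesis using wig_zero[OF W] by blast
    qed
    then show ?thesis by (auto simp: F_def)
  qed
  have jet_near: "jet (h z) x \<alpha> j = 0"
    if "(\<exists>i. 1 - \<delta> / 2 < \<bar>z $ i\<bar>) \<or> (\<exists>i. 1 - \<delta> / 2 < \<bar>x $ i\<bar>)" for z x \<alpha> j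
  proof -
    have "(z, x) \<notin> Qbox \<delta>"
    proof
      assume "(z, x) \<in> Qbox \<delta>"
      then have "\<bar>z $ i\<bar> \<le> 1 - \<delta>" "\<bar>x $ i'\<bar> \<le> 1 - \<delta>" for i i' by (auto simp: Qbox_def)
      then show False using that \<delta>(1) by (smt (verit) field_sum_of_halves)
    qed
    then show ?thesis
      unfolding jet by (rule csupp_zero[OF csupp_pdl[OF closed_Qbox f[rule_format]]])
  qed
  have lin: "smooth_on UNIV (\<lambda>p :: (real^'q) \<times> real \<times> (real^'m). fst (snd p))"
    "smooth_on UNIV (\<lambda>p :: (real^'q) \<times> real \<times> (real^'m). snd (snd p))"
    "smooth_on UNIV (\<lambda>p :: (real^'q) \<times> real \<times> (real^'m). snd (snd p) $ i0)"
    "smooth_on UNIV (\<lambda>p :: (real^'q) \<times> real \<times> (real^'m). (fst p, snd (snd p)))"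
    by (intro smooth_on_bounded_linear open_UNIV bounded_linear_Pair
        bounded_linear_vec_nth[THEN bounded_linear_compose]
        bounded_linear_fst[THEN bounded_linear_compose] bounded_linear_snd[THEN bounded_linear_compose]
        bounded_linear_fst bounded_linear_snd)+
  have smW: "smooth_on UNIV (\<lambda>p :: (real^'q) \<times> real \<times> (real^'m). W (fst p, snd (snd p)))"
    by (rule smooth_on_compose[OF wig_smooth[OF W] lin(4)]) simp
  have smtW: "smooth_on UNIV (\<lambda>p :: (real^'q) \<times> real \<times> (real^'m). fst (snd p) * W (fst p, snd (snd p)))"
    by (intro smooth_on_mult lin smW)
  show ?thesis
  proof (rule exI[of _ F], rule exI[of _ G], rule exI[of _ h], intro conjI ballI)
    show "smooth_near (icube \<times> {0..1} \<times> icube) (\<lambda>(z, t, x). F z t x)"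
      unfolding smooth_near_def
    proof (intro exI[of _ UNIV] conjI)
      have "smooth_on UNIV (\<lambda>p. F (fst p) (fst (snd p)) (snd (snd p)))"
        unfolding F_def
        by (intro smooth_on_add smooth_on_scaleR lin smooth_on_const open_UNIV smooth_on_mult[OF smtW]
            smooth_on_compose[OF \<beta>(1)]) auto
      then show "smooth_on UNIV (\<lambda>(z, t, x). F z t x)" by (simp add: case_prod_unfold)
    qed auto
    show "smooth_near (icube \<times> {0..1} \<times> icube) (\<lambda>(z, t, x). G z t x)"
      unfolding smooth_near_def
    proof (intro exI[of _ "UNIV \<times> {-2<..<2} \<times> UNIV"] conjI)
      let ?S = "UNIV \<times> {-2<..<2} \<times> UNIV :: ((real^'q) \<times> real \<times> (real^'m)) set"
      show S: "open ?S" by (intro open_Times) auto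
      show "icube \<times> {0..1} \<times> icube \<subseteq> ?S" by auto
      have pair: "smooth_on ?S (\<lambda>p. (fst (snd p) * W (fst p, snd (snd p)), snd (snd p) $ i0))"
        by (intro smooth_on_Pair smooth_on_subset[OF smtW] smooth_on_subset[OF lin(3)] S subset_UNIV)
      have "\<bar>t * W (z, x)\<bar> < s0" if "\<bar>t\<bar> < 2" for t z x
      proof -
        have "\<bar>t * W (z, x)\<bar> \<le> 2 * \<bar>W (z, x)\<bar>" unfolding abs_mult using that by (intro mult_right_mono) auto
        then show ?thesis using We[rule_format, of "(z, x)"] e by linarith
      qed
      then have "(fst (snd p) * W (fst p, snd (snd p)), snd (snd p) $ i0) \<in> {-s0<..<s0} \<times> UNIV" if "p \<in> ?S" for p
        using that by (auto simp: abs_less_iff minus_less_iff)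
      from smooth_on_compose[OF smH pair this]
      have "smooth_on ?S (\<lambda>p. H (fst (snd p) * W (fst p, snd (snd p))) (snd (snd p) $ i0))" by simp
      then have "smooth_on ?S (\<lambda>p. G (fst p) (fst (snd p)) (snd (snd p)))"
        unfolding G_def
        by (intro smooth_on_add smooth_on_scaleR smooth_on_diff smooth_on_const S
            smooth_on_subset[OF lin(2)] smooth_on_subset[OF lin(3)] subset_UNIV)
      then show "smooth_on ?S (\<lambda>(z, t, x). G z t x)" by (simp add: case_prod_unfold)
    qed
    fix z :: "real^'q" assume z: "z \<in> icube"
    show "F z 0 x = x" for x by (simp add: F_def)
    show "F z t x \<in> icube" "G z t x \<in> icube" "G z t (F z t x) = x" "F z t (G z t x) = x" "dist (F z t x) x < \<epsilon>"
      if t: "t \<in> {0..1}" and x: "x \<in> icube" for t x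
    proof -
      have xi: "\<bar>x $ i\<bar> \<le> 1" for i using x by (simp add: icube_def)
      show "F z t x \<in> icube" "G z t x \<in> icube"
        using xi in1[OF xi tWs[OF t]] in2[OF xi tWs[OF t]] by (auto simp: icube_def F_nth G_nth)
      show "G z t (F z t x) = x"
        by (simp add: vec_eq_iff G_nth F_nth WF HF[OF tWs[OF t]])
      show "F z t (G z t x) = x"
        by (simp add: vec_eq_iff G_nth F_nth WG FH[OF tWs[OF t]])
      have "dist (F z t x) x = \<bar>t * W (z, x)\<bar> * \<bar>\<beta> (x $ i0)\<bar>"
        by (simp add: F_def dist_norm abs_mult)
      also have "\<dots> \<le> \<bar>t * W (z, x)\<bar> * 1" using \<beta>(3) by (intro mult_left_mono) auto
      also have "\<dots> < \<epsilon>"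
      proof -
        have "e * 1 \<le> e * M" using M e by (intro mult_left_mono) auto
        then show ?thesis using tW[OF t, of z x] eM \<open>\<epsilon> > 0\<close> by linarith
      qed
      finally show "dist (F z t x) x < \<epsilon>" .
    qed
    show "jnorm l (jet (h z) x) < \<epsilon>" for x
    proof -
      have "jnorm l (jet (h z) x) < \<epsilon> / 2"
        by (rule small) (use f_low lr in \<open>auto simp: jet\<close>)
      then show ?thesis using \<open>\<epsilon> > 0\<close> by linarith
    qed
    show "\<exists>U. open U \<and> F z 1 ` isubcube K \<subseteq> U \<and> (\<forall>x\<in>U \<inter> icube. jdist r (jet (h z) x) (\<sigma> z x) < \<epsilon>)"
    proof (intro exI conjI ballI)
      \<comment> \<open>Openness comes from comparing with \<open>c\<close>, which is continuous on
        the whole space; \<open>c_near\<close> replaces \<open>c\<close> by \<open>\<sigma>\<close>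
        on the cube for another \<open>\<epsilon> / 2\<close>.\<close>
      let ?U = "{x. jdist r (jet (h z) x) (\<lambda>\<alpha> j. c \<alpha> j (z, x)) < \<epsilon> / 2}"
      have cont: "continuous_on UNIV (\<lambda>x. g (z, x))" if "smooth_on UNIV g" for g :: "(real^'q) \<times> (real^'m) \<Rightarrow> real"
        by (rule continuous_on_compose2[OF smooth_on_continuous_on[OF that]]) (auto intro!: continuous_intros)
      show "open ?U"
        unfolding jdist_def jet
        by (intro open_Collect_less continuous_on_jnorm continuous_on_diff cont smooth_on_pdl smf
            csupp_smooth[OF c] continuous_on_const)
      show "F z 1 ` isubcube K \<subseteq> ?U"
      proof clarify
        fix x assume x: "x \<in> isubcube K"
        then have "x $ i0 = 0" using i0 by (simp add: isubcube_def)
        then have "snd (z, F z 1 x) $ i0 = W (z, F z 1 x)" by (simp add: F_nth WF \<beta>)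
        then show "jdist r (jet (h z) (F z 1 x)) (\<lambda>\<alpha> j. c \<alpha> j (z, F z 1 x)) < \<epsilon> / 2"
          unfolding jdist_def jet using f_graph by (intro small) auto
      qed
      fix x assume x: "x \<in> ?U \<inter> icube"
      then have "jdist r (jet (h z) x) (\<sigma> z x) < \<epsilon> / 2 + \<epsilon> / 2"
        using c_near[OF z, of x] by (intro le_less_trans[OF jdist_triangle add_strict_mono]) auto
      then show "jdist r (jet (h z) x) (\<sigma> z x) < \<epsilon>" by simp
    qed
    show "\<exists>U. open U \<and> frontier icube \<subseteq> U \<and> (\<forall>x\<in>U \<inter> icube. (\<forall>t\<in>{0..1}. F z t x = x) \<and>
        (\<forall>\<alpha> j. mdeg \<alpha> \<le> r \<longrightarrow> jet (h z) x \<alpha> j = 0))"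
    proof (intro exI[of _ "{x. \<exists>i. 1 - \<delta> / 2 < \<bar>x $ i\<bar>}"] conjI)
      show "frontier icube \<subseteq> {x :: real^'m. \<exists>i. 1 - \<delta> / 2 < \<bar>x $ i\<bar>}"
        by (rule frontier_icube_subset) (use \<delta> in simp)
      show "\<forall>x\<in>{x. \<exists>i. 1 - \<delta> / 2 < \<bar>x $ i\<bar>} \<inter> icube. (\<forall>t\<in>{0..1}. F z t x = x) \<and>
        (\<forall>\<alpha> j. mdeg \<alpha> \<le> r \<longrightarrow> jet (h z) x \<alpha> j = 0)"
        using F_near jet_near by blast
    qed (rule open_coord)
  next
    show "smooth_near (icube \<times> icube) (\<lambda>(z, x). h z x)"
      unfolding smooth_near_def
    proof (intro exI[of _ UNIV] conjI)
      show "smooth_on UNIV (\<lambda>(z, x). h z x)"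
        by (rule smooth_on_vec) (simp_all add: h_def case_prod_unfold smf)
    qed auto
    show "\<exists>V. open V \<and> frontier icube \<subseteq> V \<and> (\<forall>z\<in>V \<inter> icube. \<forall>x\<in>icube. (\<forall>t\<in>{0..1}. F z t x = x) \<and>
        (\<forall>\<alpha> j. mdeg \<alpha> \<le> r \<longrightarrow> jet (h z) x \<alpha> j = 0))"
    proof (intro exI[of _ "{z. \<exists>i. 1 - \<delta> / 2 < \<bar>z $ i\<bar>}"] conjI)
      show "frontier icube \<subseteq> {z :: real^'q. \<exists>i. 1 - \<delta> / 2 < \<bar>z $ i\<bar>}"
        by (rule frontier_icube_subset) (use \<delta> in simp)
      show "\<forall>z\<in>{z. \<exists>i. 1 - \<delta> / 2 < \<bar>z $ i\<bar>} \<inter> icube. \<forall>x\<in>icube. (\<forall>t\<in>{0..1}. F z t x = x) \<and>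
        (\<forall>\<alpha> j. mdeg \<alpha> \<le> r \<longrightarrow> jet (h z) x \<alpha> j = 0)"
        using F_near jet_near by blast
    qed (rule open_coord)
  qed
qed

end
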